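(* Let $\mathcal H=(\mathcal H_L,\mathcal H_R,S)$ be a finitely generated projective Hopf algebroid (over a commutative ring $k$) with a bijective antipode and let $B\subset A$ be an $\mathcal H$-extension. (1) Suppose that $(A\otimes_kA)^{co\mathcal H}=A\otimes_kB$ (this holds e.g. if $A$ is $k$-flat). If the canonical map $$\mathrm{can}_R:A\otimes_BA\to A\otimes_RH,\qquad a\otimes_Ba'\mapsto a\,a'^{\langle0\rangle}\otimes_Ra'^{\langle1\rangle}$$ is surjective, then the extension $B\subset A$ is $\mathcal H_R$-Galois (equivalently, $\mathcal H_L$-Galois). (2) If the extension $B\subset A$ is $\mathcal H$-Galois, then $A$ is projective both as a left and as a right $B$-module.
   Context: Conventions. $k$ is a commutative ring; "algebra" means associative unital $k$-algebra. For an algebra $R$, an $R$-ring is a monoid and an $R$-coring is a comonoid in the monoidal category of $R$-$R$ bimodules. Summation is implied in all Sweedler-type notations. Left bialgebroid $(H,L,s,t,\gamma,\pi)$: algebras $H,L$; algebra maps $s:L\to H$, $t:L^{op}\to H$ with commuting images; an $L$-coring structure $(H,\gamma,\pi)$ on the bimodule $l\cdot h\cdot l'=s(l)t(l')h$, with $\gamma(h)=h_{(1)}\otimes_L h_{(2)}$, such that $h_{(1)}t(l)\otimes_L h_{(2)}=h_{(1)}\otimes_L h_{(2)}s(l)$, $\gamma(1_H)=1_H\otimes_L 1_H$, $\gamma(hh')=\gamma(h)\gamma(h')$, $\pi(1_H)=1_L$, $\pi(h\,s(\pi(h')))=\pi(hh')=\pi(h\,t(\pi(h')))$. Right bialgebroid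 $(H,R,s,t,\gamma,\pi)$: algebras $H,R$; algebra maps $s:R\to H$, $t:R^{op}\to H$ with commuting images; an $R$-coring structure $(H,\gamma,\pi)$ on the bimodule $r\cdot h\cdot r'=h\,t(r)s(r')$, with $\gamma(h)=h^{(1)}\otimes_R h^{(2)}$, such that $s(r)h^{(1)}\otimes_R h^{(2)}=h^{(1)}\otimes_R t(r)h^{(2)}$, $\gamma(1_H)=1_H\otimes_R 1_H$, $\gamma(hh')=\gamma(h)\gamma(h')$, $\pi(1_H)=1_R$, $\pi(s(\pi(h))h')=\pi(hh')=\pi(t(\pi(h))h')$. Hopf algebroid $\mathcal H=(\mathcal H_L,\mathcal H_R,S)$: a left bialgebroid $\mathcal H_L=(H,L,s_L,t_L,\gamma_L,\pi_L)$ and a right bialgebroid $\mathcal H_R=(H,R,s_R,t_R,\gamma_R,\pi_R)$ on the same algebra $H$, and a $k$-module map $S:H\to H$ (the antipode), with $\gamma_L(h)=h_{(1)}\otimes_L h_{(2)}$, $\gamma_R(h)=h^{(1)}\otimes_R h^{(2)}$, such that (i) $s_L\pi_Lt_R=t_R$, $t_L\pi_Ls_R=s_R$, $s_R\pi_Rt_L=t_L$, $t_R\pi_Rs_L=s_L$; (ii) $(\gamma_L\otimes_R H)\gamma_R=(H\otimes_L\gamma_R)\gamma_L$ and $(\gamma_R\otimes_L H)\gamma_L=(H\otimes_R\gamma_L)\gamma_R$ (tensor products over $L$ with respect to $h\cdot l=t_L(l)h$, $l\cdot h=s_L(l)h$, and over $R$ with respect to $h\cdot r=hs_R(r)$, $r\cdot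 h=ht_R(r)$); (iii) $S(t_L(l)ht_L(l'))=s_L(l')S(h)s_L(l)$ and $S(t_R(r)ht_R(r'))=s_R(r')S(h)s_R(r)$; (iv) $S(h_{(1)})h_{(2)}=s_R(\pi_R(h))$ and $h^{(1)}S(h^{(2)})=s_L(\pi_L(h))$. It is finitely generated projective if $H$ is a finitely generated projective module for each of the four module structures $h\cdot r=hs_R(r)$, $r\cdot h=ht_R(r)$, $h\cdot l=t_L(l)h$, $l\cdot h=s_L(l)h$. Comodules and comodule algebras. A right comodule of a right bialgebroid $\mathcal H_R$ is a right comodule $(M,\tau_R)$ of the $R$-coring $(H,\gamma_R,\pi_R)$, $\tau_R(m)=m^{\langle0\rangle}\otimes_R m^{\langle1\rangle}$; it is an $R$-$R$ bimodule with left action $r\cdot m=m^{\langle0\rangle}\cdot\pi_R(s_R(r)m^{\langle1\rangle})$, and satisfies $r\cdot m^{\langle0\rangle}\otimes_R m^{\langle1\rangle}=m^{\langle0\rangle}\otimes_R t_R(r)m^{\langle1\rangle}$. A right $\mathcal H_R$-comodule algebra is an $R$-ring $A$ (with this bimodule structure) which is a right $\mathcal H_R$-comodule with $\tau_R(1_A)=1_A\otimes_R1_H$ and $\tau_R(aa')=a^{\langle0\rangle}a'^{\langle0\rangle}\otimes_R a^{\langle1\rangle}a'^{\langle1\rangle}$. A right comodule of a left bialgebroid $\mathcal H_L$ is a right comodule $(M,\tau_L)$ of the $L$-coring $(H,\gamma_L,\pi_L)$, $\tau_L(m)=m_{\langle0\rangle}\otimes_L m_{\langle1\rangle}$; it is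 an $L$-$L$ bimodule with left action $l\cdot m=m_{\langle0\rangle}\cdot\pi_L(m_{\langle1\rangle}s_L(l))$, and satisfies $l\cdot m_{\langle0\rangle}\otimes_L m_{\langle1\rangle}=m_{\langle0\rangle}\otimes_L m_{\langle1\rangle}s_L(l)$. A right $\mathcal H_L$-comodule algebra is an algebra $A$ which is a right $\mathcal H_L$-comodule and an $L^{op}$-ring, i.e. $a\cdot l=(1_A\cdot l)a$, $l\cdot a=a(1_A\cdot l)$, $l\cdot 1_A=1_A\cdot l$, with $\tau_L(1_A)=1_A\otimes_L1_H$ and $\tau_L(aa')=a_{\langle0\rangle}a'_{\langle0\rangle}\otimes_L a_{\langle1\rangle}a'_{\langle1\rangle}$. A right comodule of the Hopf algebroid $\mathcal H$ is a triple $(M,\tau_L,\tau_R)$ with $(M,\tau_R)$ a right $\mathcal H_R$-comodule and $(M,\tau_L)$ a right $\mathcal H_L$-comodule such that $l\cdot m\cdot l'=\pi_R(t_L(l'))\cdot m\cdot\pi_R(t_L(l))$ for $l,l'\in L$, and $(\tau_R\otimes_LH)\tau_L=(M\otimes_R\gamma_L)\tau_R$, $(\tau_L\otimes_RH)\tau_R=(M\otimes_L\gamma_R)\tau_L$. A right $\mathcal H$-comodule algebra is a right $\mathcal H$-comodule $(A,\tau_L,\tau_R)$ such that $A$ is an algebra, $(A,\tau_R)$ is a right $\mathcal H_R$-comodule algebra and $(A,\tau_L)$ is a right $\mathcal H_L$-comodule algebra. Extensions. Let the antipode be bijective. For a right $\mathcal H$-comodule algebra $A$, the $\mathcal H_R$-coinvariants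 $\{a:\tau_R(a)=a\otimes_R1_H\}$ and the $\mathcal H_L$-coinvariants $\{a:\tau_L(a)=a\otimes_L1_H\}$ form the same subalgebra $B$; then $B\subset A$ is called an $\mathcal H$-extension. It is $\mathcal H_R$-Galois if $\mathrm{can}_R$ is bijective, and $\mathcal H_L$-Galois if $\mathrm{can}_L:A\otimes_BA\to A\otimes_LH$, $a\otimes_Ba'\mapsto a_{\langle0\rangle}a'\otimes_La_{\langle1\rangle}$ is bijective; these are equivalent, and $B\subset A$ is called $\mathcal H$-Galois if both hold. $A\otimes_kA$ is an $\mathcal H$-comodule via the second tensor factor, and $(A\otimes_kA)^{co\mathcal H}$ denotes its coinvariants, i.e. the elements $x$ with $(A\otimes_k\tau_R)(x)=x\otimes_R1_H$. The condition $(A\otimes_kA)^{co\mathcal H}=A\otimes_kB$ means that the natural map $A\otimes_kB\to(A\otimes_kA)^{co\mathcal H}$ is bijective. *)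

theory Defs
  imports "HOL-Library.Poly_Mapping" "HOL-Computational_Algebra.Group_Closure"
begin

text \<open>Rings are types of sort \<open>{ring, monoid_mult}\<close> rather than \<open>ring_1\<close>: the latter
  excludes the zero ring.\<close>

section \<open>Algebras and modules over a commutative ring\<close>

locale k_module =
  fixes sc :: "'k::{comm_ring,monoid_mult} \<Rightarrow> 'm::ab_group_add \<Rightarrow> 'm"
  assumes sc_add_right: "sc c (x + y) = sc c x + sc c y"
    and sc_add_left: "sc (c + d) x = sc c x + sc d x"
    and sc_sc: "sc (c * d) x = sc c (sc d x)"
    and sc_one: "sc 1 x = x"

locale k_algebra = k_module sc
  for sc :: "'k::{comm_ring,monoid_mult} \<Rightarrow> 'a::{ring,monoid_mult} \<Rightarrow> 'a" +
  assumes sc_mult_left: "sc c (x * y) = sc c x * y"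
    and sc_mult_right: "sc c (x * y) = x * sc c y"

locale algebra_map =
  fixes kA :: "'k \<Rightarrow> 'a::{ring,monoid_mult} \<Rightarrow> 'a"
    and kB :: "'k \<Rightarrow> 'b::{ring,monoid_mult} \<Rightarrow> 'b"
    and f :: "'a \<Rightarrow> 'b"
  assumes map_add: "f (x + y) = f x + f y"
    and map_mult: "f (x * y) = f x * f y"
    and map_one: "f 1 = 1"
    and map_scale: "f (kA c x) = kB c (f x)"

text \<open>Algebra maps from the opposite algebra of \<open>'a\<close>.\<close>

locale algebra_antimap =
  fixes kA :: "'k \<Rightarrow> 'a::{ring,monoid_mult} \<Rightarrow> 'a"
    and kB :: "'k \<Rightarrow> 'b::{ring,monoid_mult} \<Rightarrow> 'b"
    and f :: "'a \<Rightarrow> 'b"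
  assumes map_add: "f (x + y) = f x + f y"
    and map_mult: "f (x * y) = f y * f x"
    and map_one: "f 1 = 1"
    and map_scale: "f (kA c x) = kB c (f x)"

text \<open>Modules over a \<open>k\<close>-algebra; the underlying \<open>k\<close>-module structure is the one induced
  through the algebra.\<close>

locale left_module = k_module kM
  for kR :: "'k::{comm_ring,monoid_mult} \<Rightarrow> 'r::{ring,monoid_mult} \<Rightarrow> 'r"
    and kM :: "'k \<Rightarrow> 'm::ab_group_add \<Rightarrow> 'm"
    and la :: "'r \<Rightarrow> 'm \<Rightarrow> 'm" +
  assumes la_add_right: "la r (m + m') = la r m + la r m'"
    and la_add_left: "la (r + r') m = la r m + la r' m"
    and la_la: "la (r * r') m = la r (la r' m)"
    and la_one: "la 1 m = m"
    and la_scale_left: "la (kR c r) m = kM c (la r m)"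
    and la_scale_right: "la r (kM c m) = kM c (la r m)"

locale right_module = k_module kM
  for kR :: "'k::{comm_ring,monoid_mult} \<Rightarrow> 'r::{ring,monoid_mult} \<Rightarrow> 'r"
    and kM :: "'k \<Rightarrow> 'm::ab_group_add \<Rightarrow> 'm"
    and ra :: "'m \<Rightarrow> 'r \<Rightarrow> 'm" +
  assumes ra_add_left: "ra (m + m') r = ra m r + ra m' r"
    and ra_add_right: "ra m (r + r') = ra m r + ra m r'"
    and ra_ra: "ra m (r * r') = ra (ra m r) r'"
    and ra_one: "ra m 1 = m"
    and ra_scale_right: "ra m (kR c r) = kM c (ra m r)"
    and ra_scale_left: "ra (kM c m) r = kM c (ra m r)"

locale bimodule = left_module kR kM la + right_module kR kM ra
  for kR :: "'k::{comm_ring,monoid_mult} \<Rightarrow> 'r::{ring,monoid_mult} \<Rightarrow> 'r"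
    and kM :: "'k \<Rightarrow> 'm::ab_group_add \<Rightarrow> 'm"
    and la :: "'r \<Rightarrow> 'm \<Rightarrow> 'm"
    and ra :: "'m \<Rightarrow> 'r \<Rightarrow> 'm" +
  assumes la_ra: "ra (la r m) r' = la r (ra m r')"

text \<open>Finite generation and projectivity, for modules over a ring whose elements form the subset
  \<open>B\<close> of a type and whose multiplication is \<open>mul\<close>, acting from the left by \<open>act\<close>. Right modules
  are obtained by taking the opposite multiplication. A module is projective if it is a direct
  summand of (i.e. a retract of) a free module. Nothing is lost by using only the free module
  whose basis is the underlying set of the module: if a module is a summand of some free
  module, then the canonical surjection from that particular free module onto it splits.\<close>

definition finitely_generated ::
    "'b set \<Rightarrow> ('b \<Rightarrow> 'm::ab_group_add \<Rightarrow> 'm) \<Rightarrow> bool" where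
  "finitely_generated B act \<longleftrightarrow>
     (\<exists>X. finite X \<and> (\<forall>m. \<exists>c. (\<forall>x\<in>X. c x \<in> B) \<and> m = (\<Sum>x\<in>X. act (c x) x)))"

definition free_module :: "'b::ab_group_add set \<Rightarrow> ('x \<Rightarrow>\<^sub>0 'b) set" where
  "free_module B = {f. \<forall>x. Poly_Mapping.lookup f x \<in> B}"

definition projective ::
    "'b::ab_group_add set \<Rightarrow> ('b \<Rightarrow> 'b \<Rightarrow> 'b) \<Rightarrow> ('b \<Rightarrow> 'm::ab_group_add \<Rightarrow> 'm) \<Rightarrow> bool" where
  "projective B mul act \<longleftrightarrow>
     (\<exists>(i :: 'm \<Rightarrow> 'm \<Rightarrow>\<^sub>0 'b) (p :: ('m \<Rightarrow>\<^sub>0 'b) \<Rightarrow> 'm).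
        range i \<subseteq> free_module B \<and>
        (\<forall>m m'. i (m + m') = i m + i m') \<and>
        (\<forall>b\<in>B. \<forall>m. i (act b m) = Poly_Mapping.map (mul b) (i m)) \<and>
        (\<forall>f\<in>free_module B. \<forall>g\<in>free_module B. p (f + g) = p f + p g) \<and>
        (\<forall>b\<in>B. \<forall>f\<in>free_module B. p (Poly_Mapping.map (mul b) f) = act b (p f)) \<and>
        (\<forall>m. p (i m) = m))"

definition left_projective ::
    "'b::ring set \<Rightarrow> ('b \<Rightarrow> 'm::ab_group_add \<Rightarrow> 'm) \<Rightarrow> bool" where
  "left_projective B la \<longleftrightarrow> projective B (*) la"

definition right_projective ::
    "'b::ring set \<Rightarrow> ('m::ab_group_add \<Rightarrow> 'b \<Rightarrow> 'm) \<Rightarrow> bool" where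
  "right_projective B ra \<longleftrightarrow> projective B (\<lambda>b c. c * b) (\<lambda>b m. ra m b)"

section \<open>Tensor products\<close>

text \<open>\<open>M \<otimes>\<^sub>S N\<close> is the free abelian group on \<open>M \<times> N\<close> modulo the usual relations; its elements are
  the cosets. Over a \<open>k\<close>-algebra \<open>S\<close> this is also the tensor product in \<open>k\<close>-modules. Threefold
  tensor products are formed in one step, with both balancing relations, so that no
  associativity isomorphisms are needed.\<close>

type_synonym 'x frag = "'x \<Rightarrow>\<^sub>0 int"

definition coset :: "'x frag set \<Rightarrow> 'x frag \<Rightarrow> 'x frag set" where
  "coset K x = {y. y - x \<in> K}"

definition coset_add :: "'x frag set \<Rightarrow> 'x frag set \<Rightarrow> 'x frag set" where
  "coset_add X Y = {x + y |x y. x \<in> X \<and> y \<in> Y}"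

definition tensor_ker_on ::
    "'m set \<Rightarrow> ('m \<Rightarrow> 'm \<Rightarrow> 'm) \<Rightarrow> 'n set \<Rightarrow> ('n \<Rightarrow> 'n \<Rightarrow> 'n) \<Rightarrow> 's set
      \<Rightarrow> ('m \<Rightarrow> 's \<Rightarrow> 'm) \<Rightarrow> ('s \<Rightarrow> 'n \<Rightarrow> 'n) \<Rightarrow> ('m \<times> 'n) frag set" where
  "tensor_ker_on M addM N addN S ra la = group_closure
     ({frag_of (addM m m', n) - frag_of (m, n) - frag_of (m', n) |m m' n.
         m \<in> M \<and> m' \<in> M \<and> n \<in> N} \<union>
      {frag_of (m, addN n n') - frag_of (m, n) - frag_of (m, n') |m n n'.
         m \<in> M \<and> n \<in> N \<and> n' \<in> N} \<union>
      {frag_of (ra m s, n) - frag_of (m, la s n) |m s n. m \<in> M \<and> s \<in> S \<and> n \<in> N})"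

definition tensor_on :: "'m set \<Rightarrow> 'n set \<Rightarrow> ('m \<times> 'n) frag set \<Rightarrow> ('m \<times> 'n) frag set set" where
  "tensor_on M N K = coset K ` {x. Poly_Mapping.keys x \<subseteq> M \<times> N}"

definition tensor_ker ::
    "('m::ab_group_add \<Rightarrow> 's \<Rightarrow> 'm) \<Rightarrow> ('s \<Rightarrow> 'n::ab_group_add \<Rightarrow> 'n) \<Rightarrow> ('m \<times> 'n) frag set" where
  "tensor_ker ra la = tensor_ker_on UNIV (+) UNIV (+) UNIV ra la"

definition tensor3_ker ::
    "('m::ab_group_add \<Rightarrow> 's \<Rightarrow> 'm) \<Rightarrow> ('s \<Rightarrow> 'n::ab_group_add \<Rightarrow> 'n)
      \<Rightarrow> ('n \<Rightarrow> 't \<Rightarrow> 'n) \<Rightarrow> ('t \<Rightarrow> 'p::ab_group_add \<Rightarrow> 'p) \<Rightarrow> ('m \<times> 'n \<times> 'p) frag set" where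
  "tensor3_ker raM laN raN laP = group_closure
     ({frag_of (m + m', n, p) - frag_of (m, n, p) - frag_of (m', n, p) |m m' n p. True} \<union>
      {frag_of (m, n + n', p) - frag_of (m, n, p) - frag_of (m, n', p) |m n n' p. True} \<union>
      {frag_of (m, n, p + p') - frag_of (m, n, p) - frag_of (m, n, p') |m n p p'. True} \<union>
      {frag_of (raM m s, n, p) - frag_of (m, laN s n, p) |m s n p. True} \<union>
      {frag_of (m, raN n t, p) - frag_of (m, n, laP t p) |m n t p. True})"

text \<open>The map between quotients of free abelian groups induced by a map \<open>f\<close> on generators, where
  \<open>K\<close> is the subgroup divided out in the target. If \<open>f\<close> respects the relations, the value at
  \<open>coset K' x\<close> is \<open>coset K (frag_extend f x)\<close>.\<close>

definition induced :: "'y frag set \<Rightarrow> ('x \<Rightarrow> 'y frag) \<Rightarrow> 'x frag set \<Rightarrow> 'y frag set" where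
  "induced K f X = {y. \<exists>x\<in>X. y - frag_extend f x \<in> K}"

text \<open>An arbitrary representative: \<open>rep (\<gamma> h)\<close> plays the role of the Sweedler notation
  \<open>h\<^sub>1 \<otimes> h\<^sub>2\<close>.\<close>

definition rep :: "'x frag set \<Rightarrow> 'x frag" where
  "rep X = (SOME x. x \<in> X)"

text \<open>On generators, the maps \<open>f \<otimes> N\<close> and \<open>M \<otimes> f\<close> for a map \<open>f\<close> with values in a tensor product.\<close>

definition tensor_left :: "('m \<Rightarrow> ('a \<times> 'b) frag set) \<Rightarrow> 'm \<times> 'n \<Rightarrow> ('a \<times> 'b \<times> 'n) frag" where
  "tensor_left f = (\<lambda>(m, n). frag_extend (\<lambda>(a, b). frag_of (a, b, n)) (rep (f m)))"

definition tensor_right :: "('n \<Rightarrow> ('a \<times> 'b) frag set) \<Rightarrow> 'm \<times> 'n \<Rightarrow> ('m \<times> 'a \<times> 'b) frag" where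
  "tensor_right f = (\<lambda>(m, n). frag_extend (\<lambda>(a, b). frag_of (m, a, b)) (rep (f n)))"

text \<open>Factorwise multiplication of tensors, \<open>(a \<otimes> b)(a' \<otimes> b') = aa' \<otimes> bb'\<close>.\<close>

definition frag_mult ::
    "('a::times \<times> 'b::times) frag \<Rightarrow> ('a \<times> 'b) frag \<Rightarrow> ('a \<times> 'b) frag" where
  "frag_mult x y =
     frag_extend (\<lambda>(a, b). frag_extend (\<lambda>(a', b'). frag_of (a * a', b * b')) y) x"

definition coset_mult ::
    "('a::times \<times> 'b::times) frag set \<Rightarrow> ('a \<times> 'b) frag set \<Rightarrow> ('a \<times> 'b) frag set
      \<Rightarrow> ('a \<times> 'b) frag set" where
  "coset_mult K X Y = {z. \<exists>x\<in>X. \<exists>y\<in>Y. z - frag_mult x y \<in> K}"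

text \<open>Evaluation of a formal sum in an abelian group: \<open>\<Sum>\<^sub>i n\<^sub>i x\<^sub>i \<mapsto> \<Sum>\<^sub>i n\<^sub>i f(x\<^sub>i)\<close>.\<close>

definition int_mult :: "int \<Rightarrow> 'm::ab_group_add \<Rightarrow> 'm" where
  "int_mult z m = (\<Sum>_<nat z. m) - (\<Sum>_<nat (- z). m)"

definition evaluate :: "('x \<Rightarrow> 'm::ab_group_add) \<Rightarrow> 'x frag \<Rightarrow> 'm" where
  "evaluate f x = (\<Sum>p\<in>Poly_Mapping.keys x. int_mult (Poly_Mapping.lookup x p) (f p))"

section \<open>Corings and comodules\<close>

locale coring = bimodule kR kC la ra
  for kR :: "'k::{comm_ring,monoid_mult} \<Rightarrow> 'r::{ring,monoid_mult} \<Rightarrow> 'r"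
    and kC :: "'k \<Rightarrow> 'c::ab_group_add \<Rightarrow> 'c"
    and la :: "'r \<Rightarrow> 'c \<Rightarrow> 'c"
    and ra :: "'c \<Rightarrow> 'r \<Rightarrow> 'c"
    and \<Delta> :: "'c \<Rightarrow> ('c \<times> 'c) frag set"
    and \<epsilon> :: "'c \<Rightarrow> 'r" +
  assumes comult_in: "\<Delta> c \<in> tensor_on UNIV UNIV (tensor_ker ra la)"
    and comult_add: "\<Delta> (c + c') = coset_add (\<Delta> c) (\<Delta> c')"
    and comult_bilinear: "\<Delta> (ra (la r c) r') =
          induced (tensor_ker ra la) (\<lambda>(a, b). frag_of (la r a, ra b r')) (\<Delta> c)"
    and counit_add: "\<epsilon> (c + c') = \<epsilon> c + \<epsilon> c'"
    and counit_bilinear: "\<epsilon> (ra (la r c) r') = r * \<epsilon> c * r'"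
    and coassociative:
      "induced (tensor3_ker ra la ra la) (tensor_left \<Delta>) (\<Delta> c) =
       induced (tensor3_ker ra la ra la) (tensor_right \<Delta>) (\<Delta> c)"
    and counital_left: "x \<in> \<Delta> c \<Longrightarrow> evaluate (\<lambda>(a, b). la (\<epsilon> a) b) x = c"
    and counital_right: "x \<in> \<Delta> c \<Longrightarrow> evaluate (\<lambda>(a, b). ra a (\<epsilon> b)) x = c"

text \<open>Right comodules \<open>M\<close> of the coring \<open>(C, \<Delta>, \<epsilon>)\<close>; \<open>raM\<close> is the right action on \<open>M\<close>.\<close>

locale coring_comodule = coring kR kC la ra \<Delta> \<epsilon> + M: right_module kR kM raM
  for kR :: "'k::{comm_ring,monoid_mult} \<Rightarrow> 'r::{ring,monoid_mult} \<Rightarrow> 'r"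
    and kC :: "'k \<Rightarrow> 'c::ab_group_add \<Rightarrow> 'c"
    and la :: "'r \<Rightarrow> 'c \<Rightarrow> 'c"
    and ra :: "'c \<Rightarrow> 'r \<Rightarrow> 'c"
    and \<Delta> :: "'c \<Rightarrow> ('c \<times> 'c) frag set"
    and \<epsilon> :: "'c \<Rightarrow> 'r"
    and kM :: "'k \<Rightarrow> 'm::ab_group_add \<Rightarrow> 'm"
    and raM :: "'m \<Rightarrow> 'r \<Rightarrow> 'm"
    and \<tau> :: "'m \<Rightarrow> ('m \<times> 'c) frag set" +
  assumes coact_in: "\<tau> m \<in> tensor_on UNIV UNIV (tensor_ker raM la)"
    and coact_add: "\<tau> (m + m') = coset_add (\<tau> m) (\<tau> m')"
    and coact_linear: "\<tau> (raM m r) =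
          induced (tensor_ker raM la) (\<lambda>(n, c). frag_of (n, ra c r)) (\<tau> m)"
    and coact_coassociative:
      "induced (tensor3_ker raM la ra la) (tensor_left \<tau>) (\<tau> m) =
       induced (tensor3_ker raM la ra la) (tensor_right \<Delta>) (\<tau> m)"
    and coact_counital: "x \<in> \<tau> m \<Longrightarrow> evaluate (\<lambda>(n, c). raM n (\<epsilon> c)) x = m"

section \<open>Bialgebroids and Hopf algebroids\<close>

text \<open>\<open>\<gamma>\<close> is the comultiplication and \<open>\<pi>\<close> the counit.\<close>

record ('h, 'b) bialgebroid =
  src :: "'b \<Rightarrow> 'h"
  tgt :: "'b \<Rightarrow> 'h"
  \<gamma> :: "'h \<Rightarrow> ('h \<times> 'h) frag set"
  \<pi> :: "'h \<Rightarrow> 'b"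

abbreviation left_l :: "('h::times, 'l) bialgebroid \<Rightarrow> 'l \<Rightarrow> 'h \<Rightarrow> 'h" where
  "left_l HL \<equiv> \<lambda>l h. src HL l * h"

abbreviation right_l :: "('h::times, 'l) bialgebroid \<Rightarrow> 'h \<Rightarrow> 'l \<Rightarrow> 'h" where
  "right_l HL \<equiv> \<lambda>h l. tgt HL l * h"

abbreviation left_r :: "('h::times, 'r) bialgebroid \<Rightarrow> 'r \<Rightarrow> 'h \<Rightarrow> 'h" where
  "left_r HR \<equiv> \<lambda>r h. h * tgt HR r"

abbreviation right_r :: "('h::times, 'r) bialgebroid \<Rightarrow> 'h \<Rightarrow> 'r \<Rightarrow> 'h" where
  "right_r HR \<equiv> \<lambda>h r. h * src HR r"

locale left_bialgebroid =
  H: k_algebra kH + L: k_algebra kL +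
  s: algebra_map kL kH "src HL" + t: algebra_antimap kL kH "tgt HL" +
  coring kL kH "left_l HL" "right_l HL" "\<gamma> HL" "\<pi> HL"
  for kH :: "'k::{comm_ring,monoid_mult} \<Rightarrow> 'h::{ring,monoid_mult} \<Rightarrow> 'h"
    and kL :: "'k \<Rightarrow> 'l::{ring,monoid_mult} \<Rightarrow> 'l"
    and HL :: "('h, 'l) bialgebroid" +
  assumes src_tgt_commute: "src HL l * tgt HL l' = tgt HL l' * src HL l"
    and takeuchi:
      "induced (tensor_ker (right_l HL) (left_l HL)) (\<lambda>(a, b). frag_of (a * tgt HL l, b)) (\<gamma> HL h) =
       induced (tensor_ker (right_l HL) (left_l HL)) (\<lambda>(a, b). frag_of (a, b * src HL l)) (\<gamma> HL h)"
    and comult_one: "\<gamma> HL 1 = coset (tensor_ker (right_l HL) (left_l HL)) (frag_of (1, 1))"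
    and comult_mult:
      "\<gamma> HL (h * h') = coset_mult (tensor_ker (right_l HL) (left_l HL)) (\<gamma> HL h) (\<gamma> HL h')"
    and counit_one: "\<pi> HL 1 = 1"
    and counit_src: "\<pi> HL (h * src HL (\<pi> HL h')) = \<pi> HL (h * h')"
    and counit_tgt: "\<pi> HL (h * tgt HL (\<pi> HL h')) = \<pi> HL (h * h')"

locale right_bialgebroid =
  H: k_algebra kH + R: k_algebra kR +
  s: algebra_map kR kH "src HR" + t: algebra_antimap kR kH "tgt HR" +
  coring kR kH "left_r HR" "right_r HR" "\<gamma> HR" "\<pi> HR"
  for kH :: "'k::{comm_ring,monoid_mult} \<Rightarrow> 'h::{ring,monoid_mult} \<Rightarrow> 'h"
    and kR :: "'k \<Rightarrow> 'r::{ring,monoid_mult} \<Rightarrow> 'r"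
    and HR :: "('h, 'r) bialgebroid" +
  assumes src_tgt_commute: "src HR r * tgt HR r' = tgt HR r' * src HR r"
    and takeuchi:
      "induced (tensor_ker (right_r HR) (left_r HR)) (\<lambda>(a, b). frag_of (src HR r * a, b)) (\<gamma> HR h) =
       induced (tensor_ker (right_r HR) (left_r HR)) (\<lambda>(a, b). frag_of (a, tgt HR r * b)) (\<gamma> HR h)"
    and comult_one: "\<gamma> HR 1 = coset (tensor_ker (right_r HR) (left_r HR)) (frag_of (1, 1))"
    and comult_mult:
      "\<gamma> HR (h * h') = coset_mult (tensor_ker (right_r HR) (left_r HR)) (\<gamma> HR h) (\<gamma> HR h')"
    and counit_one: "\<pi> HR 1 = 1"
    and counit_src: "\<pi> HR (src HR (\<pi> HR h) * h') = \<pi> HR (h * h')"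
    and counit_tgt: "\<pi> HR (tgt HR (\<pi> HR h) * h') = \<pi> HR (h * h')"

text \<open>The two mixed coassociativity laws are equations in \<open>H \<otimes>\<^sub>L H \<otimes>\<^sub>R H\<close> and
  \<open>H \<otimes>\<^sub>R H \<otimes>\<^sub>L H\<close> respectively.\<close>

locale hopf_algebroid =
  HL: left_bialgebroid kH kL HL + HR: right_bialgebroid kH kR HR
  for kH :: "'k::{comm_ring,monoid_mult} \<Rightarrow> 'h::{ring,monoid_mult} \<Rightarrow> 'h"
    and kL :: "'k \<Rightarrow> 'l::{ring,monoid_mult} \<Rightarrow> 'l"
    and kR :: "'k \<Rightarrow> 'r::{ring,monoid_mult} \<Rightarrow> 'r"
    and HL :: "('h, 'l) bialgebroid"
    and HR :: "('h, 'r) bialgebroid"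
    and S :: "'h \<Rightarrow> 'h" +
  assumes sL_tR: "src HL (\<pi> HL (tgt HR r)) = tgt HR r"
    and tL_sR: "tgt HL (\<pi> HL (src HR r)) = src HR r"
    and sR_tL: "src HR (\<pi> HR (tgt HL l)) = tgt HL l"
    and tR_sL: "tgt HR (\<pi> HR (src HL l)) = src HL l"
    and mixed_coassociative_LR:
      "induced (tensor3_ker (right_l HL) (left_l HL) (right_r HR) (left_r HR))
         (tensor_left (\<gamma> HL)) (\<gamma> HR h) =
       induced (tensor3_ker (right_l HL) (left_l HL) (right_r HR) (left_r HR))
         (tensor_right (\<gamma> HR)) (\<gamma> HL h)"
    and mixed_coassociative_RL:
      "induced (tensor3_ker (right_r HR) (left_r HR) (right_l HL) (left_l HL))
         (tensor_left (\<gamma> HR)) (\<gamma> HL h) =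
       induced (tensor3_ker (right_r HR) (left_r HR) (right_l HL) (left_l HL))
         (tensor_right (\<gamma> HL)) (\<gamma> HR h)"
    and antipode_add: "S (h + h') = S h + S h'"
    and antipode_scale: "S (kH c h) = kH c (S h)"
    and antipode_tL: "S (tgt HL l * h * tgt HL l') = src HL l' * S h * src HL l"
    and antipode_tR: "S (tgt HR r * h * tgt HR r') = src HR r' * S h * src HR r"
    and antipode_left: "x \<in> \<gamma> HL h \<Longrightarrow> evaluate (\<lambda>(a, b). S a * b) x = src HR (\<pi> HR h)"
    and antipode_right: "x \<in> \<gamma> HR h \<Longrightarrow> evaluate (\<lambda>(a, b). a * S b) x = src HL (\<pi> HL h)"

definition fin_gen_projective_hopf_algebroid ::
    "('h::{ring,monoid_mult}, 'l::{ring,monoid_mult}) bialgebroid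
      \<Rightarrow> ('h, 'r::{ring,monoid_mult}) bialgebroid \<Rightarrow> bool" where
  "fin_gen_projective_hopf_algebroid HL HR \<longleftrightarrow>
     finitely_generated UNIV (\<lambda>r h. right_r HR h r) \<and> right_projective UNIV (right_r HR) \<and>
     finitely_generated UNIV (left_r HR) \<and> left_projective UNIV (left_r HR) \<and>
     finitely_generated UNIV (\<lambda>l h. right_l HL h l) \<and> right_projective UNIV (right_l HL) \<and>
     finitely_generated UNIV (left_l HL) \<and> left_projective UNIV (left_l HL)"

section \<open>Comodules and comodule algebras\<close>

text \<open>A right action of the base algebra together with a coaction.\<close>

record ('m, 'b, 'h) comodule =
  ract :: "'m \<Rightarrow> 'b \<Rightarrow> 'm"
  coact :: "'m \<Rightarrow> ('m \<times> 'h) frag set"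

abbreviation ker_R ::
    "('h::{ring,monoid_mult}, 'r) bialgebroid \<Rightarrow> ('m::ab_group_add, 'r, 'h) comodule
      \<Rightarrow> ('m \<times> 'h) frag set" where
  "ker_R HR XR \<equiv> tensor_ker (ract XR) (left_r HR)"

abbreviation ker_L ::
    "('h::{ring,monoid_mult}, 'l) bialgebroid \<Rightarrow> ('m::ab_group_add, 'l, 'h) comodule
      \<Rightarrow> ('m \<times> 'h) frag set" where
  "ker_L HL XL \<equiv> tensor_ker (ract XL) (left_l HL)"

text \<open>The left actions \<open>r \<cdot> m = m\<^sub>0 \<cdot> \<pi>\<^sub>R(s\<^sub>R(r) m\<^sub>1)\<close> and \<open>l \<cdot> m = m\<^sub>0 \<cdot> \<pi>\<^sub>L(m\<^sub>1 s\<^sub>L(l))\<close> are determined by the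
  right action and the coaction. That they make \<open>M\<close> a bimodule with
  \<open>r \<cdot> m\<^sub>0 \<otimes> m\<^sub>1 = m\<^sub>0 \<otimes> t\<^sub>R(r) m\<^sub>1\<close> and \<open>l \<cdot> m\<^sub>0 \<otimes> m\<^sub>1 = m\<^sub>0 \<otimes> m\<^sub>1 s\<^sub>L(l)\<close> follows from the comodule axioms.\<close>

definition lact_R ::
    "('h::times, 'r) bialgebroid \<Rightarrow> ('m::ab_group_add, 'r, 'h) comodule \<Rightarrow> 'r \<Rightarrow> 'm \<Rightarrow> 'm" where
  "lact_R HR XR r m = evaluate (\<lambda>(n, h). ract XR n (\<pi> HR (src HR r * h))) (rep (coact XR m))"

definition lact_L ::
    "('h::times, 'l) bialgebroid \<Rightarrow> ('m::ab_group_add, 'l, 'h) comodule \<Rightarrow> 'l \<Rightarrow> 'm \<Rightarrow> 'm" where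
  "lact_L HL XL l m = evaluate (\<lambda>(n, h). ract XL n (\<pi> HL (h * src HL l))) (rep (coact XL m))"

locale right_comodule_R =
  coring_comodule kR kH "left_r HR" "right_r HR" "\<gamma> HR" "\<pi> HR" kM "ract XR" "coact XR"
  for kH :: "'k::{comm_ring,monoid_mult} \<Rightarrow> 'h::{ring,monoid_mult} \<Rightarrow> 'h"
    and kR :: "'k \<Rightarrow> 'r::{ring,monoid_mult} \<Rightarrow> 'r"
    and HR :: "('h, 'r) bialgebroid"
    and kM :: "'k \<Rightarrow> 'm::ab_group_add \<Rightarrow> 'm"
    and XR :: "('m, 'r, 'h) comodule"

locale right_comodule_L =
  coring_comodule kL kH "left_l HL" "right_l HL" "\<gamma> HL" "\<pi> HL" kM "ract XL" "coact XL"
  for kH :: "'k::{comm_ring,monoid_mult} \<Rightarrow> 'h::{ring,monoid_mult} \<Rightarrow> 'h"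
    and kL :: "'k \<Rightarrow> 'l::{ring,monoid_mult} \<Rightarrow> 'l"
    and HL :: "('h, 'l) bialgebroid"
    and kM :: "'k \<Rightarrow> 'm::ab_group_add \<Rightarrow> 'm"
    and XL :: "('m, 'l, 'h) comodule"

text \<open>An \<open>R\<close>-ring, i.e. a monoid in the category of \<open>R\<close>-\<open>R\<close> bimodules.\<close>

locale R_ring = k_algebra kA + bimodule kR kA la ra
  for kR :: "'k::{comm_ring,monoid_mult} \<Rightarrow> 'r::{ring,monoid_mult} \<Rightarrow> 'r"
    and kA :: "'k \<Rightarrow> 'a::{ring,monoid_mult} \<Rightarrow> 'a"
    and la :: "'r \<Rightarrow> 'a \<Rightarrow> 'a"
    and ra :: "'a \<Rightarrow> 'r \<Rightarrow> 'a" +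
  assumes mult_la: "la r a * a' = la r (a * a')"
    and mult_balanced: "ra a r * a' = a * la r a'"
    and mult_ra: "a * ra a' r = ra (a * a') r"

locale comodule_algebra_R =
  right_comodule_R kH kR HR kA AR + A: R_ring kR kA "lact_R HR AR" "ract AR"
  for kH :: "'k::{comm_ring,monoid_mult} \<Rightarrow> 'h::{ring,monoid_mult} \<Rightarrow> 'h"
    and kR :: "'k \<Rightarrow> 'r::{ring,monoid_mult} \<Rightarrow> 'r"
    and HR :: "('h, 'r) bialgebroid"
    and kA :: "'k \<Rightarrow> 'a::{ring,monoid_mult} \<Rightarrow> 'a"
    and AR :: "('a, 'r, 'h) comodule" +
  assumes coact_one: "coact AR 1 = coset (ker_R HR AR) (frag_of (1, 1))"
    and coact_mult: "coact AR (a * a') = coset_mult (ker_R HR AR) (coact AR a) (coact AR a')"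

locale comodule_algebra_L =
  right_comodule_L kH kL HL kA AL + A: k_algebra kA
  for kH :: "'k::{comm_ring,monoid_mult} \<Rightarrow> 'h::{ring,monoid_mult} \<Rightarrow> 'h"
    and kL :: "'k \<Rightarrow> 'l::{ring,monoid_mult} \<Rightarrow> 'l"
    and HL :: "('h, 'l) bialgebroid"
    and kA :: "'k \<Rightarrow> 'a::{ring,monoid_mult} \<Rightarrow> 'a"
    and AL :: "('a, 'l, 'h) comodule" +
  assumes ract_one: "ract AL a l = ract AL 1 l * a"
    and lact_one: "lact_L HL AL l a = a * ract AL 1 l"
    and lact_ract_one: "lact_L HL AL l 1 = ract AL 1 l"
    and coact_one: "coact AL 1 = coset (ker_L HL AL) (frag_of (1, 1))"
    and coact_mult: "coact AL (a * a') = coset_mult (ker_L HL AL) (coact AL a) (coact AL a')"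

text \<open>The last two axioms are equations in \<open>M \<otimes>\<^sub>R H \<otimes>\<^sub>L H\<close> and \<open>M \<otimes>\<^sub>L H \<otimes>\<^sub>R H\<close> respectively.\<close>

locale right_comodule =
  R: right_comodule_R kH kR HR kM XR + L: right_comodule_L kH kL HL kM XL
  for kH :: "'k::{comm_ring,monoid_mult} \<Rightarrow> 'h::{ring,monoid_mult} \<Rightarrow> 'h"
    and kL :: "'k \<Rightarrow> 'l::{ring,monoid_mult} \<Rightarrow> 'l"
    and kR :: "'k \<Rightarrow> 'r::{ring,monoid_mult} \<Rightarrow> 'r"
    and HL :: "('h, 'l) bialgebroid"
    and HR :: "('h, 'r) bialgebroid"
    and kM :: "'k \<Rightarrow> 'm::ab_group_add \<Rightarrow> 'm"
    and XL :: "('m, 'l, 'h) comodule"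
    and XR :: "('m, 'r, 'h) comodule" +
  assumes actions_compatible:
      "ract XL (lact_L HL XL l m) l' =
       ract XR (lact_R HR XR (\<pi> HR (tgt HL l')) m) (\<pi> HR (tgt HL l))"
    and coactions_RL:
      "induced (tensor3_ker (ract XR) (left_r HR) (right_l HL) (left_l HL))
         (tensor_left (coact XR)) (coact XL m) =
       induced (tensor3_ker (ract XR) (left_r HR) (right_l HL) (left_l HL))
         (tensor_right (\<gamma> HL)) (coact XR m)"
    and coactions_LR:
      "induced (tensor3_ker (ract XL) (left_l HL) (right_r HR) (left_r HR))
         (tensor_left (coact XL)) (coact XR m) =
       induced (tensor3_ker (ract XL) (left_l HL) (right_r HR) (left_r HR))
         (tensor_right (\<gamma> HR)) (coact XL m)"

locale comodule_algebra =
  right_comodule kH kL kR HL HR kA AL AR +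
  AR: comodule_algebra_R kH kR HR kA AR + AL: comodule_algebra_L kH kL HL kA AL
  for kH :: "'k::{comm_ring,monoid_mult} \<Rightarrow> 'h::{ring,monoid_mult} \<Rightarrow> 'h"
    and kL :: "'k \<Rightarrow> 'l::{ring,monoid_mult} \<Rightarrow> 'l"
    and kR :: "'k \<Rightarrow> 'r::{ring,monoid_mult} \<Rightarrow> 'r"
    and HL :: "('h, 'l) bialgebroid"
    and HR :: "('h, 'r) bialgebroid"
    and kA :: "'k \<Rightarrow> 'a::{ring,monoid_mult} \<Rightarrow> 'a"
    and AL :: "('a, 'l, 'h) comodule"
    and AR :: "('a, 'r, 'h) comodule"

section \<open>Extensions and the Galois property\<close>

definition coinvariants_R ::
    "('h::{ring,monoid_mult}, 'r) bialgebroid \<Rightarrow> ('a::ab_group_add, 'r, 'h) comodule \<Rightarrow> 'a set" where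
  "coinvariants_R HR AR = {a. coact AR a = coset (ker_R HR AR) (frag_of (a, 1))}"

text \<open>When the antipode is bijective, the coinvariants with respect to the left bialgebroid are
  the same subalgebra; this is not made part of the definition.\<close>

definition extension ::
    "('k::{comm_ring,monoid_mult} \<Rightarrow> 'h::{ring,monoid_mult} \<Rightarrow> 'h)
      \<Rightarrow> ('k \<Rightarrow> 'l::{ring,monoid_mult} \<Rightarrow> 'l) \<Rightarrow> ('k \<Rightarrow> 'r::{ring,monoid_mult} \<Rightarrow> 'r)
      \<Rightarrow> ('h, 'l) bialgebroid \<Rightarrow> ('h, 'r) bialgebroid
      \<Rightarrow> ('k \<Rightarrow> 'a::{ring,monoid_mult} \<Rightarrow> 'a)
      \<Rightarrow> ('a, 'l, 'h) comodule \<Rightarrow> ('a, 'r, 'h) comodule \<Rightarrow> 'a set \<Rightarrow> bool" where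
  "extension kH kL kR HL HR kA AL AR B \<longleftrightarrow>
     comodule_algebra kH kL kR HL HR kA AL AR \<and> B = coinvariants_R HR AR"

definition tensor_B :: "'a::{ring,monoid_mult} set \<Rightarrow> ('a \<times> 'a) frag set set" where
  "tensor_B B = tensor_on UNIV UNIV (tensor_ker_on UNIV (+) UNIV (+) B (*) (*))"

definition can_R ::
    "('h::{ring,monoid_mult}, 'r) bialgebroid \<Rightarrow> ('a::{ring,monoid_mult}, 'r, 'h) comodule
      \<Rightarrow> ('a \<times> 'a) frag set \<Rightarrow> ('a \<times> 'h) frag set" where
  "can_R HR AR = induced (ker_R HR AR)
     (\<lambda>(a, a'). frag_extend (\<lambda>(c, h). frag_of (a * c, h)) (rep (coact AR a')))"

definition can_L ::
    "('h::{ring,monoid_mult}, 'l) bialgebroid \<Rightarrow> ('a::{ring,monoid_mult}, 'l, 'h) comodule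
      \<Rightarrow> ('a \<times> 'a) frag set \<Rightarrow> ('a \<times> 'h) frag set" where
  "can_L HL AL = induced (ker_L HL AL)
     (\<lambda>(a, a'). frag_extend (\<lambda>(c, h). frag_of (c * a', h)) (rep (coact AL a)))"

definition galois_R ::
    "('h::{ring,monoid_mult}, 'r) bialgebroid \<Rightarrow> ('a::{ring,monoid_mult}, 'r, 'h) comodule
      \<Rightarrow> 'a set \<Rightarrow> bool" where
  "galois_R HR AR B \<longleftrightarrow>
     bij_betw (can_R HR AR) (tensor_B B) (tensor_on UNIV UNIV (ker_R HR AR))"

definition galois_L ::
    "('h::{ring,monoid_mult}, 'l) bialgebroid \<Rightarrow> ('a::{ring,monoid_mult}, 'l, 'h) comodule
      \<Rightarrow> 'a set \<Rightarrow> bool" where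
  "galois_L HL AL B \<longleftrightarrow>
     bij_betw (can_L HL AL) (tensor_B B) (tensor_on UNIV UNIV (ker_L HL AL))"

text \<open>\<open>A \<otimes>\<^sub>k M\<close> for a \<open>k\<close>-module with carrier \<open>M\<close>, addition \<open>add\<close> and scalar multiplication \<open>sm\<close>.\<close>

abbreviation k_tensor_ker ::
    "('k \<Rightarrow> 'a::ab_group_add \<Rightarrow> 'a) \<Rightarrow> 'm set \<Rightarrow> ('m \<Rightarrow> 'm \<Rightarrow> 'm) \<Rightarrow> ('k \<Rightarrow> 'm \<Rightarrow> 'm)
      \<Rightarrow> ('a \<times> 'm) frag set" where
  "k_tensor_ker kA M add sm \<equiv> tensor_ker_on UNIV (+) M add UNIV (\<lambda>a c. kA c a) sm"

abbreviation k_tensor ::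
    "('k \<Rightarrow> 'a::ab_group_add \<Rightarrow> 'a) \<Rightarrow> 'm set \<Rightarrow> ('m \<Rightarrow> 'm \<Rightarrow> 'm) \<Rightarrow> ('k \<Rightarrow> 'm \<Rightarrow> 'm)
      \<Rightarrow> ('a \<times> 'm) frag set set" where
  "k_tensor kA M add sm \<equiv> tensor_on UNIV M (k_tensor_ker kA M add sm)"

text \<open>The coinvariants of \<open>A \<otimes>\<^sub>k A\<close> with coaction \<open>A \<otimes>\<^sub>k \<tau>\<^sub>R\<close>; the defining equation lives in
  \<open>A \<otimes>\<^sub>k A \<otimes>\<^sub>R H\<close>.\<close>

definition coinvariants_AA ::
    "('h::{ring,monoid_mult}, 'r) bialgebroid \<Rightarrow> ('k \<Rightarrow> 'a::{ring,monoid_mult} \<Rightarrow> 'a)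
      \<Rightarrow> ('a, 'r, 'h) comodule \<Rightarrow> ('a \<times> 'a) frag set set" where
  "coinvariants_AA HR kA AR =
     {X \<in> k_tensor kA UNIV (+) kA.
        induced (tensor3_ker (\<lambda>a c. kA c a) kA (ract AR) (left_r HR)) (tensor_right (coact AR)) X =
        induced (tensor3_ker (\<lambda>a c. kA c a) kA (ract AR) (left_r HR))
          (\<lambda>(a, a'). frag_of (a, a', 1)) X}"

text \<open>\<open>(A \<otimes>\<^sub>k A)\<^sup>c\<^sup>o\<^sup>H = A \<otimes>\<^sub>k B\<close>, where \<open>A \<otimes>\<^sub>k B\<close> is the abstract tensor product and not its image
  in \<open>A \<otimes>\<^sub>k A\<close>.\<close>

definition coinvariants_AA_eq ::
    "('h::{ring,monoid_mult}, 'r) bialgebroid \<Rightarrow> ('k \<Rightarrow> 'a::{ring,monoid_mult} \<Rightarrow> 'a)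
      \<Rightarrow> ('a, 'r, 'h) comodule \<Rightarrow> 'a set \<Rightarrow> bool" where
  "coinvariants_AA_eq HR kA AR B \<longleftrightarrow>
     bij_betw (induced (k_tensor_ker kA UNIV (+) kA) frag_of)
       (k_tensor kA B (+) kA) (coinvariants_AA HR kA AR)"

section \<open>Flatness over the ground ring\<close>

definition k_module_on ::
    "'m set \<Rightarrow> ('m \<Rightarrow> 'm \<Rightarrow> 'm) \<Rightarrow> ('k::{comm_ring,monoid_mult} \<Rightarrow> 'm \<Rightarrow> 'm) \<Rightarrow> bool" where
  "k_module_on M add sm \<longleftrightarrow>
     (\<forall>x\<in>M. \<forall>y\<in>M. add x y \<in> M \<and> add x y = add y x) \<and>
     (\<forall>x\<in>M. \<forall>y\<in>M. \<forall>z\<in>M. add (add x y) z = add x (add y z)) \<and>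
     (\<exists>z\<in>M. \<forall>x\<in>M. add z x = x \<and> (\<exists>y\<in>M. add y x = z)) \<and>
     (\<forall>c. \<forall>x\<in>M. sm c x \<in> M) \<and>
     (\<forall>c. \<forall>x\<in>M. \<forall>y\<in>M. sm c (add x y) = add (sm c x) (sm c y)) \<and>
     (\<forall>c d. \<forall>x\<in>M. sm (c + d) x = add (sm c x) (sm d x)) \<and>
     (\<forall>c d. \<forall>x\<in>M. sm (c * d) x = sm c (sm d x)) \<and>
     (\<forall>x\<in>M. sm 1 x = x)"

text \<open>\<open>A \<otimes>\<^sub>k _\<close> preserves injectivity of the \<open>k\<close>-linear maps between \<open>k\<close>-modules carried by subsets
  of the type \<open>'n\<close>. Flatness of \<open>A\<close> is this property for all \<open>'n\<close>; hence assuming it for a single type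
  only is weaker than assuming \<open>A\<close> to be flat.\<close>

definition k_flat ::
    "'n itself \<Rightarrow> ('k::{comm_ring,monoid_mult} \<Rightarrow> 'a::ab_group_add \<Rightarrow> 'a) \<Rightarrow> bool" where
  "k_flat T kA \<longleftrightarrow>
     (\<forall>(M :: 'n set) addM (smM :: 'k \<Rightarrow> 'n \<Rightarrow> 'n) (N :: 'n set) addN (smN :: 'k \<Rightarrow> 'n \<Rightarrow> 'n)
        (f :: 'n \<Rightarrow> 'n).
        k_module_on M addM smM \<and> k_module_on N addN smN \<and>
        f ` M \<subseteq> N \<and> inj_on f M \<and>
        (\<forall>x\<in>M. \<forall>y\<in>M. f (addM x y) = addN (f x) (f y)) \<and>
        (\<forall>c. \<forall>x\<in>M. f (smM c x) = smN c (f x))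
        \<longrightarrow> inj_on (induced (k_tensor_ker kA N addN smN) (\<lambda>(a, m). frag_of (a, f m)))
              (k_tensor kA M addM smM))"

end

theory Submission
  imports Defs
begin

text \<open>Since \<open>H\<close> is finitely generated projective, a trace formula produces integrals
  \<open>\<lambda>\<^sub>j : H \<rightarrow> R\<close>, that is, \<open>h\<^sup>1 s\<^sub>R(\<lambda>\<^sub>j(h\<^sup>2)) = t\<^sub>R(\<lambda>\<^sub>j(h))\<close>, and elements \<open>x\<^sub>j\<close> of \<open>H\<close> with
  \<open>\<Sum>\<^sub>j \<lambda>\<^sub>j(x\<^sub>j h) = \<pi>\<^sub>R(h)\<close>. Each \<open>\<lambda>\<^sub>j\<close> defines a right \<open>B\<close>-linear trace map \<open>a \<mapsto> a\<^sup>0 \<cdot> \<lambda>\<^sub>j(a\<^sup>1)\<close> from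
  \<open>A\<close> to \<open>B\<close>. If \<open>can\<^sub>R\<close> is surjective, lift \<open>1 \<otimes> x\<^sub>j\<close> to \<open>\<Sum> u \<otimes> v\<close>; then
  \<open>a = \<Sum>\<^sub>j \<Sum> u tr\<^sub>j(v a)\<close>, a finite dual basis of the right \<open>B\<close>-module \<open>A\<close>. As \<open>tr\<^sub>j(v a) a'\<close> depends
  only on \<open>can\<^sub>L(a \<otimes> a')\<close>, the map \<open>can\<^sub>L\<close> is injective, hence so is \<open>can\<^sub>R\<close>, from which \<open>can\<^sub>L\<close> is
  obtained by composition with \<open>a \<otimes> h \<mapsto> a\<^sub>0 \<otimes> a\<^sub>1 S(h)\<close>. Exchanging the two bialgebroids and
  reversing all multiplications gives projectivity on the left.

  For \<open>k\<close>-flat \<open>A\<close>, the functor \<open>A \<otimes>\<^sub>k _\<close> preserves the kernel \<open>B\<close> of \<open>a \<mapsto> \<tau>\<^sub>R(a) - a \<otimes> 1\<close>.\<close>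


section \<open>Formal sums\<close>

text \<open>Equality of tensors is used by evaluating balanced maps on representatives, which makes
  Sweedler calculations equations in abelian groups. The way back is finite: a dual basis of
  \<open>H\<close> gives coordinates
  \<open>a \<otimes> h \<mapsto> a \<cdot> \<beta>\<^sub>i(h)\<close> that determine an element of
  \<open>A \<otimes>\<^sub>R H\<close>.

  No nondegenerate integral is assumed; the finite family \<open>\<lambda>\<^sub>j\<close> with
  \<open>x\<^sub>j = S\<^sup>-\<^sup>1(b\<^sub>j)\<close> takes its place. The trace formula
  contains \<open>S\<^sup>-\<^sup>2\<close> because moving \<open>g\<close> out of an invariant
  expression costs a factor \<open>S(g\<^sub>1)\<close>: for \<open>g = S\<^sup>-\<^sup>2(b)\<close>
  it is \<open>S\<^sup>-\<^sup>1(b\<^sub>1)\<close>, to which \<open>S\<^sup>-\<^sup>1(h\<^sub>2)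
  h\<^sub>1 = t\<^sub>R(\<pi>\<^sub>R(h))\<close> is adapted. This requires
  \<open>S\<^sup>-\<^sup>2\<close> to respect \<open>\<gamma>\<^sub>L\<close>, so the behaviour of
  \<open>S\<close> on products and coproducts, absent from the axioms, is derived before.

  The trace is defined by \<open>\<tau>\<^sub>R\<close>, but the injectivity of
  \<open>can\<^sub>L\<close> needs it in terms of \<open>\<tau>\<^sub>L\<close>; invariance of the
  integral makes the two forms agree.

  Flatness is given only for modules carried by sets of cosets of formal sums on
  \<open>A \<times> H\<close>, so \<open>A\<close>, \<open>B\<close> and the image of
  \<open>a \<mapsto> \<tau>\<^sub>R(a) - a \<otimes> 1\<close> are all realised inside
  \<open>A \<otimes>\<^sub>R H\<close>.\<close>

lemma int_mult_eq_diff: "int_mult (int m - int n) x = (\<Sum>_<m. x) - (\<Sum>_<n. x)"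
proof -
  have split: "(\<Sum>_<p + q. x) = (\<Sum>_<p. x) + (\<Sum>_<q. x)" for p q :: nat
    by (induction q) (simp_all add: add_ac)
  show ?thesis
  proof (cases "n \<le> m")
    case True
    then obtain k where "m = n + k" by (auto simp: le_iff_add)
    then show ?thesis by (simp add: int_mult_def split)
  next
    case False
    then obtain k where "n = m + k" by (metis le_iff_add nle_le)
    then show ?thesis by (simp add: int_mult_def split)
  qed
qed

lemma int_mult_0 [simp]: "int_mult 0 x = 0"
  by (simp add: int_mult_def)

lemma int_mult_1 [simp]: "int_mult 1 x = x"
  by (simp add: int_mult_def)

lemma int_mult_diff_left: "int_mult (y - z) x = int_mult y x - int_mult z x"
proof -
  obtain a b c d where y: "y = int a - int b" and z: "z = int c - int d"
    by (metis int_diff_cases)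
  have split: "(\<Sum>_<p + q. x) = (\<Sum>_<p. x) + (\<Sum>_<q. x)" for p q :: nat
    by (induction q) (simp_all add: add_ac)
  have "y - z = int (a + d) - int (b + c)" by (simp add: y z)
  then have "int_mult (y - z) x = (\<Sum>_<a + d. x) - (\<Sum>_<b + c. x)"
    by (simp only: int_mult_eq_diff)
  also have "\<dots> = int_mult y x - int_mult z x"
    by (simp only: y z int_mult_eq_diff split) (simp add: algebra_simps)
  finally show ?thesis .
qed

lemma int_mult_zero_right [simp]: "int_mult z 0 = 0"
  by (simp add: int_mult_def)

lemma evaluate_superset:
  assumes "finite F" "Poly_Mapping.keys x \<subseteq> F"
  shows "evaluate f x = (\<Sum>p\<in>F. int_mult (Poly_Mapping.lookup x p) (f p))"
  unfolding evaluate_def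
  by (rule sum.mono_neutral_left) (use assms in \<open>auto simp: in_keys_iff\<close>)

lemma evaluate_diff: "evaluate f (x - y) = evaluate f x - evaluate f y"
proof -
  let ?F = "Poly_Mapping.keys x \<union> Poly_Mapping.keys y"
  have "evaluate f (x - y) = (\<Sum>p\<in>?F. int_mult (Poly_Mapping.lookup (x - y) p) (f p))"
    by (rule evaluate_superset) (auto dest: subsetD[OF keys_diff])
  also have "\<dots> = (\<Sum>p\<in>?F. int_mult (Poly_Mapping.lookup x p) (f p))
      - (\<Sum>p\<in>?F. int_mult (Poly_Mapping.lookup y p) (f p))"
    by (simp add: lookup_minus int_mult_diff_left sum_subtractf)
  also have "\<dots> = evaluate f x - evaluate f y"
    by (subst (1 2) evaluate_superset[of ?F]) auto
  finally show ?thesis .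
qed

lemma evaluate_0 [simp]: "evaluate f 0 = 0"
  by (simp add: evaluate_def)

lemma evaluate_minus: "evaluate f (- x) = - evaluate f x"
  using evaluate_diff[of f 0 x] by simp

lemma evaluate_plus: "evaluate f (x + y) = evaluate f x + evaluate f y"
  using evaluate_diff[of f x "- y"] by (simp add: evaluate_minus)

lemma evaluate_frag_of [simp]: "evaluate f (frag_of p) = f p"
  by (simp add: evaluate_def keys_frag_of)

lemma frag_induct [case_names zero one diff]:
  assumes "P 0" "\<And>p. P (frag_of p)" "\<And>x y. P x \<Longrightarrow> P y \<Longrightarrow> P (x - y)"
  shows "P (x :: 'x frag)"
  by (rule frag_induction[of x UNIV]) (use assms in auto)

lemma frag_extend_eq_evaluate: "frag_extend g x = evaluate g x"
  by (induction x rule: frag_induct) (simp_all add: frag_extend_diff evaluate_diff)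

definition additive_map :: "('m::ab_group_add \<Rightarrow> 'n::ab_group_add) \<Rightarrow> bool" where
  "additive_map g \<longleftrightarrow> (\<forall>x y. g (x + y) = g x + g y)"

lemma additive_mapI: "(\<And>x y. g (x + y) = g x + g y) \<Longrightarrow> additive_map g"
  by (simp add: additive_map_def)

lemma additive_map_plus: "additive_map g \<Longrightarrow> g (x + y) = g x + g y"
  by (simp add: additive_map_def)

lemma additive_map_0:
  assumes "additive_map g" shows "g 0 = 0"
  using additive_map_plus[OF assms, of 0 0] by simp

lemma additive_map_diff:
  assumes "additive_map g" shows "g (x - y) = g x - g y"
  using additive_map_plus[OF assms, of "x - y" y] by simp

lemma additive_map_sum:
  assumes "additive_map g" shows "g (\<Sum>i\<in>I. h i) = (\<Sum>i\<in>I. g (h i))"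
  by (induction I rule: infinite_finite_induct)
     (simp_all add: additive_map_0[OF assms] additive_map_plus[OF assms])

lemma evaluate_additive:
  assumes "additive_map g" shows "evaluate (\<lambda>p. g (f p)) x = g (evaluate f x)"
  by (induction x rule: frag_induct)
     (simp_all add: evaluate_diff additive_map_0[OF assms] additive_map_diff[OF assms])

lemma evaluate_frag_extend: "evaluate f (frag_extend g x) = evaluate (\<lambda>p. evaluate f (g p)) x"
  by (induction x rule: frag_induct) (simp_all add: evaluate_diff frag_extend_diff)

lemma evaluate_add_fun: "evaluate (\<lambda>p. f p + g p) x = evaluate f x + evaluate g x"
  by (induction x rule: frag_induct) (simp_all add: evaluate_diff)

text \<open>For \<open>d = rep (\<gamma> h)\<close>, \<open>sw d (\<lambda>a b. f a b)\<close> is what \<open>f(h\<^sub>1, h\<^sub>2)\<close> denotes in Sweedler notation;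
  it makes sense when \<open>f\<close> is balanced. Threefold expressions are obtained by nesting.\<close>

definition sw :: "('x \<times> 'y) frag \<Rightarrow> ('x \<Rightarrow> 'y \<Rightarrow> 'm::ab_group_add) \<Rightarrow> 'm" where
  "sw d f = evaluate (\<lambda>(a, b). f a b) d"

lemma sw_frag_of [simp]: "sw (frag_of (a, b)) f = f a b"
  by (simp add: sw_def)

lemma sw_zero [simp]: "sw 0 f = 0"
  by (simp add: sw_def)

lemma sw_diff_arg: "sw (x - y) f = sw x f - sw y f"
  by (simp add: sw_def evaluate_diff)

lemma sw_plus_arg: "sw (x + y) f = sw x f + sw y f"
  by (simp add: sw_def evaluate_plus)

lemma sw_add: "sw d (\<lambda>a b. f a b + g a b) = sw d f + sw d g"
  by (simp add: sw_def evaluate_add_fun split_def)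

lemma sw_hom:
  assumes "additive_map g" shows "sw d (\<lambda>a b. g (f a b)) = g (sw d f)"
  using evaluate_additive[OF assms, of "\<lambda>(a, b). f a b" d] by (simp add: sw_def split_def)

lemma additive_sw: "additive_map (\<lambda>x. sw x f)"
  by (rule additive_mapI) (rule sw_plus_arg)

lemma sw_const_0 [simp]: "sw d (\<lambda>a b. 0) = 0"
  using sw_hom[of "\<lambda>_. 0" d "\<lambda>a b. 0"] by (simp add: additive_map_def)

lemma sw_sum: "sw d (\<lambda>a b. \<Sum>i\<in>I. f i a b) = (\<Sum>i\<in>I. sw d (f i))"
  by (induction I rule: infinite_finite_induct) (simp_all add: sw_add)

lemma sw_diff: "sw d (\<lambda>a b. f a b - g a b) = sw d f - sw d g"
  using sw_add[of d "\<lambda>a b. f a b - g a b" g] by simp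

lemma sw_swap: "sw d (\<lambda>a b. sw e (\<lambda>a' b'. f a b a' b')) = sw e (\<lambda>a' b'. sw d (\<lambda>a b. f a b a' b'))"
proof (induction d rule: frag_induct)
  case (one p)
  then show ?case by (cases p) simp
qed (simp_all add: sw_diff_arg sw_diff)

section \<open>Balanced maps\<close>

text \<open>These are the maps that factor through the quotient by \<open>tensor_ker\<close>;
  testing with them replaces working with cosets.\<close>

definition balanced ::
    "('m::ab_group_add \<Rightarrow> 's \<Rightarrow> 'm) \<Rightarrow> ('s \<Rightarrow> 'n::ab_group_add \<Rightarrow> 'n)
      \<Rightarrow> ('m \<Rightarrow> 'n \<Rightarrow> 'p::ab_group_add) \<Rightarrow> bool" where
  "balanced ra la f \<longleftrightarrow>
     (\<forall>m m' n. f (m + m') n = f m n + f m' n) \<and> (\<forall>m n n'. f m (n + n') = f m n + f m n') \<and>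
     (\<forall>m s n. f (ra m s) n = f m (la s n))"

definition balanced3 ::
    "('m::ab_group_add \<Rightarrow> 's \<Rightarrow> 'm) \<Rightarrow> ('s \<Rightarrow> 'n::ab_group_add \<Rightarrow> 'n)
      \<Rightarrow> ('n \<Rightarrow> 't \<Rightarrow> 'n) \<Rightarrow> ('t \<Rightarrow> 'p::ab_group_add \<Rightarrow> 'p)
      \<Rightarrow> ('m \<Rightarrow> 'n \<Rightarrow> 'p \<Rightarrow> 'q::ab_group_add) \<Rightarrow> bool" where
  "balanced3 raM laN raN laP f \<longleftrightarrow>
     (\<forall>p. balanced raM laN (\<lambda>m n. f m n p)) \<and> (\<forall>m. balanced raN laP (\<lambda>n p. f m n p))"

lemma balancedI:
  assumes "\<And>m m' n. f (m + m') n = f m n + f m' n" "\<And>m n n'. f m (n + n') = f m n + f m n'"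
    "\<And>m s n. f (ra m s) n = f m (la s n)"
  shows "balanced ra la f"
  using assms by (simp add: balanced_def)

lemma balanced3I:
  assumes "\<And>m m' n p. f (m + m') n p = f m n p + f m' n p"
    "\<And>m n n' p. f m (n + n') p = f m n p + f m n' p"
    "\<And>m n p p'. f m n (p + p') = f m n p + f m n p'"
    "\<And>m s n p. f (raM m s) n p = f m (laN s n) p"
    "\<And>m n t p. f m (raN n t) p = f m n (laP t p)"
  shows "balanced3 raM laN raN laP f"
  using assms by (simp add: balanced3_def balanced_def)

lemma balanced_add_left: "balanced ra la f \<Longrightarrow> f (m + m') n = f m n + f m' n"
  and balanced_add_right: "balanced ra la f \<Longrightarrow> f m (n + n') = f m n + f m n'"
  and balanced_swap: "balanced ra la f \<Longrightarrow> f (ra m s) n = f m (la s n)"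
  by (simp_all add: balanced_def)

lemma balanced_additive_left: "balanced ra la f \<Longrightarrow> additive_map (\<lambda>m. f m n)"
  and balanced_additive_right: "balanced ra la f \<Longrightarrow> additive_map (f m)"
  by (simp_all add: balanced_def additive_map_def)

lemma evaluate_group_closure:
  assumes "x \<in> group_closure X" "\<And>y. y \<in> X \<Longrightarrow> evaluate f y = 0"
  shows "evaluate f x = 0"
  using assms(1) by (induction rule: group_closure.induct) (auto simp: evaluate_diff assms(2))

lemma sw_tensor_ker_on:
  assumes "x \<in> tensor_ker_on UNIV (+) UNIV (+) B ra la"
    and "\<And>m m' n. f (m + m') n = f m n + f m' n" "\<And>m n n'. f m (n + n') = f m n + f m n'"
    and "\<And>m s n. s \<in> B \<Longrightarrow> f (ra m s) n = f m (la s n)"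
  shows "sw x f = 0"
  unfolding sw_def
  by (rule evaluate_group_closure[OF assms(1)[unfolded tensor_ker_on_def]])
    (use assms(2-) in \<open>auto simp: evaluate_diff\<close>)

lemma sw_tensor_ker: "balanced ra la f \<Longrightarrow> x \<in> tensor_ker ra la \<Longrightarrow> sw x f = 0"
  unfolding tensor_ker_def by (erule sw_tensor_ker_on) (simp_all add: balanced_def)

lemma evaluate_tensor3_ker:
  assumes "balanced3 raM laN raN laP f" "x \<in> tensor3_ker raM laN raN laP"
  shows "evaluate (\<lambda>(a, b, c). f a b c) x = 0"
  by (rule evaluate_group_closure[OF assms(2)[unfolded tensor3_ker_def]])
     (use assms(1) in \<open>auto simp: evaluate_diff balanced3_def balanced_def\<close>)

lemma sw_cong_ker:
  assumes "x - y \<in> tensor_ker ra la" "balanced ra la f"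
  shows "sw x f = sw y f"
  using sw_tensor_ker[OF assms(2,1)] by (simp add: sw_diff_arg)

lemma sw_sw: "sw (sw d g) f = sw d (\<lambda>a b. sw (g a b) f)"
  by (rule sw_hom[OF additive_sw, symmetric])

lemma evaluate_sw: "evaluate f (sw d g) = sw d (\<lambda>a b. evaluate f (g a b))"
  using sw_hom[where g = "evaluate f" and d = d and f = g]
  by (simp add: additive_map_def evaluate_plus)

text \<open>Coassociativity is stored as a congruence of formal sums; this makes it a rule for
  renumbering Sweedler indices in any balanced expression. The choices \<open>\<delta>\<close> and
  \<open>\<epsilon>\<close> may belong to different comultiplications, which covers the mixed
  laws.\<close>

lemma sw_coassoc:
  assumes "sw d (\<lambda>a b. sw (\<delta> a) (\<lambda>a1 a2. frag_of (a1, a2, b)))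
      - sw e (\<lambda>a b. sw (\<epsilon> b) (\<lambda>b1 b2. frag_of (a, b1, b2))) \<in> tensor3_ker raM laN raN laP"
    and "balanced3 raM laN raN laP f"
  shows "sw d (\<lambda>a b. sw (\<delta> a) (\<lambda>a1 a2. f a1 a2 b)) = sw e (\<lambda>a b. sw (\<epsilon> b) (\<lambda>b1 b2. f a b1 b2))"
  using evaluate_tensor3_ker[OF assms(2,1)] by (simp add: evaluate_diff evaluate_sw)

lemma tensor_ker_diff: "x \<in> tensor_ker ra la \<Longrightarrow> y \<in> tensor_ker ra la \<Longrightarrow> x - y \<in> tensor_ker ra la"
  unfolding tensor_ker_def tensor_ker_on_def by (rule group_closure.diff)

section \<open>Pairs of a left and a right bialgebroid\<close>

text \<open>The multiplication of \<open>H\<close> is a parameter because interchanging the two bialgebroids and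
  reversing the multiplication gives the same structure again; \<open>dL\<close> and \<open>dR\<close> choose
  representatives of the comultiplications.\<close>

locale bialgebroid_pair =
  fixes mul :: "'h::ab_group_add \<Rightarrow> 'h \<Rightarrow> 'h" (infixl "**" 70)
    and one :: 'h
    and sL tL :: "'l::{ring,monoid_mult} \<Rightarrow> 'h" and piL :: "'h \<Rightarrow> 'l"
    and dL :: "'h \<Rightarrow> ('h \<times> 'h) frag"
    and sR tR :: "'r::{ring,monoid_mult} \<Rightarrow> 'h" and piR :: "'h \<Rightarrow> 'r"
    and dR :: "'h \<Rightarrow> ('h \<times> 'h) frag"
  assumes mul_assoc: "(a ** b) ** c = a ** (b ** c)"
    and mul_add_left: "(a + b) ** c = a ** c + b ** c"
    and mul_add_right: "a ** (b + c) = a ** b + a ** c"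
    and one_mul: "one ** a = a" and mul_one: "a ** one = a"
    and sL_add: "sL (l + l') = sL l + sL l'" and sR_add: "sR (r + r') = sR r + sR r'"
    and tL_add: "tL (l + l') = tL l + tL l'" and tR_add: "tR (r + r') = tR r + tR r'"
    and sL_mult: "sL (l * l') = sL l ** sL l'" and sR_mult: "sR (r * r') = sR r ** sR r'"
    and tL_mult: "tL (l * l') = tL l' ** tL l" and tR_mult: "tR (r * r') = tR r' ** tR r"
    and sL_one: "sL 1 = one" and sR_one: "sR 1 = one"
    and tL_one: "tL 1 = one" and tR_one: "tR 1 = one"
    and sL_tL: "sL l ** tL l' = tL l' ** sL l" and sR_tR: "sR r ** tR r' = tR r' ** sR r"
    and sL_tR: "sL (piL (tR r)) = tR r" and tL_sR: "tL (piL (sR r)) = sR r"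
    and sR_tL: "sR (piR (tL l)) = tL l" and tR_sL: "tR (piR (sL l)) = sL l"
    and piL_add: "piL (a + b) = piL a + piL b" and piR_add: "piR (a + b) = piR a + piR b"
    and piL_s: "piL (sL l ** a) = l * piL a" and piR_s: "piR (a ** sR r) = piR a * r"
    and piL_t: "piL (tL l ** a) = piL a * l" and piR_t: "piR (a ** tR r) = r * piR a"
    and piL_one: "piL one = 1" and piR_one: "piR one = 1"
    and piL_mul_s: "piL (a ** sL (piL b)) = piL (a ** b)"
    and piR_mul_s: "piR (sR (piR a) ** b) = piR (a ** b)"
    and piL_mul_t: "piL (a ** tL (piL b)) = piL (a ** b)"
    and piR_mul_t: "piR (tR (piR a) ** b) = piR (a ** b)"
    and ax_L_plus: "dL (a + b) - (dL a + dL b) \<in> tensor_ker (\<lambda>h l. tL l ** h) (\<lambda>l h. sL l ** h)"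
    and ax_R_plus: "dR (a + b) - (dR a + dR b) \<in> tensor_ker (\<lambda>h r. h ** sR r) (\<lambda>r h. h ** tR r)"
    and ax_L_one: "dL one - frag_of (one, one) \<in> tensor_ker (\<lambda>h l. tL l ** h) (\<lambda>l h. sL l ** h)"
    and ax_R_one: "dR one - frag_of (one, one) \<in> tensor_ker (\<lambda>h r. h ** sR r) (\<lambda>r h. h ** tR r)"
    and ax_L_mult: "dL (a ** b) - sw (dL a) (\<lambda>a1 a2. sw (dL b) (\<lambda>b1 b2. frag_of (a1 ** b1, a2 ** b2)))
        \<in> tensor_ker (\<lambda>h l. tL l ** h) (\<lambda>l h. sL l ** h)"
    and ax_R_mult: "dR (a ** b) - sw (dR b) (\<lambda>b1 b2. sw (dR a) (\<lambda>a1 a2. frag_of (a1 ** b1, a2 ** b2)))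
        \<in> tensor_ker (\<lambda>h r. h ** sR r) (\<lambda>r h. h ** tR r)"
    and ax_L_s: "dL (sL l ** a) - sw (dL a) (\<lambda>a1 a2. frag_of (sL l ** a1, a2))
        \<in> tensor_ker (\<lambda>h l. tL l ** h) (\<lambda>l h. sL l ** h)"
    and ax_R_t: "dR (a ** tR r) - sw (dR a) (\<lambda>a1 a2. frag_of (a1 ** tR r, a2))
        \<in> tensor_ker (\<lambda>h r. h ** sR r) (\<lambda>r h. h ** tR r)"
    and ax_L_t: "dL (tL l ** a) - sw (dL a) (\<lambda>a1 a2. frag_of (a1, tL l ** a2))
        \<in> tensor_ker (\<lambda>h l. tL l ** h) (\<lambda>l h. sL l ** h)"
    and ax_R_s: "dR (a ** sR r) - sw (dR a) (\<lambda>a1 a2. frag_of (a1, a2 ** sR r))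
        \<in> tensor_ker (\<lambda>h r. h ** sR r) (\<lambda>r h. h ** tR r)"
    and ax_L_takeuchi: "sw (dL a) (\<lambda>a1 a2. frag_of (a1 ** tL l, a2))
        - sw (dL a) (\<lambda>a1 a2. frag_of (a1, a2 ** sL l)) \<in> tensor_ker (\<lambda>h l. tL l ** h) (\<lambda>l h. sL l ** h)"
    and ax_R_takeuchi: "sw (dR a) (\<lambda>a1 a2. frag_of (sR r ** a1, a2))
        - sw (dR a) (\<lambda>a1 a2. frag_of (a1, tR r ** a2)) \<in> tensor_ker (\<lambda>h r. h ** sR r) (\<lambda>r h. h ** tR r)"
    and L_counit_left: "sw (dL a) (\<lambda>a1 a2. sL (piL a1) ** a2) = a"
    and R_counit_left: "sw (dR a) (\<lambda>a1 a2. a2 ** tR (piR a1)) = a"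
    and L_counit_right: "sw (dL a) (\<lambda>a1 a2. tL (piL a2) ** a1) = a"
    and R_counit_right: "sw (dR a) (\<lambda>a1 a2. a1 ** sR (piR a2)) = a"
    and ax_LL: "sw (dL h) (\<lambda>a b. sw (dL a) (\<lambda>a1 a2. frag_of (a1, a2, b)))
        - sw (dL h) (\<lambda>a b. sw (dL b) (\<lambda>b1 b2. frag_of (a, b1, b2)))
        \<in> tensor3_ker (\<lambda>h l. tL l ** h) (\<lambda>l h. sL l ** h) (\<lambda>h l. tL l ** h) (\<lambda>l h. sL l ** h)"
    and ax_RR: "sw (dR h) (\<lambda>a b. sw (dR a) (\<lambda>a1 a2. frag_of (a1, a2, b)))
        - sw (dR h) (\<lambda>a b. sw (dR b) (\<lambda>b1 b2. frag_of (a, b1, b2)))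
        \<in> tensor3_ker (\<lambda>h r. h ** sR r) (\<lambda>r h. h ** tR r) (\<lambda>h r. h ** sR r) (\<lambda>r h. h ** tR r)"
    and ax_LR: "sw (dR h) (\<lambda>a b. sw (dL a) (\<lambda>a1 a2. frag_of (a1, a2, b)))
        - sw (dL h) (\<lambda>a b. sw (dR b) (\<lambda>b1 b2. frag_of (a, b1, b2)))
        \<in> tensor3_ker (\<lambda>h l. tL l ** h) (\<lambda>l h. sL l ** h) (\<lambda>h r. h ** sR r) (\<lambda>r h. h ** tR r)"
    and ax_RL: "sw (dL h) (\<lambda>a b. sw (dR a) (\<lambda>a1 a2. frag_of (a1, a2, b)))
        - sw (dR h) (\<lambda>a b. sw (dL b) (\<lambda>b1 b2. frag_of (a, b1, b2)))
        \<in> tensor3_ker (\<lambda>h r. h ** sR r) (\<lambda>r h. h ** tR r) (\<lambda>h l. tL l ** h) (\<lambda>l h. sL l ** h)"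
begin

text \<open>\<open>s\<^sub>L\<close> trades places with \<open>t\<^sub>R\<close>, and
  \<open>t\<^sub>L\<close> with \<open>s\<^sub>R\<close>. The locale lists every axiom together with
  its mirror image in exactly the form that this substitution produces (whence the exchanged sums in
  \<open>ax_R_mult\<close>), so each goal is one of the axioms.\<close>

lemma op: "bialgebroid_pair (\<lambda>a b. b ** a) one tR sR piR dR tL sL piL dL"
  by unfold_locales
    (fact mul_assoc[symmetric] mul_add_left mul_add_right one_mul mul_one sL_add sR_add tL_add tR_add
      sL_mult sR_mult tL_mult tR_mult sL_one sR_one tL_one tR_one sL_tL sR_tR
      sL_tR tL_sR sR_tL tR_sL piL_add piR_add piL_s piR_s piL_t piR_t piL_one piR_one
      piL_mul_s piR_mul_s piL_mul_t piR_mul_t ax_L_plus ax_R_plus ax_L_one ax_R_one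
      ax_L_mult ax_R_mult ax_L_s ax_R_s ax_L_t ax_R_t ax_L_takeuchi ax_R_takeuchi
      L_counit_left R_counit_left L_counit_right R_counit_right ax_LL ax_RR ax_LR ax_RL)+

abbreviation balL :: "('h \<Rightarrow> 'h \<Rightarrow> 'p::ab_group_add) \<Rightarrow> bool" where
  "balL \<equiv> balanced (\<lambda>h l. tL l ** h) (\<lambda>l h. sL l ** h)"

abbreviation balR :: "('h \<Rightarrow> 'h \<Rightarrow> 'p::ab_group_add) \<Rightarrow> bool" where
  "balR \<equiv> balanced (\<lambda>h r. h ** sR r) (\<lambda>r h. h ** tR r)"

abbreviation balLL :: "('h \<Rightarrow> 'h \<Rightarrow> 'h \<Rightarrow> 'p::ab_group_add) \<Rightarrow> bool" where
  "balLL \<equiv> balanced3 (\<lambda>h l. tL l ** h) (\<lambda>l h. sL l ** h) (\<lambda>h l. tL l ** h) (\<lambda>l h. sL l ** h)"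

abbreviation balRR :: "('h \<Rightarrow> 'h \<Rightarrow> 'h \<Rightarrow> 'p::ab_group_add) \<Rightarrow> bool" where
  "balRR \<equiv> balanced3 (\<lambda>h r. h ** sR r) (\<lambda>r h. h ** tR r) (\<lambda>h r. h ** sR r) (\<lambda>r h. h ** tR r)"

abbreviation balLR :: "('h \<Rightarrow> 'h \<Rightarrow> 'h \<Rightarrow> 'p::ab_group_add) \<Rightarrow> bool" where
  "balLR \<equiv> balanced3 (\<lambda>h l. tL l ** h) (\<lambda>l h. sL l ** h) (\<lambda>h r. h ** sR r) (\<lambda>r h. h ** tR r)"

abbreviation balRL :: "('h \<Rightarrow> 'h \<Rightarrow> 'h \<Rightarrow> 'p::ab_group_add) \<Rightarrow> bool" where
  "balRL \<equiv> balanced3 (\<lambda>h r. h ** sR r) (\<lambda>r h. h ** tR r) (\<lambda>h l. tL l ** h) (\<lambda>l h. sL l ** h)"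

lemma additive_mul_left: "additive_map (\<lambda>a. a ** b)"
  and additive_mul_right: "additive_map (\<lambda>b. a ** b)"
  and additive_tL: "additive_map tL" and additive_sR: "additive_map sR"
  and additive_tR: "additive_map tR" and additive_piR: "additive_map piR"
  by (simp_all add: additive_map_def mul_add_left mul_add_right tL_add sR_add tR_add piR_add)

lemmas distribs = mul_add_left mul_add_right sL_add tL_add sR_add tR_add piL_add piR_add sw_add

lemma mul_sw: "c ** sw d f = sw d (\<lambda>a b. c ** f a b)"
  by (rule sw_hom[OF additive_mul_right, symmetric])

lemma sw_mul: "sw d f ** c = sw d (\<lambda>a b. f a b ** c)"
  by (rule sw_hom[OF additive_mul_left, symmetric])

lemma L_plus: "balL f \<Longrightarrow> sw (dL (a + b)) f = sw (dL a) f + sw (dL b) f"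
  using sw_cong_ker[OF ax_L_plus] by (simp add: sw_plus_arg)

lemma additive_L: "balL f \<Longrightarrow> additive_map (\<lambda>a. sw (dL a) f)"
  by (simp add: additive_map_def L_plus)

lemma sL_tL': "sL l ** (tL l' ** a) = tL l' ** (sL l ** a)"
  by (simp add: sL_tL flip: mul_assoc)

lemma L_one: "balL f \<Longrightarrow> sw (dL one) f = f one one"
  using sw_cong_ker[OF ax_L_one] by simp

lemma L_mult: "balL f \<Longrightarrow>
    sw (dL (a ** b)) f = sw (dL a) (\<lambda>a1 a2. sw (dL b) (\<lambda>b1 b2. f (a1 ** b1) (a2 ** b2)))"
  using sw_cong_ker[OF ax_L_mult] by (simp add: sw_sw)

lemma L_mult': "balL f \<Longrightarrow>
    sw (dL (a ** b)) f = sw (dL b) (\<lambda>b1 b2. sw (dL a) (\<lambda>a1 a2. f (a1 ** b1) (a2 ** b2)))"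
  by (subst sw_swap) (rule L_mult)

lemma L_s: "balL f \<Longrightarrow> sw (dL (sL l ** a)) f = sw (dL a) (\<lambda>a1 a2. f (sL l ** a1) a2)"
  using sw_cong_ker[OF ax_L_s] by (simp add: sw_sw)

lemma L_t: "balL f \<Longrightarrow> sw (dL (tL l ** a)) f = sw (dL a) (\<lambda>a1 a2. f a1 (tL l ** a2))"
  using sw_cong_ker[OF ax_L_t] by (simp add: sw_sw)

lemma L_takeuchi: "balL f \<Longrightarrow> sw (dL a) (\<lambda>a1 a2. f (a1 ** tL l) a2) = sw (dL a) (\<lambda>a1 a2. f a1 (a2 ** sL l))"
  using sw_cong_ker[OF ax_L_takeuchi] by (simp add: sw_sw)

lemma coassoc_LL: "balLL f \<Longrightarrow> sw (dL h) (\<lambda>a b. sw (dL a) (\<lambda>a1 a2. f a1 a2 b))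
    = sw (dL h) (\<lambda>a b. sw (dL b) (\<lambda>b1 b2. f a b1 b2))"
  by (rule sw_coassoc[OF ax_LL])

lemma coassoc_LR: "balLR f \<Longrightarrow> sw (dR h) (\<lambda>a b. sw (dL a) (\<lambda>a1 a2. f a1 a2 b))
    = sw (dL h) (\<lambda>a b. sw (dR b) (\<lambda>b1 b2. f a b1 b2))"
  by (rule sw_coassoc[OF ax_LR])

lemmas R_plus = bialgebroid_pair.L_plus[OF op]
  and additive_R = bialgebroid_pair.additive_L[OF op]
  and R_s = bialgebroid_pair.L_t[OF op]
  and R_takeuchi = bialgebroid_pair.L_takeuchi[OF op]
  and coassoc_RL = bialgebroid_pair.coassoc_LR[OF op]

lemmas R_mult = bialgebroid_pair.L_mult'[OF op]

lemma piL_sL: "piL (sL l) = l" and piL_tL: "piL (tL l) = l"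
  using piL_s[of l one] piL_t[of l one] by (simp_all add: mul_one piL_one)

lemmas piR_sR = bialgebroid_pair.piL_tL[OF op]

text \<open>By \<open>tL_sR\<close> the values of \<open>s\<^sub>R\<close> are values of
  \<open>t\<^sub>L\<close>, which commute with those of \<open>s\<^sub>L\<close>.\<close>

lemma sL_sR: "sL l ** sR r = sR r ** sL l"
  using sL_tL[of l "piL (sR r)"] by (simp add: tL_sR)

lemma sL_sR': "sL l ** (sR r ** a) = sR r ** (sL l ** a)"
  by (simp add: sL_sR flip: mul_assoc)

text \<open>Factorwise multiplication is not defined on all of \<open>H \<otimes>\<^sub>L H\<close>
  in general; the Takeuchi condition on \<open>\<gamma>\<^sub>L(a)\<close> is what makes
  multiplication by it from the left well defined.\<close>

lemma balL_takeuchi: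
  assumes "balL f"
  shows "balL (\<lambda>b1 b2. sw (dL a) (\<lambda>a1 a2. f (a1 ** b1) (a2 ** b2)))"
proof (rule balancedI)
  fix b1 b2 l
  have "balL (\<lambda>a1 a2. f (a1 ** b1) (a2 ** b2))"
    using assms by (simp add: balanced_def mul_assoc mul_add_left)
  from L_takeuchi[OF this, of a l]
  show "sw (dL a) (\<lambda>a1 a2. f (a1 ** (tL l ** b1)) (a2 ** b2))
      = sw (dL a) (\<lambda>a1 a2. f (a1 ** b1) (a2 ** (sL l ** b2)))"
    by (simp add: mul_assoc)
qed (simp_all add: mul_add_right balanced_add_left[OF assms] balanced_add_right[OF assms] sw_add)

text \<open>For factors \<open>b\<close> whose comultiplication is a single tensor, such as
  \<open>s\<^sub>L(l)\<close> and \<open>t\<^sub>L(l)\<close>.\<close>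

lemma L_mul:
  assumes "balL f" "\<And>g::'h \<Rightarrow> 'h \<Rightarrow> 'p. balL g \<Longrightarrow> sw (dL b) g = g b1 b2"
  shows "sw (dL (a ** b)) f = sw (dL a) (\<lambda>a1 a2. f (a1 ** b1) (a2 ** b2) :: 'p::ab_group_add)"
  unfolding L_mult[OF assms(1)]
  by (subst sw_swap) (rule assms(2)[OF balL_takeuchi[OF assms(1)]])

lemma L_sL: "balL f \<Longrightarrow> sw (dL (sL l)) f = f (sL l) one"
  and L_tL: "balL f \<Longrightarrow> sw (dL (tL l)) f = f one (tL l)"
proof -
  show "sw (dL (sL l)) f = f (sL l) one" if "balL f"
    using L_s[OF that, of l one] L_one[of "\<lambda>a b. f (sL l ** a) b"] that
    by (simp add: balanced_def mul_one mul_add_right sL_tL')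
  show "sw (dL (tL l)) f = f one (tL l)" if "balL f"
    using L_t[OF that, of l one] L_one[of "\<lambda>a b. f a (tL l ** b)"] that
    by (simp add: balanced_def mul_one mul_add_right flip: sL_tL')
qed

lemma L_mul_s: "balL f \<Longrightarrow> sw (dL (a ** sL l)) f = sw (dL a) (\<lambda>a1 a2. f (a1 ** sL l) a2)"
  using L_mul[of f "sL l" "sL l" one a] by (simp add: L_sL mul_one)

lemma L_mul_t: "balL f \<Longrightarrow> sw (dL (a ** tL l)) f = sw (dL a) (\<lambda>a1 a2. f a1 (a2 ** tL l))"
  using L_mul[of f "tL l" one "tL l" a] by (simp add: L_tL mul_one)

lemmas R_s_mul = bialgebroid_pair.L_mul_t[OF op]

text \<open>By \<open>sL_tR\<close> and \<open>tL_sR\<close>, \<open>t\<^sub>R(r)\<close> is a value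
  of \<open>s\<^sub>L\<close> and \<open>s\<^sub>R(r)\<close> one of \<open>t\<^sub>L\<close>, so
  the rules for scalars from \<open>L\<close> also move scalars from \<open>R\<close>.\<close>

lemma L_tR: "balL f \<Longrightarrow> sw (dL (tR r ** a)) f = sw (dL a) (\<lambda>a1 a2. f (tR r ** a1) a2)"
  and L_mul_tR: "balL f \<Longrightarrow> sw (dL (a ** tR r)) f = sw (dL a) (\<lambda>a1 a2. f (a1 ** tR r) a2)"
  and L_mul_sR: "balL f \<Longrightarrow> sw (dL (a ** sR r)) f = sw (dL a) (\<lambda>a1 a2. f a1 (a2 ** sR r))"
  using L_s[of f "piL (tR r)" a] L_mul_s[of f a "piL (tR r)"]
    L_mul_t[of f a "piL (sR r)"]
  by (simp_all add: sL_tR tL_sR)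

lemmas R_mul_sL = bialgebroid_pair.L_tR[OF op]
  and R_sL = bialgebroid_pair.L_mul_tR[OF op] and R_tL = bialgebroid_pair.L_mul_sR[OF op]

end

section \<open>The antipode\<close>

locale hopf = bialgebroid_pair mul one sL tL piL dL sR tR piR dR
  for mul :: "'h::ab_group_add \<Rightarrow> 'h \<Rightarrow> 'h" (infixl "**" 70)
    and one :: 'h
    and sL tL :: "'l::{ring,monoid_mult} \<Rightarrow> 'h" and piL :: "'h \<Rightarrow> 'l"
    and dL :: "'h \<Rightarrow> ('h \<times> 'h) frag"
    and sR tR :: "'r::{ring,monoid_mult} \<Rightarrow> 'h" and piR :: "'h \<Rightarrow> 'r"
    and dR :: "'h \<Rightarrow> ('h \<times> 'h) frag" +
  fixes S T :: "'h \<Rightarrow> 'h"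
  assumes S_add: "S (a + b) = S a + S b"
    and ax_S_tL: "S (tL l ** a ** tL l') = sL l' ** S a ** sL l"
    and ax_S_tR: "S (tR r ** a ** tR r') = sR r' ** S a ** sR r"
    and S_left: "sw (dL a) (\<lambda>a1 a2. S a1 ** a2) = sR (piR a)"
    and S_right: "sw (dR a) (\<lambda>a1 a2. a1 ** S a2) = sL (piL a)"
    and T_S: "T (S a) = a" and S_T: "S (T a) = a"
begin

lemma additive_S: "additive_map S"
  by (simp add: additive_map_def S_add)

lemma S_sw: "S (sw d f) = sw d (\<lambda>a b. S (f a b))"
  by (rule sw_hom[OF additive_S, symmetric])

lemma S_tL_mul: "S (tL l ** a) = S a ** sL l" and S_mul_tL: "S (a ** tL l) = sL l ** S a"
  using ax_S_tL[of l a 1] ax_S_tL[of 1 a l] by (simp_all add: sL_one tL_one mul_one one_mul)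

lemma S_tR_mul: "S (tR r ** a) = S a ** sR r" and S_mul_tR: "S (a ** tR r) = sR r ** S a"
  using ax_S_tR[of r a 1] ax_S_tR[of 1 a r] by (simp_all add: sR_one tR_one mul_one one_mul)

lemmas S_simps = S_add S_tL_mul S_mul_tL S_tR_mul S_mul_tR

lemma S_one: "S one = one"
  using S_left[of one] L_one[of "\<lambda>a b. S a ** b"]
  by (simp add: balanced_def S_simps distribs mul_assoc piR_one sR_one mul_one)

lemma S_left_mul: "sw (dL a) (\<lambda>a1 a2. S a1 ** (a2 ** c)) = sR (piR a) ** c"
  unfolding S_left[symmetric] sw_mul mul_assoc ..

lemma S_right_mul: "sw (dR a) (\<lambda>a1 a2. c ** (a1 ** (S a2 ** d))) = c ** (sL (piL a) ** d)"
  unfolding S_right[symmetric] sw_mul mul_sw mul_assoc ..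

text \<open>Uniqueness of convolution inverses, with two comultiplications:
  \<open>S(x\<^sub>1) x\<^sub>2 = s\<^sub>R(\<pi>\<^sub>R(x))\<close> inserts
  \<open>S(g\<^sub>1 h\<^sub>1)\<close>, and mixed coassociativity then exposes
  \<open>h\<^sup>1 S(h\<^sup>2)\<close> and after it \<open>g\<^sup>1 S(g\<^sup>2)\<close>, which
  collapse to values of \<open>\<pi>\<^sub>L\<close>.\<close>

lemma S_mult: "S (g ** h) = S h ** S g"
proof -
  let ?K = "\<lambda>g1 h1 g3 h3 h4 g4. S (g1 ** h1) ** (g3 ** (h3 ** (S h4 ** S g4)))"
  \<comment> \<open>The counit of \<open>g'\<close> enters \<open>S\<close> as
    \<open>t\<^sub>R\<close>. Expanding \<open>h\<close> by its counit and applying the Takeuchi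
    condition unites \<open>g'\<close> and \<open>h'\<close> under one \<open>\<pi>\<^sub>R\<close>,
    so that the left antipode axiom can be read backwards at the product.\<close>
  have tR_S: "S h ** sR (piR g') = sw (dR h) (\<lambda>h' h4. sR (piR (g' ** h')) ** S h4)" for g'
  proof -
    have bal: "balR (\<lambda>h' h4. sR (piR h') ** S h4)"
      by (simp add: balanced_def distribs S_simps piR_s sR_mult mul_assoc)
    have "S h ** sR (piR g') = S (tR (piR g') ** h)" by (simp add: S_tR_mul)
    also have "\<dots> = S (tR (piR g') ** sw (dR h) (\<lambda>h' h4. h4 ** tR (piR h')))"
      by (simp add: R_counit_left)
    also have "\<dots> = sw (dR h) (\<lambda>h' h4. sR (piR h') ** S (tR (piR g') ** h4))"
      by (simp add: mul_sw S_sw S_simps flip: mul_assoc)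
    also have "\<dots> = sw (dR h) (\<lambda>h' h4. sR (piR (sR (piR g') ** h')) ** S h4)"
      by (rule R_takeuchi[OF bal, symmetric])
    finally show ?thesis by (simp add: piR_mul_s)
  qed
  have bal1: "balL (\<lambda>p q. S p ** (q ** (S h4 ** S g4)))" for h4 g4
    by (simp add: balanced_def distribs S_simps mul_assoc)
  have bal2: "balLR (\<lambda>h1 h3 h4. sw (dL g') (\<lambda>g1 g3. ?K g1 h1 g3 h3 h4 g4))" for g' g4
  proof (rule balanced3I)
    fix h1 h3 h4 l
    have "balL (\<lambda>g1 g3. ?K g1 h1 g3 h3 h4 g4)"
      by (simp add: balanced_def distribs S_simps mul_assoc)
    from L_takeuchi[OF this, of g' l]
    show "sw (dL g') (\<lambda>g1 g3. ?K g1 (tL l ** h1) g3 h3 h4 g4)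
        = sw (dL g') (\<lambda>g1 g3. ?K g1 h1 g3 (sL l ** h3) h4 g4)"
      by (simp add: mul_assoc)
  qed (simp_all add: distribs S_simps mul_assoc)
  have bal3: "balLR (\<lambda>g1 g3 g4. S (g1 ** h1) ** (g3 ** (sL (piL h2) ** S g4)))" for h1 h2
    by (rule balanced3I) (simp_all add: distribs S_simps mul_assoc sL_sR')
  have bal4: "balR (\<lambda>a b. a ** S b)"
    by (simp add: balanced_def distribs S_simps mul_assoc)
  \<comment> \<open>The scalar left over from \<open>h\<close> is absorbed into the leg of
    \<open>g\<close> before the right antipode axiom is applied to that leg.\<close>
  have collapse: "sw (dR a) (\<lambda>a1 a2. a1 ** (sL l ** S a2)) = sL (piL (a ** sL l))" for a l
    using R_mul_sL[OF bal4] by (simp add: S_right mul_assoc)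
  have bal5: "balL (\<lambda>a b. S (tL (piL b) ** a))"
    by (simp add: balanced_def distribs S_simps piL_s sL_mult mul_assoc)
  have "S h ** S g = S h ** S (sw (dR g) (\<lambda>g' g4. g4 ** tR (piR g')))"
    by (simp add: R_counit_left)
  also have "\<dots> = sw (dR g) (\<lambda>g' g4. S h ** sR (piR g') ** S g4)"
    by (simp add: S_sw mul_sw S_simps mul_assoc)
  also have "\<dots> = sw (dR g) (\<lambda>g' g4. sw (dR h) (\<lambda>h' h4. sR (piR (g' ** h')) ** (S h4 ** S g4)))"
    by (simp add: tR_S sw_mul mul_assoc)
  also have "\<dots> = sw (dR g) (\<lambda>g' g4. sw (dR h) (\<lambda>h' h4.
      sw (dL (g' ** h')) (\<lambda>p q. S p ** (q ** (S h4 ** S g4)))))"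
    by (simp add: S_left_mul)
  also have "\<dots> = sw (dR g) (\<lambda>g' g4. sw (dR h) (\<lambda>h' h4.
      sw (dL h') (\<lambda>h1 h3. sw (dL g') (\<lambda>g1 g3. ?K g1 h1 g3 h3 h4 g4))))"
    by (simp add: L_mult'[OF bal1] mul_assoc)
  also have "\<dots> = sw (dR g) (\<lambda>g' g4. sw (dL h) (\<lambda>h1 h2.
      sw (dR h2) (\<lambda>h3 h4. sw (dL g') (\<lambda>g1 g3. ?K g1 h1 g3 h3 h4 g4))))"
    by (simp add: coassoc_LR[OF bal2])
  also have "\<dots> = sw (dR g) (\<lambda>g' g4. sw (dL h) (\<lambda>h1 h2.
      sw (dL g') (\<lambda>g1 g3. sw (dR h2) (\<lambda>h3 h4. (S (g1 ** h1) ** g3) ** (h3 ** (S h4 ** S g4))))))"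
    by (subst sw_swap[of "dL _" "dR _"]) (simp add: mul_assoc)
  also have "\<dots> = sw (dL h) (\<lambda>h1 h2. sw (dR g) (\<lambda>g' g4.
      sw (dL g') (\<lambda>g1 g3. S (g1 ** h1) ** (g3 ** (sL (piL h2) ** S g4)))))"
    unfolding S_right_mul by (subst sw_swap) (simp add: mul_assoc)
  also have "\<dots> = sw (dL h) (\<lambda>h1 h2. sw (dL g) (\<lambda>g1 g2.
      sw (dR g2) (\<lambda>g3 g4. S (g1 ** h1) ** (g3 ** (sL (piL h2) ** S g4)))))"
    by (simp add: coassoc_LR[OF bal3])
  also have "\<dots> = sw (dL h) (\<lambda>h1 h2. sw (dL g) (\<lambda>g1 g2. S (g1 ** h1) ** sL (piL (g2 ** h2))))"
    by (simp add: collapse piL_mul_s mul_assoc flip: mul_sw)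
  also have "\<dots> = sw (dL (g ** h)) (\<lambda>a b. S (tL (piL b) ** a))"
    unfolding L_mult'[OF bal5] by (simp add: S_simps)
  also have "\<dots> = S (g ** h)"
    by (simp add: L_counit_right flip: S_sw)
  finally show ?thesis ..
qed

lemma S_tL: "S (tL l) = sL l" and S_tR: "S (tR r) = sR r"
  using S_tL_mul[of l one] S_tR_mul[of r one] by (simp_all add: S_one mul_one one_mul)

lemma S_sL: "S (sL l) = sR (piR (sL l))"
  using S_tR[of "piR (sL l)"] by (simp add: tR_sL)

lemma S_sR: "S (sR r) = sL (piL (sR r))"
  using S_tL[of "piL (sR r)"] by (simp add: tL_sR)

lemma T_eq_iff: "T a = b \<longleftrightarrow> a = S b"
  by (metis T_S S_T)

lemma T_add: "T (a + b) = T a + T b" and T_mult: "T (a ** b) = T b ** T a"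
  and T_sL: "T (sL l) = tL l" and T_sR: "T (sR r) = tR r"
  by (simp_all add: T_eq_iff S_add S_mult S_T S_tL S_tR)

lemma T_tL: "T (tL l) = tR (piR (tL l))" and T_tR: "T (tR r) = tL (piL (tR r))"
  by (simp_all add: T_eq_iff S_tL S_tR sR_tL sL_tR)

lemma additive_T: "additive_map T"
  by (simp add: additive_map_def T_add)

lemma T_sw: "T (sw d f) = sw d (\<lambda>a b. T (f a b))"
  by (rule sw_hom[OF additive_T, symmetric])

lemma T_left: "sw (dR a) (\<lambda>a1 a2. a2 ** T a1) = tL (piL a)"
proof -
  have "T (sw (dR a) (\<lambda>a1 a2. a1 ** S a2)) = tL (piL a)"
    by (simp add: S_right T_sL)
  then show ?thesis by (simp add: T_sw T_mult T_S)
qed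

lemma T_right: "sw (dL a) (\<lambda>a1 a2. T a2 ** a1) = tR (piR a)"
proof -
  have "T (sw (dL a) (\<lambda>a1 a2. S a1 ** a2)) = tR (piR a)"
    by (simp add: S_left T_sR)
  then show ?thesis by (simp add: T_sw T_mult T_S)
qed

text \<open>For the reversed multiplication the antipode is the inverse one; \<open>T_left\<close>
  and \<open>T_right\<close> are its two axioms.\<close>

lemma hopf_op: "hopf (\<lambda>a b. b ** a) one tR sR piR dR tL sL piL dL T S"
proof -
  interpret o: bialgebroid_pair "\<lambda>a b. b ** a" one tR sR piR dR tL sL piL dL
    by (rule op)
  show ?thesis
    by unfold_locales (simp_all add: T_add T_mult T_sL T_sR T_left T_right T_S S_T mul_assoc)
qed

text \<open>The antipode carries \<open>\<gamma>\<^sub>R\<close> to the flipped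
  \<open>\<gamma>\<^sub>L\<close>. In
  \<open>S(h) = S(h\<^sub>1) s\<^sub>L(\<pi>\<^sub>L(h\<^sub>2))\<close> the counit of
  \<open>h\<^sub>2\<close> is replaced by legs followed by antipodes; regrouping then makes
  \<open>S(p) y\<close> a counit, and only the antipodes survive.\<close>

lemma L_S:
  fixes f :: "'h \<Rightarrow> 'h \<Rightarrow> 'p::ab_group_add"
  assumes f: "balL f"
  shows "sw (dL (S h)) f = sw (dR h) (\<lambda>a b. f (S b) (S a))"
proof -
  note f_add = balanced_add_left[OF f] balanced_add_right[OF f]
  note f_swap = balanced_swap[OF f]
  have f_sR: "f (sR r ** a) b = f a (S (sR r) ** b)" for r a b
    using f_swap[of "piL (sR r)" a b] by (simp add: tL_sR S_sR)
  let ?G = "\<lambda>v w c d. f (c ** S w) (d ** S v)"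
  have balG: "balL (?G v w)" for v w
    by (simp add: balanced_def distribs f_add f_swap mul_assoc)
  note G_add = distribs f_add S_add mul_assoc
  \<comment> \<open>Read from right to left: when \<open>q\<close> is split twice by
    \<open>\<gamma>\<^sub>R\<close> into \<open>y\<close>, \<open>v\<close>, \<open>w\<close>,
    multiplying \<open>\<gamma>\<^sub>L(y)\<close> by \<open>S(w) \<otimes> S(v)\<close> cancels to
    \<open>s\<^sub>L(\<pi>\<^sub>L(q)) \<otimes> 1\<close>. So \<open>S(w) \<otimes> S(v)\<close>
    acts as a right convolution inverse of \<open>\<gamma>\<^sub>L\<close>.\<close>
  have step: "sw (dL (a ** sL (piL q))) f
      = sw (dR q) (\<lambda>y' w. sw (dR y') (\<lambda>y v. sw (dL (a ** y)) (?G v w)))" for a q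
  proof -
    have bal: "balLR (\<lambda>y1 y2 v. sw (dL a) (\<lambda>a1 a2. f (a1 ** (y1 ** S w)) (a2 ** (y2 ** S v))))" for w
    proof (rule balanced3I)
      fix y1 y2 v l
      have "balL (\<lambda>a1 a2. f (a1 ** (y1 ** S w)) (a2 ** (y2 ** S v)))"
        by (simp add: balanced_def G_add f_swap)
      from L_takeuchi[OF this, of a l]
      show "sw (dL a) (\<lambda>a1 a2. f (a1 ** (tL l ** y1 ** S w)) (a2 ** (y2 ** S v)))
          = sw (dL a) (\<lambda>a1 a2. f (a1 ** (y1 ** S w)) (a2 ** (sL l ** y2 ** S v)))"
        by (simp add: mul_assoc)
    qed (simp_all add: G_add S_simps)
    have "sw (dR q) (\<lambda>y' w. sw (dR y') (\<lambda>y v. sw (dL (a ** y)) (?G v w)))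
        = sw (dR q) (\<lambda>y' w. sw (dR y') (\<lambda>y v. sw (dL y) (\<lambda>y1 y2.
            sw (dL a) (\<lambda>a1 a2. f (a1 ** (y1 ** S w)) (a2 ** (y2 ** S v))))))"
      by (simp add: L_mult'[OF balG] mul_assoc)
    also have "\<dots> = sw (dR q) (\<lambda>y' w. sw (dL y') (\<lambda>y1 z. sw (dR z) (\<lambda>y2 v.
            sw (dL a) (\<lambda>a1 a2. f (a1 ** (y1 ** S w)) (a2 ** (y2 ** S v))))))"
      by (simp add: coassoc_LR[OF bal])
    also have "\<dots> = sw (dR q) (\<lambda>y' w. sw (dL y') (\<lambda>y1 z.
            sw (dL a) (\<lambda>a1 a2. f (a1 ** (y1 ** S w)) (a2 ** sL (piL z)))))"
      by (subst sw_swap[of "dR _" "dL a"])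
        (simp add: sw_hom[OF balanced_additive_right[OF f]] S_right flip: mul_sw)
    also have "\<dots> = sw (dR q) (\<lambda>y' w. sw (dL y') (\<lambda>y1 z.
            sw (dL a) (\<lambda>a1 a2. f (a1 ** (tL (piL z) ** y1 ** S w)) a2)))"
    proof -
      have "balL (\<lambda>a1 a2. f (a1 ** (y1 ** S w)) a2)" for y1 w
        by (simp add: balanced_def G_add f_swap)
      from L_takeuchi[OF this] show ?thesis by (simp add: mul_assoc)
    qed
    also have "\<dots> = sw (dR q) (\<lambda>y' w. sw (dL a) (\<lambda>a1 a2. f (a1 ** (y' ** S w)) a2))"
      by (subst sw_swap[of "dL _" "dL a"])
        (simp add: sw_hom[OF balanced_additive_left[OF f]] L_counit_right flip: mul_sw sw_mul)
    also have "\<dots> = sw (dL a) (\<lambda>a1 a2. f (a1 ** sL (piL q)) a2)"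
      by (subst sw_swap[of "dR _" "dL a"])
        (simp add: sw_hom[OF balanced_additive_left[OF f]] S_right flip: mul_sw)
    also have "\<dots> = sw (dL (a ** sL (piL q))) f"
      by (rule L_mul_s[OF f, symmetric])
    finally show ?thesis ..
  qed
  have G_tR: "sw (dL (a ** sR r)) (?G v w) = sw (dL a) (?G (v ** tR r) w)" for a r v w
    by (simp add: L_mul_sR[OF balG] S_simps mul_assoc)
  have bal1: "balLR (\<lambda>p y' w. sw (dR y') (\<lambda>y v. sw (dL (S p ** y)) (?G v w)))"
  proof (rule balanced3I)
    fix p y' w r
    have bal: "balR (\<lambda>y v. sw (dL (S p ** y)) (?G v w))"
      by (rule balancedI) (simp_all add: L_plus[OF balG] G_add G_tR flip: mul_assoc)
    have "sw (dR (y' ** sR r)) (\<lambda>y v. sw (dL (S p ** y)) (?G v w))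
        = sw (dR y') (\<lambda>y v. sw (dL (S p ** y)) (\<lambda>c d. f (c ** S w) (d ** (S (sR r) ** S v))))"
      by (simp add: R_s[OF bal] S_mult)
    also have "\<dots> = sw (dR y') (\<lambda>y v. sw (dL (S p ** y)) (?G v (w ** tR r)))"
    proof -
      have "sw (dL a) (\<lambda>c d. f (c ** S w) (d ** (S (sR r) ** S v))) = sw (dL a) (?G v (w ** tR r))" for a v
        using L_takeuchi[OF balG[of w v], of a "piL (sR r)"]
        by (simp add: S_simps mul_assoc tL_sR S_sR)
      then show ?thesis by simp
    qed
    finally show "sw (dR (y' ** sR r)) (\<lambda>y v. sw (dL (S p ** y)) (?G v w))
        = sw (dR y') (\<lambda>y v. sw (dL (S p ** y)) (?G v (w ** tR r)))" .
  next
    fix p p' y w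
    show "sw (dR y) (\<lambda>y v. sw (dL (S (p + p') ** y)) (?G v w))
      = sw (dR y) (\<lambda>y v. sw (dL (S p ** y)) (?G v w)) + sw (dR y) (\<lambda>y v. sw (dL (S p' ** y)) (?G v w))"
      by (simp add: S_add mul_add_left L_plus[OF balG] sw_add)
  next
    fix p y y' w l
    have bal: "balR (\<lambda>y v. sw (dL (S p ** y)) (?G v w))"
      by (rule balancedI) (simp_all add: L_plus[OF balG] G_add G_tR flip: mul_assoc)
    show "sw (dR (y + y')) (\<lambda>y v. sw (dL (S p ** y)) (?G v w))
      = sw (dR y) (\<lambda>y v. sw (dL (S p ** y)) (?G v w)) + sw (dR y') (\<lambda>y v. sw (dL (S p ** y)) (?G v w))"
      by (rule R_plus[OF bal])
    show "sw (dR y) (\<lambda>y v. sw (dL (S (tL l ** p) ** y)) (?G v w))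
      = sw (dR (sL l ** y)) (\<lambda>y v. sw (dL (S p ** y)) (?G v w))"
      by (simp add: R_sL[OF bal] S_simps mul_assoc)
  qed (simp add: G_add)
  have bal2: "balLR (\<lambda>p y v. sw (dL (S p ** y)) (?G v w))" for w
    by (rule balanced3I) (simp_all add: L_plus[OF balG] G_add S_simps G_tR flip: mul_assoc)
  have "sw (dL (S h)) f = sw (dL (sw (dL h) (\<lambda>p q. S p ** sL (piL q)))) f"
    using arg_cong[OF L_counit_right[of h], of S] by (simp add: S_sw S_simps)
  also have "\<dots> = sw (dL h) (\<lambda>p q. sw (dL (S p ** sL (piL q))) f)"
    by (rule sw_hom[OF additive_L[OF f], symmetric])
  also have "\<dots> = sw (dL h) (\<lambda>p q. sw (dR q) (\<lambda>y' w. sw (dR y') (\<lambda>y v. sw (dL (S p ** y)) (?G v w))))"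
    by (simp add: step)
  also have "\<dots> = sw (dR h) (\<lambda>u w. sw (dL u) (\<lambda>p y'. sw (dR y') (\<lambda>y v. sw (dL (S p ** y)) (?G v w))))"
    by (rule coassoc_LR[OF bal1, symmetric])
  also have "\<dots> = sw (dR h) (\<lambda>u w. sw (dR u) (\<lambda>x v. sw (dL x) (\<lambda>p y. sw (dL (S p ** y)) (?G v w))))"
    by (simp add: coassoc_LR[OF bal2])
  also have "\<dots> = sw (dR h) (\<lambda>u w. sw (dR u) (\<lambda>x v. sw (dL (sR (piR x))) (?G v w)))"
    by (simp add: sw_hom[OF additive_L[OF balG]] S_left)
  also have "\<dots> = sw (dR h) (\<lambda>u w. sw (dR u) (\<lambda>x v. f (S w) (S (v ** tR (piR x)))))"
  proof -
    have "sw (dL (sR r)) (?G v w) = f (S w) (S (v ** tR r))" for r v w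
      using L_tL[OF balG[of w v], of "piL (sR r)"] by (simp add: tL_sR S_simps one_mul)
    then show ?thesis by simp
  qed
  also have "\<dots> = sw (dR h) (\<lambda>u w. f (S w) (S u))"
    by (simp add: sw_hom[OF balanced_additive_right[OF f]] R_counit_left flip: S_sw)
  finally show ?thesis .
qed

text \<open>Reversing the multiplication would turn \<open>L_S\<close> into a statement about
  \<open>T\<close>, not \<open>S\<close>. Hence the calculation is repeated with the antipodes
  multiplied from the left, where the left antipode axiom does the first cancellation.\<close>

lemma R_S:
  fixes f :: "'h \<Rightarrow> 'h \<Rightarrow> 'p::ab_group_add"
  assumes f: "balR f"
  shows "sw (dR (S h)) f = sw (dL h) (\<lambda>a b. f (S b) (S a))"
proof -
  note f_add = balanced_add_left[OF f] balanced_add_right[OF f]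
  note f_swap = balanced_swap[OF f]
  let ?G = "\<lambda>w v c d. f (S v ** c) (S w ** d)"
  have balG: "balR (?G w v)" for w v
    by (simp add: balanced_def distribs f_add f_swap flip: mul_assoc)
  note G_add = distribs f_add S_add mul_assoc
  have step: "sw (dR (sR (piR q) ** a)) f
      = sw (dL q) (\<lambda>w z. sw (dL z) (\<lambda>v y. sw (dR (y ** a)) (?G w v)))" for a q
  proof -
    have bal: "balLR (\<lambda>v y1 y2. sw (dR a) (\<lambda>a1 a2. f (S v ** (y1 ** a1)) (S w ** (y2 ** a2))))" for w
    proof (rule balanced3I)
      fix v y1 y2 r
      have "balR (\<lambda>a1 a2. f (S v ** (y1 ** a1)) (S w ** (y2 ** a2)))"
        by (simp add: balanced_def distribs f_add f_swap flip: mul_assoc)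
      from R_takeuchi[OF this, of a r]
      show "sw (dR a) (\<lambda>a1 a2. f (S v ** (y1 ** sR r ** a1)) (S w ** (y2 ** a2)))
          = sw (dR a) (\<lambda>a1 a2. f (S v ** (y1 ** a1)) (S w ** (y2 ** tR r ** a2)))"
        by (simp add: mul_assoc)
    qed (simp_all add: G_add S_simps)
    have "sw (dL q) (\<lambda>w z. sw (dL z) (\<lambda>v y. sw (dR (y ** a)) (?G w v)))
        = sw (dL q) (\<lambda>w z. sw (dL z) (\<lambda>v y. sw (dR y) (\<lambda>y1 y2.
            sw (dR a) (\<lambda>a1 a2. f (S v ** (y1 ** a1)) (S w ** (y2 ** a2))))))"
      by (simp add: R_mult[OF balG] mul_assoc)
    also have "\<dots> = sw (dL q) (\<lambda>w z. sw (dR z) (\<lambda>x y2. sw (dL x) (\<lambda>v y1.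
            sw (dR a) (\<lambda>a1 a2. f (S v ** (y1 ** a1)) (S w ** (y2 ** a2))))))"
      by (simp add: coassoc_LR[OF bal])
    also have "\<dots> = sw (dL q) (\<lambda>w z. sw (dR z) (\<lambda>x y2.
            sw (dR a) (\<lambda>a1 a2. f (sR (piR x) ** a1) (S w ** (y2 ** a2)))))"
      by (subst sw_swap[of "dL _" "dR a"])
        (simp add: sw_hom[OF balanced_additive_left[OF f]] S_left_mul)
    also have "\<dots> = sw (dL q) (\<lambda>w z. sw (dR z) (\<lambda>x y2.
            sw (dR a) (\<lambda>a1 a2. f a1 (S w ** (y2 ** tR (piR x) ** a2)))))"
    proof -
      have "balR (\<lambda>a1 a2. f a1 (S w ** (y2 ** a2)))" for y2 w
        by (simp add: balanced_def distribs f_add f_swap flip: mul_assoc)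
      from R_takeuchi[OF this] show ?thesis by (simp add: mul_assoc)
    qed
    also have "\<dots> = sw (dL q) (\<lambda>w z. sw (dR a) (\<lambda>a1 a2. f a1 (S w ** (z ** a2))))"
      by (subst sw_swap[of "dR _" "dR a"])
        (simp add: sw_hom[OF balanced_additive_right[OF f]] R_counit_left flip: mul_sw sw_mul)
    also have "\<dots> = sw (dR a) (\<lambda>a1 a2. f a1 (sR (piR q) ** a2))"
      by (subst sw_swap[of "dL _" "dR a"])
        (simp add: sw_hom[OF balanced_additive_right[OF f]] S_left_mul)
    also have "\<dots> = sw (dR (sR (piR q) ** a)) f"
      by (rule R_s_mul[OF f, symmetric])
    finally show ?thesis ..
  qed
  have G_sL: "sw (dR (sL l ** a)) (?G w v) = sw (dR a) (?G w (tL l ** v))" for a l v w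
    by (simp add: R_sL[OF balG] S_simps mul_assoc)
  have bal2: "balLR (\<lambda>v y p. sw (dR (y ** S p)) (?G w v))" for w
    by (rule balanced3I) (simp_all add: R_plus[OF balG] G_add S_simps G_sL)
  have balL: "balL (\<lambda>v y. sw (dR (y ** S p)) (?G w v))" for p w
    by (rule balancedI) (simp_all add: R_plus[OF balG] G_add G_sL)
  have bal1: "balLR (\<lambda>w z p. sw (dL z) (\<lambda>v y. sw (dR (y ** S p)) (?G w v)))"
  proof (rule balanced3I)
    fix w z p l
    have "sw (dL (sL l ** z)) (\<lambda>v y. sw (dR (y ** S p)) (?G w v))
        = sw (dL z) (\<lambda>v y. sw (dR (y ** S p)) (\<lambda>c d. f (S v ** (S (sL l) ** c)) (S w ** d)))"
      by (simp add: L_s[OF balL] S_mult mul_assoc)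
    also have "\<dots> = sw (dL z) (\<lambda>v y. sw (dR (y ** S p)) (?G (tL l ** w) v))"
    proof -
      have "sw (dR a) (\<lambda>c d. f (S v ** (S (sL l) ** c)) (S w ** d)) = sw (dR a) (?G (tL l ** w) v)" for a v
        using R_takeuchi[OF balG[of v w], of a "piR (sL l)"]
        by (simp add: S_simps mul_assoc tR_sL S_sL)
      then show ?thesis by simp
    qed
    finally show "sw (dL z) (\<lambda>v y. sw (dR (y ** S p)) (?G (tL l ** w) v))
        = sw (dL (sL l ** z)) (\<lambda>v y. sw (dR (y ** S p)) (?G w v))" ..
  next
    fix w z p r
    show "sw (dL (z ** sR r)) (\<lambda>v y. sw (dR (y ** S p)) (?G w v))
        = sw (dL z) (\<lambda>v y. sw (dR (y ** S (p ** tR r))) (?G w v))"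
      by (simp add: L_mul_sR[OF balL] S_simps mul_assoc)
  next
    fix w z p p'
    show "sw (dL z) (\<lambda>v y. sw (dR (y ** S (p + p'))) (?G w v))
      = sw (dL z) (\<lambda>v y. sw (dR (y ** S p)) (?G w v)) + sw (dL z) (\<lambda>v y. sw (dR (y ** S p')) (?G w v))"
      by (simp add: S_add mul_add_right R_plus[OF balG] sw_add)
  next
    fix w z z' p
    show "sw (dL (z + z')) (\<lambda>v y. sw (dR (y ** S p)) (?G w v))
      = sw (dL z) (\<lambda>v y. sw (dR (y ** S p)) (?G w v)) + sw (dL z') (\<lambda>v y. sw (dR (y ** S p)) (?G w v))"
      by (rule L_plus[OF balL])
  qed (simp add: G_add)
  have "sw (dR (S h)) f = sw (dR (sw (dR h) (\<lambda>q p. sR (piR q) ** S p))) f"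
    using arg_cong[OF R_counit_left[of h], of S] by (simp add: S_sw S_simps)
  also have "\<dots> = sw (dR h) (\<lambda>q p. sw (dR (sR (piR q) ** S p)) f)"
    by (rule sw_hom[OF additive_R[OF f], symmetric])
  also have "\<dots> = sw (dR h) (\<lambda>q p. sw (dL q) (\<lambda>w z. sw (dL z) (\<lambda>v y. sw (dR (y ** S p)) (?G w v))))"
    by (simp add: step)
  also have "\<dots> = sw (dL h) (\<lambda>w u. sw (dR u) (\<lambda>z p. sw (dL z) (\<lambda>v y. sw (dR (y ** S p)) (?G w v))))"
    by (rule coassoc_LR[OF bal1])
  also have "\<dots> = sw (dL h) (\<lambda>w u. sw (dL u) (\<lambda>v e. sw (dR e) (\<lambda>y p. sw (dR (y ** S p)) (?G w v))))"
    by (simp add: coassoc_LR[OF bal2])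
  also have "\<dots> = sw (dL h) (\<lambda>w u. sw (dL u) (\<lambda>v e. sw (dR (sL (piL e))) (?G w v)))"
    by (simp add: sw_hom[OF additive_R[OF balG]] S_right)
  also have "\<dots> = sw (dL h) (\<lambda>w u. sw (dL u) (\<lambda>v e. f (S (tL (piL e) ** v)) (S w)))"
  proof -
    have "sw (dR (sL l)) (?G w v) = f (S (tL l ** v)) (S w)" for l v w
      using bialgebroid_pair.L_sL[OF op balG[of v w], of "piR (sL l)"]
      by (simp add: tR_sL S_simps mul_one)
    then show ?thesis by simp
  qed
  also have "\<dots> = sw (dL h) (\<lambda>w u. f (S u) (S w))"
    by (simp add: sw_hom[OF balanced_additive_left[OF f]] L_counit_right flip: S_sw)
  finally show ?thesis .
qed

lemma balL_S:
  assumes "balL f" shows "balR (\<lambda>a b. f (S b) (S a))"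
proof (rule balancedI)
  fix a b r
  show "f (S b) (S (a ** sR r)) = f (S (b ** tR r)) (S a)"
    using balanced_swap[OF assms, of "piL (sR r)" "S b" "S a"] by (simp add: S_mult S_sR tL_sR S_tR)
qed (simp_all add: S_add balanced_add_left[OF assms] balanced_add_right[OF assms])

lemma L_SS: "balL f \<Longrightarrow> sw (dL (S (S h))) f = sw (dL h) (\<lambda>a b. f (S (S a)) (S (S b)))"
  by (simp add: L_S R_S[OF balL_S])

text \<open>\<open>T \<circ> T\<close> acts on scalars from \<open>L\<close> by \<open>l \<mapsto>
  \<pi>\<^sub>L(t\<^sub>R(\<pi>\<^sub>R(t\<^sub>L(l))))\<close>, through \<open>s\<^sub>L\<close>
  and \<open>t\<^sub>L\<close> alike, so the test map stays balanced and \<open>L_SS\<close> applies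
  at \<open>T (T h)\<close>.\<close>

lemma L_TT:
  assumes "balL f" shows "sw (dL (T (T h))) f = sw (dL h) (\<lambda>a b. f (T (T a)) (T (T b)))"
proof -
  let ?g = "\<lambda>a b. f (T (T a)) (T (T b))"
  have bal: "balL ?g"
  proof (rule balancedI)
    fix a b l
    show "f (T (T (tL l ** a))) (T (T b)) = f (T (T a)) (T (T (sL l ** b)))"
      using balanced_swap[OF assms, of "piL (tR (piR (tL l)))" "T (T a)" "T (T b)"]
      by (simp add: T_mult T_tL T_sL T_tR sL_tR)
  qed (simp_all add: T_add balanced_add_left[OF assms] balanced_add_right[OF assms])
  show ?thesis using L_SS[OF bal, of "T (T h)"] by (simp add: S_T T_S)
qed

end

section \<open>Integrals on finitely generated projective Hopf algebroids\<close>

text \<open>The dual bases are those of \<open>H\<close> as right-hand factor of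
  \<open>\<otimes>\<^sub>L\<close> and of \<open>\<otimes>\<^sub>R\<close>, so that they expand the
  last leg of a coproduct or coaction into a finite sum.\<close>

locale fgp_hopf = hopf mul one sL tL piL dL sR tR piR dR S T
  for mul :: "'h::ab_group_add \<Rightarrow> 'h \<Rightarrow> 'h" (infixl "**" 70)
    and one :: 'h
    and sL tL :: "'l::{ring,monoid_mult} \<Rightarrow> 'h" and piL :: "'h \<Rightarrow> 'l"
    and dL :: "'h \<Rightarrow> ('h \<times> 'h) frag"
    and sR tR :: "'r::{ring,monoid_mult} \<Rightarrow> 'h" and piR :: "'h \<Rightarrow> 'r"
    and dR :: "'h \<Rightarrow> ('h \<times> 'h) frag"
    and S T :: "'h \<Rightarrow> 'h" +
  fixes IL IR :: "'h set" and bL bR :: "'h \<Rightarrow> 'h" and \<beta>L :: "'h \<Rightarrow> 'h \<Rightarrow> 'l" and \<beta>R :: "'h \<Rightarrow> 'h \<Rightarrow> 'r"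
  assumes \<beta>L_add: "\<beta>L i (a + b) = \<beta>L i a + \<beta>L i b" and \<beta>R_add: "\<beta>R i (a + b) = \<beta>R i a + \<beta>R i b"
    and \<beta>L_s: "\<beta>L i (sL l ** a) = l * \<beta>L i a" and \<beta>R_t: "\<beta>R i (a ** tR r) = r * \<beta>R i a"
    and dual_basis_L: "(\<Sum>i\<in>IL. sL (\<beta>L i a) ** bL i) = a"
    and dual_basis_R: "(\<Sum>i\<in>IR. bR i ** tR (\<beta>R i a)) = a"
begin

lemma fgp_hopf_op: "fgp_hopf (\<lambda>a b. b ** a) one tR sR piR dR tL sL piL dL T S IR IL bR bL \<beta>R \<beta>L"
proof -
  interpret o: hopf "\<lambda>a b. b ** a" one tR sR piR dR tL sL piL dL T S
    by (rule hopf_op)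
  show ?thesis
    by unfold_locales (fact \<beta>L_add \<beta>R_add \<beta>L_s \<beta>R_t dual_basis_L dual_basis_R)+
qed

text \<open>The regular action
  \<open>y \<mapsto> y\<^sub>1 \<cdot> \<beta>\<^sub>i(y\<^sub>2)\<close> of a functional on
  \<open>H\<close>; composition of such operators corresponds to the convolution product.\<close>

definition \<chi>L :: "'h \<Rightarrow> 'h \<Rightarrow> 'h" where
  "\<chi>L i y = sw (dL y) (\<lambda>a b. tL (\<beta>L i b) ** a)"

definition \<chi>R :: "'h \<Rightarrow> 'h \<Rightarrow> 'h" where
  "\<chi>R i y = sw (dR y) (\<lambda>a b. a ** sR (\<beta>R i b))"

lemma balL_\<chi>: "balL (\<lambda>a b. tL (\<beta>L i b) ** a)"
  by (simp add: balanced_def distribs \<beta>L_add \<beta>L_s tL_mult mul_assoc)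

lemma \<chi>L_add: "\<chi>L i (a + b) = \<chi>L i a + \<chi>L i b"
  by (simp add: \<chi>L_def L_plus[OF balL_\<chi>])

lemma additive_\<chi>L: "additive_map (\<chi>L i)"
  by (simp add: additive_map_def \<chi>L_add)

lemma \<chi>L_sL: "\<chi>L i (sL l ** y) = sL l ** \<chi>L i y"
  by (simp add: \<chi>L_def L_s[OF balL_\<chi>] mul_sw sL_tL')

lemma \<chi>L_tR: "\<chi>L i (y ** tR r) = \<chi>L i y ** tR r"
  by (simp add: \<chi>L_def L_mul_tR[OF balL_\<chi>] sw_mul mul_assoc)

text \<open>By coassociativity, contracting the last leg commutes with comultiplying;
  \<open>R_\<chi>L\<close> is the same with mixed coassociativity.\<close>

lemma L_\<chi>L:
  assumes "balL f" shows "sw (dL (\<chi>L i z)) f = sw (dL z) (\<lambda>a b. f a (\<chi>L i b))"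
proof -
  have bal: "balLL (\<lambda>a1 a2 b. f a1 (tL (\<beta>L i b) ** a2))"
    using assms
    by (simp add: balanced3_def balanced_def distribs \<beta>L_add \<beta>L_s tL_mult mul_assoc flip: sL_tL')
  have "sw (dL (\<chi>L i z)) f = sw (dL z) (\<lambda>a b. sw (dL (tL (\<beta>L i b) ** a)) f)"
    unfolding \<chi>L_def by (rule sw_hom[OF additive_L[OF assms], symmetric])
  also have "\<dots> = sw (dL z) (\<lambda>a b. sw (dL b) (\<lambda>b1 b2. f a (tL (\<beta>L i b2) ** b1)))"
    by (simp add: L_t[OF assms] coassoc_LL[OF bal])
  finally show ?thesis
    by (simp add: \<chi>L_def sw_hom[OF balanced_additive_right[OF assms]])
qed

lemma R_\<chi>L:
  assumes "balR f" shows "sw (dR (\<chi>L i z)) f = sw (dR z) (\<lambda>a b. f a (\<chi>L i b))"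
proof -
  have bal: "balRL (\<lambda>a1 a2 b. f a1 (tL (\<beta>L i b) ** a2))"
    using assms
    by (simp add: balanced3_def balanced_def distribs \<beta>L_add \<beta>L_s tL_mult mul_assoc)
  have "sw (dR (\<chi>L i z)) f = sw (dL z) (\<lambda>a b. sw (dR (tL (\<beta>L i b) ** a)) f)"
    unfolding \<chi>L_def by (rule sw_hom[OF additive_R[OF assms], symmetric])
  also have "\<dots> = sw (dR z) (\<lambda>a b. sw (dL b) (\<lambda>b1 b2. f a (tL (\<beta>L i b2) ** b1)))"
    by (simp add: R_tL[OF assms] coassoc_RL[OF bal])
  finally show ?thesis
    by (simp add: \<chi>L_def sw_hom[OF balanced_additive_right[OF assms]])
qed

lemma \<chi>R_eq: "\<chi>R i y = fgp_hopf.\<chi>L (\<lambda>a b. b ** a) sR dR \<beta>R i y"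
  by (simp add: \<chi>R_def fgp_hopf.\<chi>L_def[OF fgp_hopf_op])

lemmas \<chi>R_add = fgp_hopf.\<chi>L_add[OF fgp_hopf_op, folded \<chi>R_eq]
  and \<chi>R_tR = fgp_hopf.\<chi>L_sL[OF fgp_hopf_op, folded \<chi>R_eq]
  and \<chi>R_sL = fgp_hopf.\<chi>L_tR[OF fgp_hopf_op, folded \<chi>R_eq]
  and R_\<chi>R = fgp_hopf.L_\<chi>L[OF fgp_hopf_op, folded \<chi>R_eq]
  and L_\<chi>R = fgp_hopf.R_\<chi>L[OF fgp_hopf_op, folded \<chi>R_eq]

text \<open>The second leg is written in the dual basis, which amounts to \<open>\<gamma>\<^sub>L(z)
  = \<Sum>\<^sub>i \<chi>\<^sub>i(z) \<otimes> b\<^sub>i\<close>.\<close>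

lemma L_expand:
  assumes "balL f" shows "sw (dL z) f = (\<Sum>i\<in>IL. f (\<chi>L i z) (bL i))"
proof -
  have "sw (dL z) f = sw (dL z) (\<lambda>a b. f a (\<Sum>i\<in>IL. sL (\<beta>L i b) ** bL i))"
    by (simp add: dual_basis_L)
  also have "\<dots> = (\<Sum>i\<in>IL. sw (dL z) (\<lambda>a b. f (tL (\<beta>L i b) ** a) (bL i)))"
    by (simp add: additive_map_sum[OF balanced_additive_right[OF assms]] balanced_swap[OF assms] sw_sum)
  finally show ?thesis
    by (simp add: \<chi>L_def sw_hom[OF balanced_additive_left[OF assms]])
qed

text \<open>Inserting \<open>S(g\<^sub>1) g\<^sub>2\<close> moves \<open>g\<close> out of an operator \<open>Q\<close> that commutes with the coaction.\<close>

lemma comult_shift: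
  assumes Q_add: "\<And>a b. Q (a + b) = Q a + Q b" and Q_tR: "\<And>a r. Q (a ** tR r) = Q a ** tR r"
    and Q_colinear: "\<And>z. sw (dR z) (\<lambda>a b. a ** sR (piR (Q b))) = Q z"
  shows "sw (dR x) (\<lambda>a b. a ** sR (piR (Q (g ** b)))) = sw (dL g) (\<lambda>p q. S p ** Q (q ** x))"
proof -
  note adds = distribs Q_add S_add
  have balQ: "balR (\<lambda>a b. a ** sR (piR (Q b)))"
    by (simp add: balanced_def adds Q_tR piR_t sR_mult mul_assoc)
  have balQd: "balR (\<lambda>a b. c ** (a ** sR (piR (Q (d ** b)))))" for c d
    using Q_tR[of "d ** _"] by (simp add: balanced_def adds piR_t sR_mult mul_assoc)
  have bal: "balLR (\<lambda>p c d. sw (dR x) (\<lambda>a b. S p ** (c ** (a ** sR (piR (Q (d ** b)))))))"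
  proof (rule balanced3I)
    fix p c d r
    show "sw (dR x) (\<lambda>a b. S p ** (c ** sR r ** (a ** sR (piR (Q (d ** b))))))
        = sw (dR x) (\<lambda>a b. S p ** (c ** (a ** sR (piR (Q (d ** tR r ** b))))))"
      using R_takeuchi[OF balQd[of "S p ** c" d], of x r] by (simp add: mul_assoc)
  qed (simp_all add: adds S_simps mul_assoc)
  have "sw (dL g) (\<lambda>p q. S p ** Q (q ** x))
      = sw (dL g) (\<lambda>p q. S p ** sw (dR (q ** x)) (\<lambda>a b. a ** sR (piR (Q b))))"
    by (simp add: Q_colinear)
  also have "\<dots> = sw (dL g) (\<lambda>p q. sw (dR q) (\<lambda>c d. sw (dR x) (\<lambda>a b. S p ** (c ** (a ** sR (piR (Q (d ** b))))))))"
    by (simp add: R_mult[OF balQ] mul_sw mul_assoc)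
  also have "\<dots> = sw (dR g) (\<lambda>y d. sw (dL y) (\<lambda>p c. sw (dR x) (\<lambda>a b. S p ** (c ** (a ** sR (piR (Q (d ** b))))))))"
    by (rule coassoc_LR[OF bal, symmetric])
  also have "\<dots> = sw (dR g) (\<lambda>y d. sw (dR x) (\<lambda>a b. sR (piR y) ** (a ** sR (piR (Q (d ** b))))))"
    by (subst sw_swap[of "dL _" "dR x"]) (simp add: S_left_mul)
  \<comment> \<open>The Takeuchi condition carries \<open>s\<^sub>R(\<pi>\<^sub>R(y))\<close> to the
    other leg as \<open>t\<^sub>R(\<pi>\<^sub>R(y))\<close>, where the counit law reassembles
    \<open>g\<close>.\<close>
  also have "\<dots> = sw (dR g) (\<lambda>y d. sw (dR x) (\<lambda>a b. a ** sR (piR (Q (d ** tR (piR y) ** b)))))"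
  proof -
    have "balR (\<lambda>a b. a ** sR (piR (Q (d ** b))))" for d
      using balQd[of one d] by (simp add: one_mul)
    from R_takeuchi[OF this] show ?thesis by (simp add: mul_assoc)
  qed
  also have "\<dots> = sw (dR x) (\<lambda>a b. sw (dR g) (\<lambda>y d. a ** sR (piR (Q (d ** tR (piR y) ** b)))))"
    by (rule sw_swap)
  also have "\<dots> = sw (dR x) (\<lambda>a b. a ** sR (piR (Q (g ** b))))"
  proof -
    have "additive_map (\<lambda>X. a ** sR (piR (Q (X ** b))))" for a b
      by (simp add: additive_map_def adds)
    from sw_hom[OF this, where d = "dR g" and f = "\<lambda>y d. d ** tR (piR y)"]
    show ?thesis by (simp add: R_counit_left)
  qed
  finally show ?thesis ..
qed

text \<open>The dual basis turns the sum over \<open>i\<close> into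
  \<open>T(\<chi>\<^sub>m(y\<^sub>2)) y\<^sub>1\<close>; as \<open>\<chi>\<^sub>m\<close> is
  colinear, this is \<open>T(z\<^sub>2) z\<^sub>1\<close> for
  \<open>z = \<chi>\<^sub>m(y)\<close>.\<close>

lemma sum_T_\<chi>L: "(\<Sum>i\<in>IL. T (\<chi>L m (bL i)) ** \<chi>L i y) = tR (piR (\<chi>L m y))"
proof -
  have balT: "balL (\<lambda>a b. T b ** a)"
    by (simp add: balanced_def distribs T_add T_mult T_sL mul_assoc)
  have "(\<Sum>i\<in>IL. T (\<chi>L m (bL i)) ** \<chi>L i y)
      = (\<Sum>i\<in>IL. sw (dL y) (\<lambda>a b. T (\<chi>L m (sL (\<beta>L i b) ** bL i)) ** a))"
    by (simp add: \<chi>L_def[of _ y] mul_sw \<chi>L_sL T_mult T_sL mul_assoc)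
  also have "\<dots> = sw (dL y) (\<lambda>a b. T (\<chi>L m (\<Sum>i\<in>IL. sL (\<beta>L i b) ** bL i)) ** a)"
    by (simp add: additive_map_sum[OF additive_\<chi>L] additive_map_sum[OF additive_T]
        additive_map_sum[OF additive_mul_left] sw_sum)
  also have "\<dots> = sw (dL (\<chi>L m y)) (\<lambda>a b. T b ** a)"
    by (simp add: dual_basis_L L_\<chi>L[OF balT])
  finally show ?thesis by (simp add: T_right)
qed

text \<open>The trace formula for integrals: over a field, and with \<open>(b\<^sub>i, \<beta>\<^sub>i)\<close> a pair of dual bases, it
  reads \<open>x \<mapsto> \<Sum>\<^sub>i (\<beta>\<^sub>i \<beta>\<^sub>j)(S\<^sup>-\<^sup>2(b\<^sub>i) x)\<close> with the convolution product \<open>\<beta>\<^sub>i \<beta>\<^sub>j\<close>.\<close>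

definition integral :: "'h \<Rightarrow> 'h \<Rightarrow> 'r" where
  "integral j x = (\<Sum>i\<in>IL. piR (\<chi>L i (\<chi>R j (T (T (bL i)) ** x))))"

lemma integral_add: "integral j (x + y) = integral j x + integral j y"
  by (simp add: integral_def distribs \<chi>L_add \<chi>R_add sum.distrib)

lemma integral_tR: "integral j (x ** tR r) = r * integral j x"
  by (simp add: integral_def \<chi>L_tR \<chi>R_tR piR_t sum_distrib_left flip: mul_assoc)

text \<open>\<open>comult_shift\<close> at \<open>g = S\<^sup>-\<^sup>2(b\<^sub>i)\<close> produces
  \<open>S(g\<^sub>1)\<close>, which is \<open>T\<close> of a leg of \<open>b\<^sub>i\<close> by
  \<open>L_TT\<close>. Expanding \<open>\<gamma>\<^sub>L(b\<^sub>i)\<close> in the dual basis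
  introduces a second index \<open>m\<close>; the sum over \<open>i\<close> is then
  \<open>sum_T_\<chi>L\<close>, and the remaining sum over \<open>m\<close> is again the trace
  formula.\<close>

lemma integral_invariant: "sw (dR x) (\<lambda>a b. a ** sR (integral j b)) = tR (integral j x)"
proof -
  let ?Q = "\<lambda>i z. \<chi>L i (\<chi>R j z)"
  have Q_sL: "?Q i (sL l ** a) = sL l ** ?Q i a" for i l a
    by (simp add: \<chi>L_sL \<chi>R_sL)
  have shift: "sw (dR x) (\<lambda>a b. a ** sR (piR (?Q i (g ** b)))) = sw (dL g) (\<lambda>p q. S p ** ?Q i (q ** x))" for i g
  proof (rule comult_shift)
    fix z
    have bal: "balR (\<lambda>a b. a ** sR (piR b))"
      by (simp add: balanced_def distribs piR_t sR_mult mul_assoc)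
    have bal': "balR (\<lambda>a b. a ** sR (piR (\<chi>L i b)))"
      by (simp add: balanced_def distribs \<chi>L_add \<chi>L_tR piR_t sR_mult mul_assoc)
    show "sw (dR z) (\<lambda>a b. a ** sR (piR (?Q i b))) = ?Q i z"
      using R_counit_right[of "?Q i z"] by (simp add: R_\<chi>L[OF bal] R_\<chi>R[OF bal'])
  qed (simp_all add: \<chi>L_add \<chi>R_add \<chi>L_tR \<chi>R_tR)
  let ?W = "\<lambda>i p q. T p ** ?Q i (T (T q) ** x)"
  have balW: "balL (?W i)" for i
  proof (rule balancedI)
    fix p q l
    show "?W i (tL l ** p) q = ?W i p (sL l ** q)"
      using Q_sL[of i "piL (tR (piR (tL l)))"]
      by (simp add: T_mult T_sL T_tL sL_tR mul_assoc)
  qed (simp_all add: T_add \<chi>L_add \<chi>R_add distribs)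
  have balS: "balL (\<lambda>p q. S p ** ?Q i (q ** x))" for i
    by (simp add: balanced_def distribs S_simps \<chi>L_add \<chi>R_add Q_sL mul_assoc)
  have "sw (dR x) (\<lambda>a b. a ** sR (integral j b))
      = (\<Sum>i\<in>IL. sw (dR x) (\<lambda>a b. a ** sR (piR (?Q i (T (T (bL i)) ** b)))))"
    by (simp add: integral_def additive_map_sum[OF additive_sR] additive_map_sum[OF additive_mul_right] sw_sum)
  also have "\<dots> = (\<Sum>i\<in>IL. sw (dL (bL i)) (?W i))"
    by (simp add: shift L_TT[OF balS] S_T)
  also have "\<dots> = (\<Sum>i\<in>IL. \<Sum>m\<in>IL. T (\<chi>L m (bL i)) ** \<chi>L i (\<chi>R j (T (T (bL m)) ** x)))"
    by (simp add: L_expand[OF balW])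
  also have "\<dots> = (\<Sum>m\<in>IL. tR (piR (\<chi>L m (\<chi>R j (T (T (bL m)) ** x)))))"
    by (subst sum.swap) (simp add: sum_T_\<chi>L)
  finally show ?thesis
    by (simp add: integral_def additive_map_sum[OF additive_tR])
qed

text \<open>\<open>t\<^sub>L(l)\<close> is a value of \<open>s\<^sub>R\<close>, and under
  \<open>\<pi>\<^sub>R\<close> the counit axioms allow \<open>s\<^sub>R\<close> on the left to be
  replaced by \<open>t\<^sub>R\<close>. The replacement is \<open>T(t\<^sub>L(l))\<close>, a value
  of \<open>s\<^sub>L\<close>, with which \<open>\<chi>L\<close> commutes.\<close>

lemma piR_tL_mul: "piR (tL l ** \<chi>L i z) = piR (\<chi>L i (T (tL l) ** z))"
  using piR_mul_s[of "tL l" "\<chi>L i z"] piR_mul_t[of "tL l" "\<chi>L i z"]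
    \<chi>L_sL[of i "piL (tR (piR (tL l)))" z]
  by (simp add: sR_tL T_tL sL_tR)

text \<open>Rewriting \<open>\<chi>L k \<circ> \<chi>R j\<close> through the operators
  \<open>\<chi>L i\<close> frees the sums over \<open>k\<close> and \<open>j\<close>: the first
  rebuilds \<open>\<chi>R j (bL i)\<close>, the second collapses by \<open>T_left\<close>, and
  \<open>\<Sum>\<^sub>i t\<^sub>L(\<pi>\<^sub>L(b\<^sub>i)) \<chi>\<^sub>i(x) = x\<close>
  remains.\<close>

lemma integral_dual_basis: "(\<Sum>j\<in>IR. integral j (T (bR j) ** x)) = piR x"
proof -
  \<comment> \<open>The matrix over \<open>L\<close> of \<open>\<chi>R j\<close> in the dual basis
    of \<open>H\<close>; it makes sense because \<open>\<chi>R j\<close> commutes with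
    multiplication by \<open>s\<^sub>L\<close>.\<close>
  define B where "B j k i = \<beta>L k (\<chi>R j (bL i))" for j k i
  have \<beta>L_\<chi>R: "\<beta>L k (\<chi>R j b) = (\<Sum>i\<in>IL. \<beta>L i b * B j k i)" for j k b
  proof -
    have "\<beta>L k (\<chi>R j b) = \<beta>L k (\<chi>R j (\<Sum>i\<in>IL. sL (\<beta>L i b) ** bL i))"
      by (simp add: dual_basis_L)
    also have "\<dots> = (\<Sum>i\<in>IL. \<beta>L k (\<chi>R j (sL (\<beta>L i b) ** bL i)))"
      by (rule additive_map_sum) (simp add: additive_map_def \<beta>L_add \<chi>R_add)
    finally show ?thesis by (simp add: B_def \<chi>R_sL \<beta>L_s)
  qed
  have \<chi>L_\<chi>R: "\<chi>L k (\<chi>R j z) = (\<Sum>i\<in>IL. tL (B j k i) ** \<chi>L i z)" for j k z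
  proof -
    have "\<chi>L k (\<chi>R j z) = sw (dL z) (\<lambda>a b. tL (\<beta>L k (\<chi>R j b)) ** a)"
      unfolding \<chi>L_def by (rule L_\<chi>R[OF balL_\<chi>])
    also have "\<dots> = sw (dL z) (\<lambda>a b. \<Sum>i\<in>IL. tL (B j k i) ** (tL (\<beta>L i b) ** a))"
      by (simp add: \<beta>L_\<chi>R additive_map_sum[OF additive_tL] additive_map_sum[OF additive_mul_left]
          tL_mult mul_assoc)
    finally show ?thesis by (simp add: sw_sum \<chi>L_def mul_sw)
  qed
  have T_sum: "(\<Sum>j\<in>IR. bR j ** T (\<chi>R j b)) = tL (piL b)" for b
  proof -
    have "(\<Sum>j\<in>IR. bR j ** T (\<chi>R j b)) = sw (dR b) (\<lambda>a c. \<Sum>j\<in>IR. bR j ** tR (\<beta>R j c) ** T a)"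
      by (simp add: \<chi>R_def T_sw mul_sw sw_sum T_mult T_sR mul_assoc)
    also have "\<dots> = sw (dR b) (\<lambda>a c. c ** T a)"
      by (simp add: dual_basis_R flip: additive_map_sum[OF additive_mul_left])
    finally show ?thesis by (simp add: T_left)
  qed
  have "(\<Sum>j\<in>IR. integral j (T (bR j) ** x))
      = (\<Sum>j\<in>IR. \<Sum>k\<in>IL. \<Sum>i\<in>IL. piR (tL (B j k i) ** \<chi>L i (T (bR j ** T (bL k)) ** x)))"
    by (simp add: integral_def \<chi>L_\<chi>R additive_map_sum[OF additive_piR] T_mult mul_assoc)
  \<comment> \<open>The matrix entry is moved inside until it stands next to \<open>bL k\<close>,
    where the sum over \<open>k\<close> is an expansion in the dual basis.\<close>
  also have "\<dots> = (\<Sum>j\<in>IR. \<Sum>k\<in>IL. \<Sum>i\<in>IL. piR (\<chi>L i (T (bR j ** T (sL (B j k i) ** bL k)) ** x)))"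
    by (simp add: piR_tL_mul T_mult T_sL mul_assoc)
  also have "\<dots> = (\<Sum>i\<in>IL. \<Sum>j\<in>IR. \<Sum>k\<in>IL. piR (\<chi>L i (T (bR j ** T (sL (B j k i) ** bL k)) ** x)))"
    by (subst (2) sum.swap, subst sum.swap) simp
  also have "\<dots> = (\<Sum>i\<in>IL. piR (\<chi>L i (T (tL (piL (bL i))) ** x)))"
  proof (rule sum.cong[OF refl])
    fix i
    let ?F = "\<lambda>X. piR (\<chi>L i (T X ** x))"
    have add: "additive_map ?F" "additive_map (\<lambda>X. ?F (c ** T X))" for c
      by (simp_all add: additive_map_def distribs \<chi>L_add T_add)
    have "(\<Sum>j\<in>IR. \<Sum>k\<in>IL. ?F (bR j ** T (sL (B j k i) ** bL k)))
        = (\<Sum>j\<in>IR. ?F (bR j ** T (\<chi>R j (bL i))))"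
      by (simp add: B_def dual_basis_L flip: additive_map_sum[OF add(2)])
    also have "\<dots> = ?F (tL (piL (bL i)))"
      by (simp add: T_sum flip: additive_map_sum[OF add(1)])
    finally show "(\<Sum>j\<in>IR. \<Sum>k\<in>IL. ?F (bR j ** T (sL (B j k i) ** bL k))) = ?F (tL (piL (bL i)))" .
  qed
  also have "\<dots> = piR (\<Sum>i\<in>IL. tL (piL (bL i)) ** \<chi>L i x)"
    by (simp add: piR_tL_mul additive_map_sum[OF additive_piR])
  also have "(\<Sum>i\<in>IL. tL (piL (bL i)) ** \<chi>L i x) = sw (dL x) (\<lambda>a b. tL (piL b) ** a)"
  proof -
    have "balL (\<lambda>a b. tL (piL b) ** a)"
      by (simp add: balanced_def distribs piL_s tL_mult mul_assoc)
    from L_expand[OF this] show ?thesis by simp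
  qed
  finally show ?thesis by (simp add: L_counit_right)
qed

end

section \<open>Comodule algebras\<close>

text \<open>The actions of \<open>L\<close> and \<open>R\<close> on a comodule algebra are multiplications by \<open>eL l = 1 \<cdot> l\<close> and
  \<open>eR r = 1 \<cdot> r\<close>: \<open>a \<cdot> l = eL l a\<close>, \<open>l \<cdot> a = a eL l\<close>, \<open>a \<cdot> r = a eR r\<close>, \<open>r \<cdot> a = eR r a\<close>.\<close>

locale comod_alg = fgp_hopf mul one sL tL piL dL sR tR piR dR S T IL IR bL bR \<beta>L \<beta>R
  for mul :: "'h::ab_group_add \<Rightarrow> 'h \<Rightarrow> 'h" (infixl "**" 70)
    and one :: 'h
    and sL tL :: "'l::{ring,monoid_mult} \<Rightarrow> 'h" and piL :: "'h \<Rightarrow> 'l"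
    and dL :: "'h \<Rightarrow> ('h \<times> 'h) frag"
    and sR tR :: "'r::{ring,monoid_mult} \<Rightarrow> 'h" and piR :: "'h \<Rightarrow> 'r"
    and dR :: "'h \<Rightarrow> ('h \<times> 'h) frag"
    and S T :: "'h \<Rightarrow> 'h"
    and IL IR :: "'h set" and bL bR :: "'h \<Rightarrow> 'h" and \<beta>L :: "'h \<Rightarrow> 'h \<Rightarrow> 'l" and \<beta>R :: "'h \<Rightarrow> 'h \<Rightarrow> 'r" +
  fixes mulA :: "'a::ab_group_add \<Rightarrow> 'a \<Rightarrow> 'a" (infixl "\<bullet>" 70)
    and oneA :: 'a
    and eL :: "'l \<Rightarrow> 'a" and eR :: "'r \<Rightarrow> 'a"
    and rL rR :: "'a \<Rightarrow> ('a \<times> 'h) frag"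
  assumes mulA_assoc: "(a \<bullet> b) \<bullet> c = a \<bullet> (b \<bullet> c)"
    and mulA_add_left: "(a + b) \<bullet> c = a \<bullet> c + b \<bullet> c"
    and mulA_add_right: "a \<bullet> (b + c) = a \<bullet> b + a \<bullet> c"
    and oneA_mul: "oneA \<bullet> a = a" and mul_oneA: "a \<bullet> oneA = a"
    and eL_add: "eL (l + l') = eL l + eL l'" and eR_add: "eR (r + r') = eR r + eR r'"
    and eL_mult: "eL (l * l') = eL l' \<bullet> eL l" and eR_mult: "eR (r * r') = eR r \<bullet> eR r'"
    and eL_one: "eL 1 = oneA" and eR_one: "eR 1 = oneA"
    and eL_eq: "eR (piR (tL l)) = eL l" and eR_eq: "eL (piL (sR r)) = eR r"
    and ax_rL_plus: "rL (a + b) - (rL a + rL b) \<in> tensor_ker (\<lambda>a l. eL l \<bullet> a) (\<lambda>l h. sL l ** h)"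
    and ax_rR_plus: "rR (a + b) - (rR a + rR b) \<in> tensor_ker (\<lambda>a r. a \<bullet> eR r) (\<lambda>r h. h ** tR r)"
    and ax_rL_one: "rL oneA - frag_of (oneA, one) \<in> tensor_ker (\<lambda>a l. eL l \<bullet> a) (\<lambda>l h. sL l ** h)"
    and ax_rR_one: "rR oneA - frag_of (oneA, one) \<in> tensor_ker (\<lambda>a r. a \<bullet> eR r) (\<lambda>r h. h ** tR r)"
    and ax_rL_mult: "rL (a \<bullet> b) - sw (rL b) (\<lambda>b0 b1. sw (rL a) (\<lambda>a0 a1. frag_of (a0 \<bullet> b0, a1 ** b1)))
        \<in> tensor_ker (\<lambda>a l. eL l \<bullet> a) (\<lambda>l h. sL l ** h)"
    and ax_rR_mult: "rR (a \<bullet> b) - sw (rR a) (\<lambda>a0 a1. sw (rR b) (\<lambda>b0 b1. frag_of (a0 \<bullet> b0, a1 ** b1)))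
        \<in> tensor_ker (\<lambda>a r. a \<bullet> eR r) (\<lambda>r h. h ** tR r)"
    and ax_rL_e: "rL (eL l \<bullet> a) - sw (rL a) (\<lambda>a0 a1. frag_of (a0, tL l ** a1))
        \<in> tensor_ker (\<lambda>a l. eL l \<bullet> a) (\<lambda>l h. sL l ** h)"
    and ax_rR_e: "rR (a \<bullet> eR r) - sw (rR a) (\<lambda>a0 a1. frag_of (a0, a1 ** sR r))
        \<in> tensor_ker (\<lambda>a r. a \<bullet> eR r) (\<lambda>r h. h ** tR r)"
    and rL_lact: "sw (rL a) (\<lambda>a0 a1. eL (piL (a1 ** tL l)) \<bullet> a0) = a \<bullet> eL l"
    and rR_lact: "sw (rR a) (\<lambda>a0 a1. a0 \<bullet> eR (piR (sR r ** a1))) = eR r \<bullet> a"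
    and rL_counit: "sw (rL a) (\<lambda>a0 a1. eL (piL a1) \<bullet> a0) = a"
    and rR_counit: "sw (rR a) (\<lambda>a0 a1. a0 \<bullet> eR (piR a1)) = a"
    and ax_rLL: "sw (rL a) (\<lambda>b c. sw (rL b) (\<lambda>b0 b1. frag_of (b0, b1, c)))
        - sw (rL a) (\<lambda>b c. sw (dL c) (\<lambda>c1 c2. frag_of (b, c1, c2)))
        \<in> tensor3_ker (\<lambda>a l. eL l \<bullet> a) (\<lambda>l h. sL l ** h) (\<lambda>h l. tL l ** h) (\<lambda>l h. sL l ** h)"
    and ax_rRR: "sw (rR a) (\<lambda>b c. sw (rR b) (\<lambda>b0 b1. frag_of (b0, b1, c)))
        - sw (rR a) (\<lambda>b c. sw (dR c) (\<lambda>c1 c2. frag_of (b, c1, c2)))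
        \<in> tensor3_ker (\<lambda>a r. a \<bullet> eR r) (\<lambda>r h. h ** tR r) (\<lambda>h r. h ** sR r) (\<lambda>r h. h ** tR r)"
    and ax_rLR: "sw (rR a) (\<lambda>b c. sw (rL b) (\<lambda>b0 b1. frag_of (b0, b1, c)))
        - sw (rL a) (\<lambda>b c. sw (dR c) (\<lambda>c1 c2. frag_of (b, c1, c2)))
        \<in> tensor3_ker (\<lambda>a l. eL l \<bullet> a) (\<lambda>l h. sL l ** h) (\<lambda>h r. h ** sR r) (\<lambda>r h. h ** tR r)"
    and ax_rRL: "sw (rL a) (\<lambda>b c. sw (rR b) (\<lambda>b0 b1. frag_of (b0, b1, c)))
        - sw (rR a) (\<lambda>b c. sw (dL c) (\<lambda>c1 c2. frag_of (b, c1, c2)))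
        \<in> tensor3_ker (\<lambda>a r. a \<bullet> eR r) (\<lambda>r h. h ** tR r) (\<lambda>h l. tL l ** h) (\<lambda>l h. sL l ** h)"
begin

lemma comod_alg_op: "comod_alg (\<lambda>a b. b ** a) one tR sR piR dR tL sL piL dL T S IR IL bR bL \<beta>R \<beta>L
    (\<lambda>a b. b \<bullet> a) oneA eR eL rR rL"
proof -
  interpret o: fgp_hopf "\<lambda>a b. b ** a" one tR sR piR dR tL sL piL dL T S IR IL bR bL \<beta>R \<beta>L
    by (rule fgp_hopf_op)
  show ?thesis
    by unfold_locales
      (fact mulA_assoc[symmetric] mulA_add_left mulA_add_right oneA_mul mul_oneA eL_add eR_add
        eL_mult eR_mult eL_one eR_one eL_eq eR_eq ax_rL_plus ax_rR_plus ax_rL_one ax_rR_one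
        ax_rL_mult ax_rR_mult ax_rL_e ax_rR_e rL_lact rR_lact rL_counit rR_counit
        ax_rLL ax_rRR ax_rLR ax_rRL)+
qed

abbreviation kerL :: "('a \<times> 'h) frag set" where
  "kerL \<equiv> tensor_ker (\<lambda>a l. eL l \<bullet> a) (\<lambda>l h. sL l ** h)"

abbreviation kerR :: "('a \<times> 'h) frag set" where
  "kerR \<equiv> tensor_ker (\<lambda>a r. a \<bullet> eR r) (\<lambda>r h. h ** tR r)"

abbreviation balAL :: "('a \<Rightarrow> 'h \<Rightarrow> 'p::ab_group_add) \<Rightarrow> bool" where
  "balAL \<equiv> balanced (\<lambda>a l. eL l \<bullet> a) (\<lambda>l h. sL l ** h)"

abbreviation balAR :: "('a \<Rightarrow> 'h \<Rightarrow> 'p::ab_group_add) \<Rightarrow> bool" where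
  "balAR \<equiv> balanced (\<lambda>a r. a \<bullet> eR r) (\<lambda>r h. h ** tR r)"

abbreviation balALR :: "('a \<Rightarrow> 'h \<Rightarrow> 'h \<Rightarrow> 'p::ab_group_add) \<Rightarrow> bool" where
  "balALR \<equiv> balanced3 (\<lambda>a l. eL l \<bullet> a) (\<lambda>l h. sL l ** h) (\<lambda>h r. h ** sR r) (\<lambda>r h. h ** tR r)"

abbreviation balARR :: "('a \<Rightarrow> 'h \<Rightarrow> 'h \<Rightarrow> 'p::ab_group_add) \<Rightarrow> bool" where
  "balARR \<equiv> balanced3 (\<lambda>a r. a \<bullet> eR r) (\<lambda>r h. h ** tR r) (\<lambda>h r. h ** sR r) (\<lambda>r h. h ** tR r)"

lemma additive_mulA_left: "additive_map (\<lambda>a. a \<bullet> b)"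
  and additive_mulA_right: "additive_map (\<lambda>b. a \<bullet> b)"
  and additive_eR: "additive_map eR"
  by (simp_all add: additive_map_def mulA_add_left mulA_add_right eR_add)

lemmas distribsA = distribs mulA_add_left mulA_add_right eL_add eR_add

lemma mulA_sw: "c \<bullet> sw d f = sw d (\<lambda>a b. c \<bullet> f a b)"
  by (rule sw_hom[OF additive_mulA_right, symmetric])

lemma sw_mulA: "sw d f \<bullet> c = sw d (\<lambda>a b. f a b \<bullet> c)"
  by (rule sw_hom[OF additive_mulA_left, symmetric])

lemma rR_plus: "balAR f \<Longrightarrow> sw (rR (a + b)) f = sw (rR a) f + sw (rR b) f"
  using sw_cong_ker[OF ax_rR_plus] by (simp add: sw_plus_arg)

lemma additive_rR: "balAR f \<Longrightarrow> additive_map (\<lambda>a. sw (rR a) f)"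
  by (simp add: additive_map_def rR_plus)

lemma rR_one: "balAR f \<Longrightarrow> sw (rR oneA) f = f oneA one"
  using sw_cong_ker[OF ax_rR_one] by simp

lemma rR_mult: "balAR f \<Longrightarrow>
    sw (rR (a \<bullet> b)) f = sw (rR a) (\<lambda>a0 a1. sw (rR b) (\<lambda>b0 b1. f (a0 \<bullet> b0) (a1 ** b1)))"
  using sw_cong_ker[OF ax_rR_mult] by (simp add: sw_sw)

lemma rR_mul_eR: "balAR f \<Longrightarrow> sw (rR (a \<bullet> eR r)) f = sw (rR a) (\<lambda>a0 a1. f a0 (a1 ** sR r))"
  using sw_cong_ker[OF ax_rR_e] by (simp add: sw_sw)

lemma coassoc_rRR: "balARR f \<Longrightarrow> sw (rR a) (\<lambda>b c. sw (rR b) (\<lambda>b0 b1. f b0 b1 c))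
    = sw (rR a) (\<lambda>b c. sw (dR c) (\<lambda>c1 c2. f b c1 c2))"
  by (rule sw_coassoc[OF ax_rRR])

lemma coassoc_rLR: "balALR f \<Longrightarrow> sw (rR a) (\<lambda>b c. sw (rL b) (\<lambda>b0 b1. f b0 b1 c))
    = sw (rL a) (\<lambda>b c. sw (dR c) (\<lambda>c1 c2. f b c1 c2))"
  by (rule sw_coassoc[OF ax_rLR])

lemma piR_s': "piR (a ** (b ** sR r)) = piR (a ** b) * r" and piR_t': "piR (a ** (b ** tR r)) = r * piR (a ** b)"
  by (simp_all add: piR_s piR_t flip: mul_assoc)

text \<open>The left action of \<open>R\<close> is expressed by the coaction
  (\<open>rR_lact\<close>), so this compatibility is a consequence: coassociativity moves the scalar
  into \<open>\<gamma>\<^sub>R\<close>, whose Takeuchi condition and counit law finish the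
  argument.\<close>

lemma rR_takeuchi:
  assumes f: "balAR f"
  shows "sw (rR a) (\<lambda>a0 a1. f (eR r \<bullet> a0) a1) = sw (rR a) (\<lambda>a0 a1. f a0 (tR r ** a1))"
proof -
  note f_add = balanced_add_left[OF f] balanced_add_right[OF f]
  have bal: "balARR (\<lambda>n h k. f n (k ** tR (piR (sR r ** h))))"
    by (rule balanced3I)
      (simp_all add: distribs f_add balanced_swap[OF f] tR_mult piR_s' piR_t' mul_assoc)
  have bal': "balR (\<lambda>h k. f n (k ** tR (piR h)))" for n
    by (simp add: balanced_def distribs f_add tR_mult piR_s mul_assoc)
  have "f (eR r \<bullet> a0) a1 = sw (rR a0) (\<lambda>n h. f n (a1 ** tR (piR (sR r ** h))))" for a0 a1
    using sw_hom[OF balanced_additive_left[OF f], of "rR a0" "\<lambda>n h. n \<bullet> eR (piR (sR r ** h))" a1]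
    by (simp add: rR_lact balanced_swap[OF f])
  then have "sw (rR a) (\<lambda>a0 a1. f (eR r \<bullet> a0) a1)
      = sw (rR a) (\<lambda>a0 a1. sw (rR a0) (\<lambda>n h. f n (a1 ** tR (piR (sR r ** h)))))"
    by simp
  also have "\<dots> = sw (rR a) (\<lambda>n c. sw (dR c) (\<lambda>h k. f n (tR r ** k ** tR (piR h))))"
    by (simp add: coassoc_rRR[OF bal] R_takeuchi[OF bal'])
  also have "\<dots> = sw (rR a) (\<lambda>n c. f n (tR r ** c))"
    by (simp add: sw_hom[OF balanced_additive_right[OF f]] R_counit_left mul_assoc flip: mul_sw)
  finally show ?thesis .
qed

lemma balAR_takeuchi:
  assumes f: "balAR f"
  shows "balAR (\<lambda>c0 c1. sw (rR a) (\<lambda>a0 a1. f (c0 \<bullet> a0) (c1 ** a1)))"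
proof (rule balancedI)
  fix c0 c1 r
  have "balAR (\<lambda>a0 a1. f (c0 \<bullet> a0) (c1 ** a1))"
    using f by (simp add: balanced_def distribsA mulA_assoc[symmetric] mul_assoc[symmetric])
  from rR_takeuchi[OF this, of a r]
  show "sw (rR a) (\<lambda>a0 a1. f (c0 \<bullet> eR r \<bullet> a0) (c1 ** a1))
      = sw (rR a) (\<lambda>a0 a1. f (c0 \<bullet> a0) (c1 ** tR r ** a1))"
    by (simp add: mulA_assoc mul_assoc)
qed (simp_all add: distribsA balanced_add_left[OF f] balanced_add_right[OF f])

text \<open>Multiplicativity reduces the claim to the coaction on \<open>1 \<cdot> r\<close>, which
  right linearity turns into \<open>1 \<otimes> s\<^sub>R(r)\<close>.\<close>

lemma rR_eR_mul:
  assumes f: "balAR f" shows "sw (rR (eR r \<bullet> a)) f = sw (rR a) (\<lambda>a0 a1. f a0 (sR r ** a1))"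
proof -
  note f_add = balanced_add_left[OF f] balanced_add_right[OF f]
  note bal1 = balAR_takeuchi[OF f, of a]
  have bal2: "balAR (\<lambda>c0 c1. sw (rR a) (\<lambda>a0 a1. f (c0 \<bullet> a0) (c1 ** sR r ** a1)))"
  proof (rule balancedI)
    fix c0 c1 r'
    show "sw (rR a) (\<lambda>a0 a1. f (c0 \<bullet> eR r' \<bullet> a0) (c1 ** sR r ** a1))
        = sw (rR a) (\<lambda>a0 a1. f (c0 \<bullet> a0) (c1 ** tR r' ** sR r ** a1))"
      using balanced_swap[OF bal1, of c0 r' "c1 ** sR r"] bialgebroid_pair.sL_tL'[OF op]
      by (simp add: mul_assoc sR_tR)
  qed (simp_all add: distribsA f_add)
  have "sw (rR (eR r \<bullet> a)) f = sw (rR (oneA \<bullet> eR r)) (\<lambda>c0 c1. sw (rR a) (\<lambda>a0 a1. f (c0 \<bullet> a0) (c1 ** a1)))"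
    by (simp add: rR_mult[OF f] oneA_mul)
  also have "\<dots> = sw (rR oneA) (\<lambda>c0 c1. sw (rR a) (\<lambda>a0 a1. f (c0 \<bullet> a0) (c1 ** sR r ** a1)))"
    by (rule rR_mul_eR[OF bal1])
  finally show ?thesis by (simp add: rR_one[OF bal2] oneA_mul one_mul)
qed

lemmas rL_plus = comod_alg.rR_plus[OF comod_alg_op]
  and rL_mult = comod_alg.rR_mult[OF comod_alg_op]
  and balAL_takeuchi = comod_alg.balAR_takeuchi[OF comod_alg_op]
  and rL_mul_eL = comod_alg.rR_eR_mul[OF comod_alg_op]

lemma rL_mul_eR: "balAL f \<Longrightarrow> sw (rL (a \<bullet> eR r)) f = sw (rL a) (\<lambda>a0 a1. f a0 (a1 ** sR r))"
  using rL_mul_eL[of f a "piL (sR r)"] by (simp add: eR_eq tL_sR)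

subsection \<open>Coinvariants\<close>

definition coinvR :: "'a \<Rightarrow> bool" where
  "coinvR a \<longleftrightarrow> rR a - frag_of (a, one) \<in> kerR"

definition coinvL :: "'a \<Rightarrow> bool" where
  "coinvL a \<longleftrightarrow> rL a - frag_of (a, one) \<in> kerL"

lemma coinvR_sw: "coinvR b \<Longrightarrow> balAR f \<Longrightarrow> sw (rR b) f = f b one"
  unfolding coinvR_def using sw_cong_ker by force

lemma coinvL_iff: "coinvL a \<longleftrightarrow> comod_alg.coinvR (\<lambda>a b. b ** a) one sL (\<lambda>a b. b \<bullet> a) eL rL a"
  by (simp add: coinvL_def comod_alg.coinvR_def[OF comod_alg_op])

end

section \<open>Congruences modulo the relations of a tensor product\<close>

lemma group_closure_sum:
  "(\<And>i. i \<in> I \<Longrightarrow> g i \<in> group_closure X) \<Longrightarrow> (\<Sum>i\<in>I. g i) \<in> group_closure X"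
  by (induction I rule: infinite_finite_induct) (auto intro: group_closure_add)

text \<open>Meant for maps such as \<open>m \<mapsto> frag_of (m, n)\<close>, which are additive
  only modulo the relations.\<close>

lemma additive_mod_zero:
  assumes "\<And>x y. g (x + y) - g x - g y \<in> group_closure X"
  shows "g (0::'m::ab_group_add) \<in> group_closure X"
  using assms[of 0 0] by simp

lemma additive_mod_diff:
  assumes "\<And>x y. g (x + y) - g x - g y \<in> group_closure X"
  shows "g (x - y :: 'm::ab_group_add) - (g x - g y) \<in> group_closure X"
  using assms[of "x - y" y] group_closure_minus_iff[of "g x - g (x - y) - g y" X]
  by (simp add: algebra_simps)

lemma additive_mod_sum:
  assumes "\<And>x y. g (x + y) - g x - g y \<in> group_closure X"
  shows "g (\<Sum>i\<in>I. f i :: 'm::ab_group_add) - (\<Sum>i\<in>I. g (f i)) \<in> group_closure X"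
proof (induction I rule: infinite_finite_induct)
  case (insert i I)
  from group_closure_add[OF assms[of "f i" "sum f I"] insert.IH]
  show ?case using insert(1,2) by (simp add: algebra_simps)
qed (simp_all add: additive_mod_zero[of g, OF assms])

lemma additive_mod_sw:
  assumes "\<And>x y. g (x + y) - g x - g y \<in> group_closure X"
  shows "g (sw d f :: 'm::ab_group_add) - sw d (\<lambda>a b. g (f a b)) \<in> group_closure X"
proof (induction d rule: frag_induct)
  case zero
  then show ?case by (simp add: additive_mod_zero[of g, OF assms])
next
  case (one p)
  then show ?case by (cases p) simp
next
  case (diff x y)
  from group_closure_add[OF additive_mod_diff[of g, OF assms, of "sw x f" "sw y f"]
      group_closure.diff[OF diff]]
  show ?case by (simp add: sw_diff_arg algebra_simps)
qed

lemma sw_group_closure: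
  assumes "\<And>a b. f a b - g a b \<in> group_closure X"
  shows "sw d f - sw d g \<in> group_closure X"
proof (induction d rule: frag_induct)
  case (one p)
  then show ?case using assms by (cases p) simp
next
  case (diff x y)
  from group_closure.diff[OF diff] show ?case by (simp add: sw_diff_arg algebra_simps)
qed simp

abbreviation ten_ker ::
    "'s set \<Rightarrow> ('m::ab_group_add \<Rightarrow> 's \<Rightarrow> 'm) \<Rightarrow> ('s \<Rightarrow> 'n::ab_group_add \<Rightarrow> 'n) \<Rightarrow> ('m \<times> 'n) frag set" where
  "ten_ker B ra la \<equiv> tensor_ker_on UNIV (+) UNIV (+) B ra la"

lemma ten_ker_add_left: "frag_of (m + m', n) - frag_of (m, n) - frag_of (m', n) \<in> ten_ker B ra la"
  and ten_ker_add_right: "frag_of (m, n + n') - frag_of (m, n) - frag_of (m, n') \<in> ten_ker B ra la"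
  and ten_ker_swap: "s \<in> B \<Longrightarrow> frag_of (ra m s, n) - frag_of (m, la s n) \<in> ten_ker B ra la"
  unfolding tensor_ker_on_def by (rule group_closure.base; blast)+

lemmas ten_ker_left_sw =
    additive_mod_sw[of "\<lambda>m. frag_of (m, n)" for n, OF ten_ker_add_left[unfolded tensor_ker_on_def],
      folded tensor_ker_on_def]
  and ten_ker_right_sum =
    additive_mod_sum[of "\<lambda>n. frag_of (m, n)" for m, OF ten_ker_add_right[unfolded tensor_ker_on_def],
      folded tensor_ker_on_def]
  and ten_ker_left_sum =
    additive_mod_sum[of "\<lambda>m. frag_of (m, n)" for n, OF ten_ker_add_left[unfolded tensor_ker_on_def],
      folded tensor_ker_on_def]
  and ten_ker_right_diff =
    additive_mod_diff[of "\<lambda>n. frag_of (m, n)" for m, OF ten_ker_add_right[unfolded tensor_ker_on_def],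
      folded tensor_ker_on_def]
  and ten_ker_left_diff =
    additive_mod_diff[of "\<lambda>m. frag_of (m, n)" for n, OF ten_ker_add_left[unfolded tensor_ker_on_def],
      folded tensor_ker_on_def]
  and ten_ker_right_0 =
    additive_mod_zero[of "\<lambda>n. frag_of (m, n)" for m, OF ten_ker_add_right[unfolded tensor_ker_on_def],
      folded tensor_ker_on_def]
  and ten_ker_left_0 =
    additive_mod_zero[of "\<lambda>m. frag_of (m, n)" for n, OF ten_ker_add_left[unfolded tensor_ker_on_def],
      folded tensor_ker_on_def]

lemma ten_ker_diff: "x \<in> ten_ker B ra la \<Longrightarrow> y \<in> ten_ker B ra la \<Longrightarrow> x - y \<in> ten_ker B ra la"
  and ten_ker_add: "x \<in> ten_ker B ra la \<Longrightarrow> y \<in> ten_ker B ra la \<Longrightarrow> x + y \<in> ten_ker B ra la"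
  and ten_ker_zero: "0 \<in> ten_ker B ra la"
  and ten_ker_minus: "x \<in> ten_ker B ra la \<Longrightarrow> - x \<in> ten_ker B ra la"
  and ten_ker_sum: "(\<And>i. i \<in> I \<Longrightarrow> g i \<in> ten_ker B ra la) \<Longrightarrow> (\<Sum>i\<in>I. g i) \<in> ten_ker B ra la"
  and ten_ker_sw: "(\<And>a b. f a b - f' a b \<in> ten_ker B ra la) \<Longrightarrow> sw d f - sw d f' \<in> ten_ker B ra la"
  unfolding tensor_ker_on_def
  by (fact group_closure.diff group_closure_add zero_in_group_closure
      group_closure_minus_iff[THEN iffD2] group_closure_sum sw_group_closure)+

lemma ten_ker_trans: "x - y \<in> ten_ker B ra la \<Longrightarrow> y - z \<in> ten_ker B ra la \<Longrightarrow> x - z \<in> ten_ker B ra la"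
  using ten_ker_add[of "x - y" B ra la "y - z"] by simp

lemma ten_ker_UNIV: "tensor_ker ra la = ten_ker UNIV ra la"
  by (simp add: tensor_ker_def)

context comod_alg
begin

text \<open>The dual basis writes \<open>a \<otimes> h\<close> as \<open>\<Sum>\<^sub>i a \<cdot>
  \<beta>\<^sub>i(h) \<otimes> b\<^sub>i\<close>, which extends to all formal sums since their first
  entries may be added up modulo the relations.\<close>

lemma kerR_decomposition: "x - (\<Sum>i\<in>IR. frag_of (sw x (\<lambda>a h. a \<bullet> eR (\<beta>R i h)), bR i)) \<in> kerR"
  unfolding ten_ker_UNIV
proof (induction x rule: frag_induct)
  case zero
  show ?case using ten_ker_minus[OF ten_ker_sum[OF ten_ker_left_0]] by simp
next
  case (one p)
  obtain a h where p: "p = (a, h)" by (cases p)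
  have "frag_of (a, \<Sum>i\<in>IR. bR i ** tR (\<beta>R i h)) - (\<Sum>i\<in>IR. frag_of (a, bR i ** tR (\<beta>R i h)))
      \<in> ten_ker UNIV (\<lambda>a r. a \<bullet> eR r) (\<lambda>r h. h ** tR r)"
    by (rule ten_ker_right_sum)
  moreover have "(\<Sum>i\<in>IR. frag_of (a \<bullet> eR (\<beta>R i h), bR i) - frag_of (a, bR i ** tR (\<beta>R i h)))
      \<in> ten_ker UNIV (\<lambda>a r. a \<bullet> eR r) (\<lambda>r h. h ** tR r)"
    by (rule ten_ker_sum)
      (rule ten_ker_swap[OF UNIV_I, where ra = "\<lambda>a r. a \<bullet> eR r" and la = "\<lambda>r h. h ** tR r"])
  ultimately show ?case
    using ten_ker_diff by (fastforce simp: p dual_basis_R sum_subtractf)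
next
  case (diff x y)
  let ?K = "ten_ker UNIV (\<lambda>a r. a \<bullet> eR r) (\<lambda>r h. h ** tR r)"
  let ?g = "\<lambda>x i. sw x (\<lambda>a h. a \<bullet> eR (\<beta>R i h))"
  have "(\<Sum>i\<in>IR. frag_of (?g x i - ?g y i, bR i) - (frag_of (?g x i, bR i) - frag_of (?g y i, bR i))) \<in> ?K"
    by (rule ten_ker_sum) (rule ten_ker_left_diff)
  from ten_ker_diff[OF ten_ker_diff[OF diff] this] show ?case
    by (simp add: sw_diff_arg sum_subtractf sum.distrib algebra_simps)
qed

text \<open>The converse of \<open>sw_cong_ker\<close>: finitely many balanced maps into
  \<open>A\<close> decide equality in \<open>A \<otimes>\<^sub>R H\<close>.\<close>

lemma kerR_separation:
  assumes "\<And>i. i \<in> IR \<Longrightarrow> sw x (\<lambda>a h. a \<bullet> eR (\<beta>R i h)) = sw y (\<lambda>a h. a \<bullet> eR (\<beta>R i h))"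
  shows "x - y \<in> kerR"
  using tensor_ker_diff[OF kerR_decomposition[of x] kerR_decomposition[of y]] assms by simp

lemma balAR_\<beta>: "balAR (\<lambda>a h. a \<bullet> eR (\<beta>R i h))"
  by (simp add: balanced_def distribsA \<beta>R_add \<beta>R_t eR_mult mulA_assoc)

lemma coinvRI: "(\<And>i. sw (rR a) (\<lambda>c h. c \<bullet> eR (\<beta>R i h)) = a \<bullet> eR (\<beta>R i one)) \<Longrightarrow> coinvR a"
  unfolding coinvR_def by (rule kerR_separation) simp

text \<open>The expression \<open>b\<^sup>0\<^sub>0 \<otimes> b\<^sup>0\<^sub>1 S(b\<^sup>1)\<close>
  is computed twice: coinvariance leaves \<open>\<tau>\<^sub>L(b)\<close>, while mixed
  coassociativity and the right antipode axiom leave \<open>b \<otimes> 1\<close>.\<close>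

lemma coinvR_sw_L:
  assumes b: "coinvR b" and f: "balAL f" shows "sw (rL b) f = f b one"
proof -
  note f_add = balanced_add_left[OF f] balanced_add_right[OF f]
  have balS: "balAL (\<lambda>b0 b1. f b0 (b1 ** S c))" for c
    by (simp add: balanced_def distribs f_add balanced_swap[OF f] mul_assoc)
  have bal: "balALR (\<lambda>b h k. f b (h ** S k))"
    by (rule balanced3I) (simp_all add: distribs f_add balanced_swap[OF f] S_simps mul_assoc)
  have bal': "balAR (\<lambda>b c. sw (rL b) (\<lambda>b0 b1. f b0 (b1 ** S c)))"
    by (rule balancedI)
      (simp_all add: rL_plus[OF balS] rL_mul_eR[OF balS] distribs f_add S_simps mul_assoc)
  have "sw (rL b) f = sw (rR b) (\<lambda>b c. sw (rL b) (\<lambda>b0 b1. f b0 (b1 ** S c)))"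
    by (simp add: coinvR_sw[OF b bal'] S_one mul_one)
  also have "\<dots> = sw (rL b) (\<lambda>b0 c. f (eL (piL c) \<bullet> b0) one)"
    using balanced_swap[OF f, of _ _ one]
    by (simp add: coassoc_rLR[OF bal] sw_hom[OF balanced_additive_right[OF f]] S_right mul_one)
  also have "\<dots> = f b one"
    by (simp add: sw_hom[OF balanced_additive_left[OF f]] rL_counit)
  finally show ?thesis .
qed

lemma coinvR_imp_coinvL:
  assumes "coinvR b" shows "coinvL b"
  unfolding coinvL_iff
proof (rule comod_alg.coinvRI[OF comod_alg_op])
  fix i
  have "balAL (\<lambda>c h. eL (\<beta>L i h) \<bullet> c)"
    by (rule comod_alg.balAR_\<beta>[OF comod_alg_op])
  from coinvR_sw_L[OF assms this]
  show "sw (rL b) (\<lambda>c h. eL (\<beta>L i h) \<bullet> c) = eL (\<beta>L i one) \<bullet> b" .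
qed

lemma coinvL_eq_coinvR: "coinvL b = coinvR b"
proof -
  interpret o: comod_alg "\<lambda>a b. b ** a" one tR sR piR dR tL sL piL dL T S IR IL bR bL \<beta>R \<beta>L
      "\<lambda>a b. b \<bullet> a" oneA eR eL rR rL
    by (rule comod_alg_op)
  show ?thesis
    using coinvR_imp_coinvL[of b] o.coinvR_imp_coinvL[of b]
    unfolding coinvL_def coinvR_def o.coinvL_def o.coinvR_def by blast
qed

text \<open>The formula for the left \<open>R\<close>-action is evaluated at
  \<open>b \<otimes> 1\<close>. Because of this the trace maps are right
  \<open>B\<close>-linear.\<close>

lemma coinvR_commute:
  assumes "coinvR b" shows "b \<bullet> eR r = eR r \<bullet> b"
proof -
  have "balAR (\<lambda>a0 a1. a0 \<bullet> eR (piR (sR r ** a1)))"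
    by (simp add: balanced_def distribsA piR_t' eR_mult mulA_assoc)
  from coinvR_sw[OF assms this] show ?thesis
    by (simp add: rR_lact mul_one piR_sR)
qed

lemma coinvR_add: "coinvR a \<Longrightarrow> coinvR b \<Longrightarrow> coinvR (a + b)"
  by (rule coinvRI) (simp add: rR_plus[OF balAR_\<beta>] coinvR_sw[OF _ balAR_\<beta>] distribsA)

subsection \<open>The trace maps\<close>

definition trace :: "'h \<Rightarrow> 'a \<Rightarrow> 'a" where
  "trace j a = sw (rR a) (\<lambda>a0 a1. a0 \<bullet> eR (integral j a1))"

lemma balAR_integral: "balAR (\<lambda>a0 a1. a0 \<bullet> eR (integral j a1))"
  by (simp add: balanced_def distribsA integral_add integral_tR eR_mult mulA_assoc)

lemma trace_add: "trace j (a + b) = trace j a + trace j b"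
  by (simp add: trace_def rR_plus[OF balAR_integral])

lemma \<beta>R_tR_sR: "\<beta>R i (h ** (tR r ** sR r')) = r * \<beta>R i (h ** sR r')"
  by (simp add: \<beta>R_t flip: sR_tR mul_assoc)

text \<open>Coassociativity gives \<open>a\<^sup>0 \<otimes> (a\<^sup>1)\<^sup>1
  s\<^sub>R(\<lambda>((a\<^sup>1)\<^sup>2))\<close>. Invariance replaces the second factor by
  \<open>t\<^sub>R(\<lambda>(a\<^sup>1))\<close>, and this scalar crosses the tensor sign to leave
  \<open>1\<close> behind.\<close>

lemma trace_coinv: "coinvR (trace j a)"
proof (rule coinvRI)
  fix i
  let ?f = "\<lambda>c h. c \<bullet> eR (\<beta>R i h)"
  have bal: "balARR (\<lambda>n h k. ?f n (h ** sR (integral j k)))"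
    by (rule balanced3I)
      (simp_all add: distribsA \<beta>R_add \<beta>R_tR_sR integral_add integral_tR sR_mult eR_mult mulA_assoc
        mul_assoc)
  have "sw (rR (trace j a)) ?f = sw (rR a) (\<lambda>a0 a1. sw (rR (a0 \<bullet> eR (integral j a1))) ?f)"
    unfolding trace_def by (rule sw_hom[OF additive_rR[OF balAR_\<beta>], symmetric])
  also have "\<dots> = sw (rR a) (\<lambda>a0 a1. sw (dR a1) (\<lambda>h k. ?f a0 (h ** sR (integral j k))))"
    by (simp add: rR_mul_eR[OF balAR_\<beta>] coassoc_rRR[OF bal])
  also have "\<dots> = sw (rR a) (\<lambda>a0 a1. ?f a0 (one ** tR (integral j a1)))"
    by (simp add: sw_hom[OF balanced_additive_right[OF balAR_\<beta>]] integral_invariant one_mul)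
  also have "\<dots> = trace j a \<bullet> eR (\<beta>R i one)"
    by (simp add: \<beta>R_t eR_mult trace_def sw_mulA mulA_assoc)
  finally show "sw (rR (trace j a)) ?f = trace j a \<bullet> eR (\<beta>R i one)" .
qed

lemma trace_mul_coinv:
  assumes "coinvR b" shows "trace j (a \<bullet> b) = trace j a \<bullet> b"
proof -
  have bal: "balAR (\<lambda>b0 b1. a0 \<bullet> (b0 \<bullet> eR (integral j (a1 ** b1))))" for a0 a1
    by (simp add: balanced_def distribsA integral_add integral_tR eR_mult mulA_assoc flip: mul_assoc)
  show ?thesis
    by (simp add: trace_def rR_mult[OF balAR_integral] coinvR_sw[OF assms bal] mul_one sw_mulA
        mulA_assoc coinvR_commute[OF assms])
qed

text \<open>Right multiplication by \<open>e\<^sub>R(r)\<close> is expressed through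
  \<open>\<tau>\<^sub>L\<close> by \<open>rL_lact\<close>; mixed coassociativity then brings
  \<open>h\<^sup>1 s\<^sub>R(\<lambda>(h\<^sup>2))\<close> together, and invariance removes
  \<open>\<gamma>\<^sub>R\<close>. In this form the trace can be compared with
  \<open>can\<^sub>L\<close>.\<close>

lemma trace_L: "trace j a = sw (rL a) (\<lambda>a0 a1. eL (piL (tR (integral j a1))) \<bullet> a0)"
proof -
  have bal: "balALR (\<lambda>b h k. eL (piL (h ** sR (integral j k))) \<bullet> b)"
    by (rule balanced3I)
      (simp_all add: distribsA integral_add integral_tR sR_mult mul_assoc piL_s eL_mult mulA_assoc)
  have "sw (rL b) (\<lambda>b0 b1. eL (piL (b1 ** sR r)) \<bullet> b0) = b \<bullet> eR r" for b r
    using rL_lact[of b "piL (sR r)"] by (simp add: tL_sR eR_eq)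
  then have "trace j a = sw (rR a) (\<lambda>b c. sw (rL b) (\<lambda>b0 b1. eL (piL (b1 ** sR (integral j c))) \<bullet> b0))"
    by (simp add: trace_def)
  also have "\<dots> = sw (rL a) (\<lambda>b c. sw (dR c) (\<lambda>h k. eL (piL (h ** sR (integral j k))) \<bullet> b))"
    by (rule coassoc_rLR[OF bal])
  also have "\<dots> = sw (rL a) (\<lambda>a0 a1. eL (piL (tR (integral j a1))) \<bullet> a0)"
  proof -
    have "additive_map (\<lambda>X. eL (piL X) \<bullet> b)" for b
      by (simp add: additive_map_def distribsA)
    from sw_hom[OF this, where f = "\<lambda>h k. h ** sR (integral j k)"]
    show ?thesis by (simp add: integral_invariant)
  qed
  finally show ?thesis .
qed

text \<open>Lifting the tensors \<open>1 \<otimes> h\<close> is enough, as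
  \<open>can\<^sub>R\<close> is left \<open>A\<close>-linear.\<close>

definition surjR :: bool where
  "surjR \<longleftrightarrow> (\<forall>h. \<exists>y. sw y (\<lambda>u v. sw (rR v) (\<lambda>c k. frag_of (u \<bullet> c, k))) - frag_of (oneA, h) \<in> kerR)"

text \<open>The two entries of \<open>y\<close> are flipped with respect to
  \<open>can\<^sub>L\<close>, which makes this \<open>surjR\<close> of the opposite
  structure.\<close>

definition surjL :: bool where
  "surjL \<longleftrightarrow> (\<forall>h. \<exists>y. sw y (\<lambda>u v. sw (rL v) (\<lambda>c k. frag_of (c \<bullet> u, k))) - frag_of (oneA, h) \<in> kerL)"

lemma surjR_lift:
  assumes surjR
  obtains Y where "\<And>j. sw (Y j) (\<lambda>u v. sw (rR v) (\<lambda>c k. frag_of (u \<bullet> c, k)))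
      - frag_of (oneA, T (bR j)) \<in> kerR"
proof
  let ?P = "\<lambda>h y. sw y (\<lambda>u v. sw (rR v) (\<lambda>c k. frag_of (u \<bullet> c, k))) - frag_of (oneA, h) \<in> kerR"
  show "?P (T (bR j)) (SOME y. ?P (T (bR j)) y)" for j
    by (rule someI_ex) (use assms in \<open>simp only: surjR_def\<close>)
qed

text \<open>As \<open>\<tau>\<^sub>R\<close> is multiplicative, the lift of
  \<open>1 \<otimes> T(b\<^sub>j)\<close> turns \<open>\<Sum> u tr\<^sub>j(v a)\<close> into
  \<open>a\<^sup>0 \<cdot> \<lambda>\<^sub>j(T(b\<^sub>j) a\<^sup>1)\<close>; summing over
  \<open>j\<close> gives the counit.\<close>

lemma trace_dual_basis:
  assumes Y: "\<And>j. sw (Y j) (\<lambda>u v. sw (rR v) (\<lambda>c k. frag_of (u \<bullet> c, k))) - frag_of (oneA, T (bR j)) \<in> kerR"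
  shows "(\<Sum>j\<in>IR. sw (Y j) (\<lambda>u v. u \<bullet> trace j (v \<bullet> a))) = a"
proof -
  let ?f = "\<lambda>j c k. sw (rR a) (\<lambda>a0 a1. c \<bullet> a0 \<bullet> eR (integral j (k ** a1)))"
  have bal: "balAR (?f j)" for j
    by (rule balAR_takeuchi[OF balAR_integral])
  have "sw (Y j) (\<lambda>u v. u \<bullet> trace j (v \<bullet> a)) = ?f j oneA (T (bR j))" for j
    using sw_cong_ker[OF Y bal, of j]
    by (simp add: sw_sw trace_def rR_mult[OF balAR_integral] mulA_sw mulA_assoc)
  then have "(\<Sum>j\<in>IR. sw (Y j) (\<lambda>u v. u \<bullet> trace j (v \<bullet> a)))
      = sw (rR a) (\<lambda>a0 a1. a0 \<bullet> eR (\<Sum>j\<in>IR. integral j (T (bR j) ** a1)))"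
    by (simp add: oneA_mul sw_sum additive_map_sum[OF additive_eR] additive_map_sum[OF additive_mulA_right])
  then show ?thesis
    by (simp add: integral_dual_basis rR_counit)
qed

lemma coinvR_0: "coinvR 0"
  using coinvRI[of 0] additive_map_0[OF additive_rR[OF balAR_\<beta>]]
  by (simp add: additive_map_0[OF additive_mulA_left])

lemma coinvR_diff: "coinvR a \<Longrightarrow> coinvR b \<Longrightarrow> coinvR (a - b)"
  by (rule coinvRI)
    (simp add: additive_map_diff[OF additive_rR[OF balAR_\<beta>]] coinvR_sw[OF _ balAR_\<beta>]
      additive_map_diff[OF additive_mulA_left])

lemma coinvR_sum: "(\<And>i. i \<in> I \<Longrightarrow> coinvR (f i)) \<Longrightarrow> coinvR (\<Sum>i\<in>I. f i)"
  by (induction I rule: infinite_finite_induct) (auto intro: coinvR_0 coinvR_add)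

lemma coinvR_sw_fun: "(\<And>a b. coinvR (f a b)) \<Longrightarrow> coinvR (sw d f)"
proof (induction d rule: frag_induct)
  case (one p)
  then show ?case by (cases p) simp
qed (simp_all add: coinvR_0 coinvR_diff sw_diff_arg)

section \<open>Projectivity over the coinvariants\<close>

lemma additive_lookup: "additive_map (\<lambda>f. Poly_Mapping.lookup f x)"
  by (simp add: additive_map_def lookup_add)

lemma projective_right:
  assumes surjR shows "projective {b. coinvR b} (\<lambda>b c. c \<bullet> b) (\<lambda>b m. m \<bullet> b)"
proof -
  obtain Y where Y: "\<And>j. sw (Y j) (\<lambda>u v. sw (rR v) (\<lambda>c k. frag_of (u \<bullet> c, k)))
      - frag_of (oneA, T (bR j)) \<in> kerR"
    by (rule surjR_lift[OF assms]) (rule that)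
  \<comment> \<open>The basis of the free module is the underlying set of \<open>A\<close>, so the
    left entries \<open>u\<close> of the lifts serve as basis vectors with coefficients
    \<open>tr\<^sub>j(v m)\<close>. Contributions with the same \<open>u\<close> add up.\<close>
  define i :: "'a \<Rightarrow> 'a \<Rightarrow>\<^sub>0 'a" where
    "i m = (\<Sum>j\<in>IR. sw (Y j) (\<lambda>u v. Poly_Mapping.single u (trace j (v \<bullet> m))))" for m
  define p :: "('a \<Rightarrow>\<^sub>0 'a) \<Rightarrow> 'a" where
    "p f = (\<Sum>x\<in>Poly_Mapping.keys f. x \<bullet> Poly_Mapping.lookup f x)" for f
  note mulA_0 = additive_map_0[OF additive_mulA_left] additive_map_0[OF additive_mulA_right]
  have lookup_i: "Poly_Mapping.lookup (i m) x
      = (\<Sum>j\<in>IR. sw (Y j) (\<lambda>u v. if u = x then trace j (v \<bullet> m) else 0))" for m x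
  proof -
    have "sw (Y j) (\<lambda>u v. Poly_Mapping.lookup (Poly_Mapping.single u (trace j (v \<bullet> m))) x)
      = Poly_Mapping.lookup (sw (Y j) (\<lambda>u v. Poly_Mapping.single u (trace j (v \<bullet> m)))) x" for j
      by (rule sw_hom[OF additive_lookup])
    then show ?thesis
      by (simp add: i_def additive_map_sum[OF additive_lookup] lookup_single when_def)
  qed
  have lookup_map: "Poly_Mapping.lookup (Poly_Mapping.map (\<lambda>c. c \<bullet> b) f) x = Poly_Mapping.lookup f x \<bullet> b"
    for b f x by (simp add: Poly_Mapping.map.rep_eq when_def mulA_0)
  have p_superset: "p f = (\<Sum>x\<in>F. x \<bullet> Poly_Mapping.lookup f x)"
    if "finite F" "Poly_Mapping.keys f \<subseteq> F" for f F
    unfolding p_def by (rule sum.mono_neutral_left) (use that in \<open>auto simp: in_keys_iff mulA_0\<close>)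
  have p_add: "p (f + g) = p f + p g" for f g
  proof -
    let ?F = "Poly_Mapping.keys f \<union> Poly_Mapping.keys g"
    have "p (f + g) = (\<Sum>x\<in>?F. x \<bullet> Poly_Mapping.lookup (f + g) x)"
      by (rule p_superset) (auto dest: subsetD[OF Poly_Mapping.keys_add])
    then show ?thesis
      by (simp add: lookup_add mulA_add_right sum.distrib p_superset[of ?F])
  qed
  have p_single: "p (Poly_Mapping.single x c) = x \<bullet> c" for x c
    by (simp add: p_superset[of "{x}"])
  have p: "additive_map p" by (simp add: additive_map_def p_add)
  have p_i: "p (i m) = m" for m
    using trace_dual_basis[OF Y, of m]
    by (simp add: i_def additive_map_sum[OF p] sw_hom[OF p, symmetric] p_single)
  show ?thesis
    unfolding projective_def
  proof (intro exI[of _ i] exI[of _ p] conjI allI ballI)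
    show "range i \<subseteq> free_module {b. coinvR b}"
      by (auto simp: free_module_def lookup_i intro!: coinvR_sum coinvR_sw_fun trace_coinv coinvR_0)
    show "i (m + m') = i m + i m'" for m m'
      by (simp add: i_def mulA_add_right trace_add single_add sw_add sum.distrib)
    show "i (m \<bullet> b) = Poly_Mapping.map (\<lambda>c. c \<bullet> b) (i m)" if "b \<in> {b. coinvR b}" for b m
    proof (rule poly_mapping_eqI)
      fix x :: 'a
      have "(if u = x then trace j (v \<bullet> (m \<bullet> b)) else 0) = (if u = x then trace j (v \<bullet> m) else 0) \<bullet> b" for u v j
        using trace_mul_coinv[of b j "v \<bullet> m"] that by (simp add: mulA_0 mulA_assoc)
      then show "Poly_Mapping.lookup (i (m \<bullet> b)) x = Poly_Mapping.lookup (Poly_Mapping.map (\<lambda>c. c \<bullet> b) (i m)) x"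
        by (simp add: lookup_i lookup_map additive_map_sum[OF additive_mulA_left] sw_mulA)
    qed
    show "p (f + g) = p f + p g" for f g by (rule p_add)
    show "p (Poly_Mapping.map (\<lambda>c. c \<bullet> b) f) = p f \<bullet> b" for b f
    proof -
      have "p (Poly_Mapping.map (\<lambda>c. c \<bullet> b) f)
          = (\<Sum>x\<in>Poly_Mapping.keys f. x \<bullet> Poly_Mapping.lookup (Poly_Mapping.map (\<lambda>c. c \<bullet> b) f) x)"
        by (rule p_superset) (auto simp: in_keys_iff lookup_map mulA_0)
      then show ?thesis
        by (simp add: lookup_map p_def additive_map_sum[OF additive_mulA_left] mulA_assoc)
    qed
    show "p (i m) = m" for m by (rule p_i)
  qed
qed

lemma projective_left:
  assumes surjL shows "projective {b. coinvR b} (\<lambda>b c. b \<bullet> c) (\<lambda>b m. b \<bullet> m)"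
proof -
  interpret o: comod_alg "\<lambda>a b. b ** a" one tR sR piR dR tL sL piL dL T S IR IL bR bL \<beta>R \<beta>L
      "\<lambda>a b. b \<bullet> a" oneA eR eL rR rL
    by (rule comod_alg_op)
  have "o.surjR" using assms by (simp add: surjL_def o.surjR_def)
  from o.projective_right[OF this] show ?thesis
    by (simp add: coinvL_eq_coinvR flip: coinvL_iff)
qed

section \<open>The canonical maps\<close>

abbreviation ker_B :: "('a \<times> 'a) frag set" where
  "ker_B \<equiv> ten_ker {b. coinvR b} (\<bullet>) (\<bullet>)"

text \<open>Well-definedness of \<open>can\<^sub>R\<close> on \<open>A \<otimes>\<^sub>B A\<close>,
  in terms of test maps; a coinvariant passes from one factor to the other because its coaction is
  \<open>s \<otimes> 1\<close>.\<close>

lemma canR_ker: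
  assumes f: "balAR f" and x: "x \<in> ker_B"
  shows "sw x (\<lambda>a a'. sw (rR a') (\<lambda>c h. f (a \<bullet> c) h)) = 0"
proof (rule sw_tensor_ker_on[OF x])
  have bal: "balAR (\<lambda>c h. f (a \<bullet> c) h)" for a
    using f by (simp add: balanced_def distribsA flip: mulA_assoc)
  fix m m' n :: 'a
  show "sw (rR n) (\<lambda>c h. f ((m + m') \<bullet> c) h)
      = sw (rR n) (\<lambda>c h. f (m \<bullet> c) h) + sw (rR n) (\<lambda>c h. f (m' \<bullet> c) h)"
    unfolding mulA_add_left balanced_add_left[OF f] by (rule sw_add)
  show "sw (rR (n + m')) (\<lambda>c h. f (m \<bullet> c) h)
      = sw (rR n) (\<lambda>c h. f (m \<bullet> c) h) + sw (rR m') (\<lambda>c h. f (m \<bullet> c) h)"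
    by (rule rR_plus[OF bal])
  fix s assume "s \<in> {b. coinvR b}"
  then show "sw (rR n) (\<lambda>c h. f (m \<bullet> s \<bullet> c) h) = sw (rR (s \<bullet> n)) (\<lambda>c h. f (m \<bullet> c) h)"
    by (simp add: rR_mult[OF bal] coinvR_sw[OF _ balAR_takeuchi[OF bal]] one_mul mulA_assoc)
qed

lemma canL_ker:
  assumes f: "balAL f" and x: "x \<in> ker_B"
  shows "sw x (\<lambda>a a'. sw (rL a) (\<lambda>c h. f (c \<bullet> a') h)) = 0"
proof (rule sw_tensor_ker_on[OF x])
  have bal: "balAL (\<lambda>c h. f (c \<bullet> a) h)" for a
    using f by (simp add: balanced_def distribsA mulA_assoc)
  fix m m' n :: 'a
  show "sw (rL (m + m')) (\<lambda>c h. f (c \<bullet> n) h)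
      = sw (rL m) (\<lambda>c h. f (c \<bullet> n) h) + sw (rL m') (\<lambda>c h. f (c \<bullet> n) h)"
    by (rule rL_plus[OF bal])
  show "sw (rL m) (\<lambda>c h. f (c \<bullet> (n + m')) h)
      = sw (rL m) (\<lambda>c h. f (c \<bullet> n) h) + sw (rL m) (\<lambda>c h. f (c \<bullet> m') h)"
    unfolding mulA_add_right balanced_add_left[OF f] by (rule sw_add)
  fix s assume "s \<in> {b. coinvR b}"
  then show "sw (rL (m \<bullet> s)) (\<lambda>c h. f (c \<bullet> n) h) = sw (rL m) (\<lambda>c h. f (c \<bullet> (s \<bullet> n)) h)"
    by (subst rL_mult[OF bal], subst coinvR_sw_L[OF _ balAL_takeuchi[OF bal]])
      (simp_all add: mul_one mulA_assoc)
qed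

text \<open>The map \<open>a \<otimes> h \<mapsto> a\<^sub>0 \<otimes> a\<^sub>1 S(h)\<close> from
  \<open>A \<otimes>\<^sub>R H\<close> to \<open>A \<otimes>\<^sub>L H\<close> is well defined and
  sends \<open>\<tau>\<^sub>R(a)\<close> to \<open>a \<otimes> 1\<close>, since mixed
  coassociativity creates \<open>h\<^sup>1 S(h\<^sup>2)\<close>.\<close>

lemma rL_mul_S:
  assumes f: "balAL f"
  shows balAR_rL_S: "balAR (\<lambda>a h. sw (rL a) (\<lambda>c d. f c (d ** S h)))"
    and rR_rL_S: "sw (rR a) (\<lambda>b h. sw (rL b) (\<lambda>c d. f c (d ** S h))) = f a one"
proof -
  note f_add = balanced_add_left[OF f] balanced_add_right[OF f]
  have bal: "balAL (\<lambda>c d. f c (d ** x))" for x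
    by (simp add: balanced_def distribs f_add balanced_swap[OF f] mul_assoc)
  show "balAR (\<lambda>a h. sw (rL a) (\<lambda>c d. f c (d ** S h)))"
    by (rule balancedI) (simp_all add: rL_plus[OF bal] rL_mul_eR[OF bal] distribs f_add S_simps mul_assoc)
  have bal': "balALR (\<lambda>c d h. f c (d ** S h))"
    by (rule balanced3I) (simp_all add: distribs f_add balanced_swap[OF f] S_simps mul_assoc)
  have "sw (rR a) (\<lambda>b h. sw (rL b) (\<lambda>c d. f c (d ** S h)))
      = sw (rL a) (\<lambda>c e. f (eL (piL e) \<bullet> c) one)"
    using balanced_swap[OF f, of _ _ one]
    by (simp add: coassoc_rLR[OF bal'] sw_hom[OF balanced_additive_right[OF f]] S_right mul_one)
  then show "sw (rR a) (\<lambda>b h. sw (rL b) (\<lambda>c d. f c (d ** S h))) = f a one"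
    by (simp add: sw_hom[OF balanced_additive_left[OF f]] rL_counit)
qed

text \<open>The two canonical maps differ by \<open>a \<otimes> h \<mapsto> a\<^sub>0 \<otimes> a\<^sub>1 S(h)\<close>.\<close>

lemma canL_eq:
  assumes f: "balAL f"
  shows "sw y (\<lambda>a a'. sw (rL a) (\<lambda>c h. f (c \<bullet> a') h))
    = sw y (\<lambda>a a'. sw (rR a') (\<lambda>p q. sw (rL (a \<bullet> p)) (\<lambda>c d. f c (d ** S q))))"
proof -
  have bal: "balAL (\<lambda>c d. f c (d ** x))" for x
    using f by (simp add: balanced_def distribs mul_assoc)
  have "sw (rR a') (\<lambda>p q. sw (rL (a \<bullet> p)) (\<lambda>c d. f c (d ** S q)))
      = sw (rL a) (\<lambda>c h. f (c \<bullet> a') h)" for a a'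
  proof -
    have "sw (rR a') (\<lambda>p q. sw (rL (a \<bullet> p)) (\<lambda>c d. f c (d ** S q)))
      = sw (rR a') (\<lambda>p q. sw (rL p) (\<lambda>p0 p1. sw (rL a) (\<lambda>c d. f (c \<bullet> p0) (d ** (p1 ** S q)))))"
      by (simp add: rL_mult[OF bal] mul_assoc)
    also have "\<dots> = sw (rL a) (\<lambda>c d. f (c \<bullet> a') (d ** one))"
      by (rule rR_rL_S[OF balAL_takeuchi[OF f]])
    finally show ?thesis by (simp add: mul_one)
  qed
  then show ?thesis by simp
qed

text \<open>The vanishing of a tensor is expressed by test maps into \<open>A\<close> alone, since a
  hypothesis cannot range over all target types; by the separation lemmas these maps
  suffice.\<close>

lemma canR_zero_imp_canL_zero:
  assumes x: "\<And>f::'a \<Rightarrow> 'h \<Rightarrow> 'a. balAR f \<Longrightarrow> sw x (\<lambda>a a'. sw (rR a') (\<lambda>c h. f (a \<bullet> c) h)) = 0"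
    and f: "balAL (f::'a \<Rightarrow> 'h \<Rightarrow> 'a)"
  shows "sw x (\<lambda>a a'. sw (rL a) (\<lambda>c h. f (c \<bullet> a') h)) = 0"
  unfolding canL_eq[OF f] by (rule x[OF balAR_rL_S[OF f]])

lemma kerL_separation:
  assumes "\<And>f::'a \<Rightarrow> 'h \<Rightarrow> 'a. balAL f \<Longrightarrow> sw x f = sw y f"
  shows "x - y \<in> kerL"
  using comod_alg.kerR_separation[OF comod_alg_op] assms comod_alg.balAR_\<beta>[OF comod_alg_op] by simp

lemma canL_surj:
  assumes surj: "\<And>w. \<exists>y. sw y (\<lambda>u v. sw (rR v) (\<lambda>c k. frag_of (u \<bullet> c, k))) - w \<in> kerR"
  shows "\<exists>y. sw y (\<lambda>u v. sw (rL u) (\<lambda>c k. frag_of (c \<bullet> v, k))) - w \<in> kerL"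
proof -
  \<comment> \<open>The tensor \<open>a\<^sup>0 \<otimes> T(h) a\<^sup>1\<close> is a preimage of
    \<open>a \<otimes> h\<close> under
    \<open>a \<otimes> h \<mapsto> a\<^sub>0 \<otimes> a\<^sub>1 S(h)\<close>, and \<open>y\<close>
    lifts it along \<open>can\<^sub>R\<close>.\<close>
  obtain y where y: "sw y (\<lambda>u v. sw (rR v) (\<lambda>c k. frag_of (u \<bullet> c, k)))
      - sw w (\<lambda>a h. sw (rR a) (\<lambda>b k. frag_of (b, T h ** k))) \<in> kerR"
    using surj by blast
  have "sw y (\<lambda>u v. sw (rL u) (\<lambda>c k. frag_of (c \<bullet> v, k))) - w \<in> kerL"
  proof (rule kerL_separation)
    fix f :: "'a \<Rightarrow> 'h \<Rightarrow> 'a" assume f: "balAL f"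
    have bal: "balAL (\<lambda>c d. f c (d ** h))" for h
      using f by (simp add: balanced_def distribs mul_assoc)
    have "sw (sw y (\<lambda>u v. sw (rL u) (\<lambda>c k. frag_of (c \<bullet> v, k)))) f
        = sw w (\<lambda>a h. sw (rR a) (\<lambda>b k. sw (rL b) (\<lambda>c d. f c (d ** S (T h ** k)))))"
      using sw_cong_ker[OF y balAR_rL_S[OF f]] by (simp add: sw_sw canL_eq[OF f])
    also have "\<dots> = sw w (\<lambda>a h. f a (one ** h))"
      using rR_rL_S[OF bal] by (simp add: S_mult S_T mul_assoc)
    finally show "sw (sw y (\<lambda>u v. sw (rL u) (\<lambda>c k. frag_of (c \<bullet> v, k)))) f = sw w f"
      by (simp add: one_mul)
  qed
  then show ?thesis ..
qed

text \<open>By invariance \<open>t\<^sub>R(\<lambda>(x))\<close> equals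
  \<open>x\<^sup>1 s\<^sub>R(\<lambda>(x\<^sup>2))\<close>, where left multiplication by
  \<open>s\<^sub>L(l)\<close> only affects the first leg. This makes \<open>trace_L\<close> a
  balanced expression.\<close>

lemma tR_integral_sL: "tR (integral j (sL l ** x)) = sL l ** tR (integral j x)"
proof -
  have bal: "balR (\<lambda>a b. a ** sR (integral j b))"
    by (simp add: balanced_def distribs integral_add integral_tR sR_mult mul_assoc)
  have "tR (integral j (sL l ** x)) = sw (dR (sL l ** x)) (\<lambda>a b. a ** sR (integral j b))"
    by (rule integral_invariant[symmetric])
  also have "\<dots> = sL l ** sw (dR x) (\<lambda>a b. a ** sR (integral j b))"
    unfolding R_sL[OF bal] mul_sw mul_assoc ..
  finally show ?thesis by (simp only: integral_invariant)
qed

text \<open>The operator \<open>D\<close> sends \<open>a \<otimes> a'\<close> to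
  \<open>\<Sum> u \<otimes> tr\<^sub>j(v a) a'\<close>. It is the identity modulo
  \<open>ker_B\<close>, by the dual basis and because traces lie in \<open>B\<close> and cross the
  tensor sign; on the other hand its right entries are determined by \<open>can\<^sub>L(x)\<close>,
  so it vanishes where \<open>can\<^sub>L\<close> does.\<close>

lemma canL_inj:
  assumes surjR
    and x: "\<And>f::'a \<Rightarrow> 'h \<Rightarrow> 'a. balAL f \<Longrightarrow> sw x (\<lambda>a a'. sw (rL a) (\<lambda>c h. f (c \<bullet> a') h)) = 0"
  shows "x \<in> ker_B"
proof -
  obtain Y where Y: "\<And>j. sw (Y j) (\<lambda>u v. sw (rR v) (\<lambda>c k. frag_of (u \<bullet> c, k)))
      - frag_of (oneA, T (bR j)) \<in> kerR"
    by (rule surjR_lift[OF assms(1)]) (rule that)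
  define D where "D x = (\<Sum>j\<in>IR. sw (Y j) (\<lambda>u v. frag_of (u, sw x (\<lambda>a a'. trace j (v \<bullet> a) \<bullet> a'))))" for x
  have gen: "frag_of (a, a') - D (frag_of (a, a')) \<in> ker_B" for a a'
  proof -
    have "frag_of (\<Sum>j\<in>IR. sw (Y j) (\<lambda>u v. u \<bullet> trace j (v \<bullet> a)), a')
        - (\<Sum>j\<in>IR. frag_of (sw (Y j) (\<lambda>u v. u \<bullet> trace j (v \<bullet> a)), a')) \<in> ker_B"
      by (rule ten_ker_left_sum)
    moreover have "(\<Sum>j\<in>IR. frag_of (sw (Y j) (\<lambda>u v. u \<bullet> trace j (v \<bullet> a)), a')
        - sw (Y j) (\<lambda>u v. frag_of (u, trace j (v \<bullet> a) \<bullet> a'))) \<in> ker_B"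
    proof (rule ten_ker_sum)
      fix j
      have "sw (Y j) (\<lambda>u v. frag_of (u \<bullet> trace j (v \<bullet> a), a'))
          - sw (Y j) (\<lambda>u v. frag_of (u, trace j (v \<bullet> a) \<bullet> a')) \<in> ker_B"
        by (rule ten_ker_sw, rule ten_ker_swap) (simp add: trace_coinv)
      with ten_ker_left_sw show "frag_of (sw (Y j) (\<lambda>u v. u \<bullet> trace j (v \<bullet> a)), a')
          - sw (Y j) (\<lambda>u v. frag_of (u, trace j (v \<bullet> a) \<bullet> a')) \<in> ker_B"
        by (rule ten_ker_trans)
    qed
    ultimately show ?thesis
      using ten_ker_add by (fastforce simp: trace_dual_basis[OF Y] D_def sum_subtractf)
  qed
  \<comment> \<open>\<open>D\<close> sums up inside the second entry of a generator, so it is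
    additive only modulo the relations.\<close>
  have D_diff: "D x - D y - D (x - y) \<in> ker_B" for x y
  proof -
    have "(\<Sum>j\<in>IR. sw (Y j) (\<lambda>u v. frag_of (u, sw x (\<lambda>a a'. trace j (v \<bullet> a) \<bullet> a')
          - sw y (\<lambda>a a'. trace j (v \<bullet> a) \<bullet> a')))
        - sw (Y j) (\<lambda>u v. frag_of (u, sw x (\<lambda>a a'. trace j (v \<bullet> a) \<bullet> a'))
          - frag_of (u, sw y (\<lambda>a a'. trace j (v \<bullet> a) \<bullet> a')))) \<in> ker_B"
      by (intro ten_ker_sum ten_ker_sw ten_ker_right_diff)
    from ten_ker_minus[OF this] show ?thesis
      by (simp add: D_def sw_diff_arg sw_diff sum_subtractf sum.distrib algebra_simps)
  qed
  have "x - D x \<in> ker_B"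
  proof (induction x rule: frag_induct)
    case zero
    show ?case using ten_ker_minus[OF ten_ker_minus[OF D_diff[of 0 0]]] by simp
  next
    case (one p)
    show ?case using gen by (cases p) simp
  next
    case (diff x y)
    from ten_ker_add[OF ten_ker_diff[OF diff] D_diff[of x y]] show ?case
      by (simp add: algebra_simps)
  qed
  moreover have "D x \<in> ker_B"
  proof -
    \<comment> \<open>Written with \<open>\<tau>\<^sub>L\<close>, the expression
      \<open>tr\<^sub>j(v a) a'\<close> is the value of a balanced map on
      \<open>can\<^sub>L(a \<otimes> a')\<close>, multiplied by \<open>\<tau>\<^sub>L(v)\<close>
      from the left.\<close>
    have "sw x (\<lambda>a a'. trace j (v \<bullet> a) \<bullet> a') = 0" for j v
    proof -
      have bal: "balAL (\<lambda>a0 a1. eL (piL (tR (integral j a1))) \<bullet> a0)"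
        by (rule balancedI)
          (simp_all add: distribsA integral_add tR_integral_sL piL_s eL_mult mulA_assoc)
      have bal': "balAL (\<lambda>a0 a1. eL (piL (tR (integral j a1))) \<bullet> a0 \<bullet> a')" for a'
        using bal by (simp add: balanced_def distribsA mulA_assoc)
      show ?thesis
        using x[OF balAL_takeuchi[OF bal], of v]
        by (simp add: trace_L rL_mult[OF bal] sw_mulA mulA_assoc)
    qed
    then have "D x = (\<Sum>j\<in>IR. sw (Y j) (\<lambda>u v. frag_of (u, 0)))"
      by (simp add: D_def)
    moreover have "sw (Y j) (\<lambda>u v. frag_of (u, 0)) - sw (Y j) (\<lambda>u v. 0) \<in> ker_B" for j
      by (rule ten_ker_sw) (simp add: ten_ker_right_0)
    then have "sw (Y j) (\<lambda>u v. frag_of (u, 0)) \<in> ker_B" for j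
      by simp
    ultimately show ?thesis using ten_ker_sum by metis
  qed
  ultimately show ?thesis using ten_ker_add by fastforce
qed

end

section \<open>Cosets and representatives\<close>

lemma tensor_ker_add: "x \<in> tensor_ker ra la \<Longrightarrow> y \<in> tensor_ker ra la \<Longrightarrow> x + y \<in> tensor_ker ra la"
  and tensor_ker_zero: "0 \<in> tensor_ker ra la"
  by (simp_all only: ten_ker_UNIV ten_ker_add ten_ker_zero)

lemma tensor_ker_trans:
  "x - y \<in> tensor_ker ra la \<Longrightarrow> y - z \<in> tensor_ker ra la \<Longrightarrow> x - z \<in> tensor_ker ra la"
  using tensor_ker_add[of "x - y" ra la "y - z"] by simp

lemma tensor_elem:
  assumes "X \<in> tensor_on UNIV UNIV (tensor_ker ra la)"
  shows tensor_elem_diff: "x \<in> X \<Longrightarrow> y \<in> X \<Longrightarrow> x - y \<in> tensor_ker ra la"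
    and tensor_elem_shift: "x \<in> X \<Longrightarrow> y - x \<in> tensor_ker ra la \<Longrightarrow> y \<in> X"
    and rep_in: "rep X \<in> X"
proof -
  obtain z where X: "X = {y. y - z \<in> tensor_ker ra la}"
    using assms by (auto simp: tensor_on_def coset_def)
  show "x - y \<in> tensor_ker ra la" if "x \<in> X" "y \<in> X"
    using that tensor_ker_diff[of "x - z" ra la "y - z"] by (simp add: X)
  show "y \<in> X" if "x \<in> X" "y - x \<in> tensor_ker ra la"
    using that tensor_ker_trans[of y x ra la z] by (simp add: X)
  have "z \<in> X" by (simp add: X tensor_ker_zero)
  then show "rep X \<in> X" unfolding rep_def by (rule someI)
qed

lemma tensor_elem_eq:
  assumes "X \<in> tensor_on UNIV UNIV (tensor_ker ra la)" "x \<in> X"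
  shows "X = coset (tensor_ker ra la) x"
  using tensor_elem_diff[OF assms(1) _ assms(2)] tensor_elem_shift[OF assms(1) assms(2)]
  by (auto simp: coset_def)

lemma in_induced: "x \<in> X \<Longrightarrow> 0 \<in> K \<Longrightarrow> frag_extend f x \<in> induced K f X"
  unfolding induced_def by (auto intro!: bexI[of _ x])

lemma frag_extend_pair: "frag_extend (\<lambda>(a, b). g a b) x = sw x g"
  by (simp add: frag_extend_eq_evaluate sw_def)

lemma tensor_map_ker:
  assumes g: "\<And>x y. g (x + y) = g x + g y" and h: "\<And>x y. h (x + y) = h x + h y"
    and swap: "\<And>m s n. frag_of (g (ra m s), h n) - frag_of (g m, h (la s n)) \<in> tensor_ker ra' la'"
    and z: "z \<in> tensor_ker ra la"
  shows "sw z (\<lambda>a b. frag_of (g a, h b)) \<in> tensor_ker ra' la'"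
  using z[unfolded tensor_ker_def tensor_ker_on_def]
proof (induction z rule: group_closure.induct)
  case (base z)
  then show ?case
    using swap
    by (auto simp: sw_diff_arg g h tensor_ker_zero
        ten_ker_add_left[where B = UNIV, folded ten_ker_UNIV]
        ten_ker_add_right[where B = UNIV, folded ten_ker_UNIV])
qed (simp add: sw_diff_arg tensor_ker_diff)

text \<open>\<open>\<delta>\<close> returns arbitrary representatives and is additive and left
  linear only modulo relations; this is still enough for \<open>M \<otimes> \<delta>\<close> to
  respect the relations of the source.\<close>

lemma tensor_right_ker:
  assumes add: "\<And>n n'. \<delta> (n + n') - (\<delta> n + \<delta> n') \<in> tensor_ker raN laP"
    and left: "\<And>s n. \<delta> (la s n) - sw (\<delta> n) (\<lambda>a b. frag_of (laN s a, b)) \<in> tensor_ker raN laP"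
    and z: "z \<in> tensor_ker raM la"
  shows "sw z (\<lambda>m n. sw (\<delta> n) (\<lambda>a b. frag_of (m, a, b))) \<in> tensor3_ker raM laN raN laP"
proof -
  define K where "K = tensor3_ker raM laN raN laP"
  have sub: "x - y \<in> K" if "x \<in> K" "y \<in> K" for x y
    using that unfolding K_def tensor3_ker_def by (rule group_closure.diff)
  have zero: "0 \<in> K" unfolding K_def tensor3_ker_def by simp
  have comb: "sw d f - sw d f' \<in> K" if "\<And>a b. f a b - f' a b \<in> K" for d f f'
    using that unfolding K_def tensor3_ker_def by (rule sw_group_closure)
  have gens: "frag_of (m + m', n, p) - frag_of (m, n, p) - frag_of (m', n, p) \<in> K"
    "frag_of (m, n + n', p) - frag_of (m, n, p) - frag_of (m, n', p) \<in> K"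
    "frag_of (m, n, p + p') - frag_of (m, n, p) - frag_of (m, n, p') \<in> K"
    "frag_of (raM m s, n, p) - frag_of (m, laN s n, p) \<in> K"
    "frag_of (m, raN n t, p) - frag_of (m, n, laP t p) \<in> K" for m m' n n' p p' s t
    unfolding K_def tensor3_ker_def by (rule group_closure.base; blast)+
  \<comment> \<open>Tensoring with a fixed \<open>m\<close> takes relations in the last two factors
    to relations of the threefold product, which absorbs the errors made by
    \<open>\<delta>\<close>.\<close>
  have emb: "sw x (\<lambda>a b. frag_of (m, a, b)) \<in> K" if "x \<in> tensor_ker raN laP" for x m
    using that[unfolded tensor_ker_def tensor_ker_on_def]
    by (induction x rule: group_closure.induct) (auto simp: sw_diff_arg zero gens sub)
  have "sw z (\<lambda>m n. sw (\<delta> n) (\<lambda>a b. frag_of (m, a, b))) \<in> K"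
    using z[unfolded tensor_ker_def tensor_ker_on_def]
  proof (induction z rule: group_closure.induct)
    case (base z)
    have 1: "sw (\<delta> n) (\<lambda>a b. frag_of (m + m', a, b)) - sw (\<delta> n) (\<lambda>a b. frag_of (m, a, b))
        - sw (\<delta> n) (\<lambda>a b. frag_of (m', a, b)) \<in> K" for m m' n
      using comb[of "\<lambda>a b. frag_of (m + m', a, b) - frag_of (m, a, b)" "\<lambda>a b. frag_of (m', a, b)" "\<delta> n"] gens(1)
      by (simp add: sw_diff)
    have 2: "sw (\<delta> (n + n')) (\<lambda>a b. frag_of (m, a, b)) - sw (\<delta> n) (\<lambda>a b. frag_of (m, a, b))
        - sw (\<delta> n') (\<lambda>a b. frag_of (m, a, b)) \<in> K" for m n n'
      using emb[OF add[of n n'], of m] by (simp add: sw_diff_arg sw_plus_arg algebra_simps)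
    have 3: "sw (\<delta> n) (\<lambda>a b. frag_of (raM m s, a, b)) - sw (\<delta> (la s n)) (\<lambda>a b. frag_of (m, a, b)) \<in> K" for m n s
    proof -
      have "sw (\<delta> n) (\<lambda>a b. frag_of (raM m s, a, b)) - sw (\<delta> n) (\<lambda>a b. frag_of (m, laN s a, b)) \<in> K"
        by (rule comb) (rule gens(4))
      moreover have "sw (\<delta> (la s n)) (\<lambda>a b. frag_of (m, a, b)) - sw (\<delta> n) (\<lambda>a b. frag_of (m, laN s a, b)) \<in> K"
        using emb[OF left[of s n], of m] by (simp add: sw_diff_arg sw_sw)
      ultimately show ?thesis using sub by fastforce
    qed
    from base show ?case by (auto simp: sw_diff_arg zero 1 2 3)
  qed (simp add: sw_diff_arg sub)
  then show ?thesis by (simp add: K_def)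
qed

text \<open>The equation of cosets supplies some \<open>y\<close> in \<open>Y\<close>, which has to
  be exchanged for \<open>rep Y\<close>. Only the right-hand map must be well defined for this,
  since the left-hand one is evaluated at \<open>rep X\<close> itself.\<close>

lemma coassoc_rep:
  assumes eq: "induced (tensor3_ker raM laN raN laP) (tensor_left \<Delta>1) X
      = induced (tensor3_ker raM laN raN laP) (tensor_right \<Delta>2) Y"
    and X: "rep X \<in> X" and Y: "Y \<in> tensor_on UNIV UNIV (tensor_ker raM la)"
    and add: "\<And>n n'. rep (\<Delta>2 (n + n')) - (rep (\<Delta>2 n) + rep (\<Delta>2 n')) \<in> tensor_ker raN laP"
    and left: "\<And>s n. rep (\<Delta>2 (la s n)) - sw (rep (\<Delta>2 n)) (\<lambda>a b. frag_of (laN s a, b)) \<in> tensor_ker raN laP"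
  shows "sw (rep X) (\<lambda>a b. sw (rep (\<Delta>1 a)) (\<lambda>a1 a2. frag_of (a1, a2, b)))
      - sw (rep Y) (\<lambda>a b. sw (rep (\<Delta>2 b)) (\<lambda>b1 b2. frag_of (a, b1, b2))) \<in> tensor3_ker raM laN raN laP"
proof -
  have left_eq: "frag_extend (tensor_left \<Delta>1) x = sw x (\<lambda>a b. sw (rep (\<Delta>1 a)) (\<lambda>a1 a2. frag_of (a1, a2, b)))" for x
    by (simp add: tensor_left_def frag_extend_pair)
  have right_eq: "frag_extend (tensor_right \<Delta>2) x = sw x (\<lambda>a b. sw (rep (\<Delta>2 b)) (\<lambda>b1 b2. frag_of (a, b1, b2)))" for x
    by (simp add: tensor_right_def frag_extend_pair)
  have sub: "x - y \<in> tensor3_ker raM laN raN laP"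
    if "x \<in> tensor3_ker raM laN raN laP" "y \<in> tensor3_ker raM laN raN laP" for x y
    using that unfolding tensor3_ker_def by (rule group_closure.diff)
  have "frag_extend (tensor_left \<Delta>1) (rep X) \<in> induced (tensor3_ker raM laN raN laP) (tensor_right \<Delta>2) Y"
    unfolding eq[symmetric] by (rule in_induced[OF X]) (simp add: tensor3_ker_def)
  then obtain y where y: "y \<in> Y"
    "frag_extend (tensor_left \<Delta>1) (rep X) - frag_extend (tensor_right \<Delta>2) y \<in> tensor3_ker raM laN raN laP"
    by (auto simp: induced_def)
  have "sw (rep Y - y) (\<lambda>a b. sw (rep (\<Delta>2 b)) (\<lambda>b1 b2. frag_of (a, b1, b2))) \<in> tensor3_ker raM laN raN laP"
    by (rule tensor_right_ker[OF add left tensor_elem_diff[OF Y rep_in[OF Y] y(1)]])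
  from sub[OF y(2) this] show ?thesis
    by (simp add: left_eq right_eq sw_diff_arg)
qed

context coring
begin

abbreviation "K \<equiv> tensor_ker ra la"

lemmas rep_\<Delta> = rep_in[OF comult_in]

lemma in_\<Delta>: "x \<in> \<Delta> c \<Longrightarrow> rep (\<Delta> c) - x \<in> K"
  by (rule tensor_elem_diff[OF comult_in rep_\<Delta>])

lemma \<Delta>_plus: "rep (\<Delta> (c + c')) - (rep (\<Delta> c) + rep (\<Delta> c')) \<in> K"
  by (rule in_\<Delta>) (use rep_\<Delta> in \<open>force simp: comult_add coset_add_def\<close>)

lemma \<Delta>_bilinear: "x \<in> \<Delta> c \<Longrightarrow> sw x (\<lambda>a b. frag_of (la r a, ra b r')) \<in> \<Delta> (ra (la r c) r')"
  unfolding comult_bilinear using in_induced[of x "\<Delta> c" K "\<lambda>(a, b). frag_of (la r a, ra b r')"]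
  by (simp add: tensor_ker_zero frag_extend_pair)

lemma \<Delta>_left: "x \<in> \<Delta> c \<Longrightarrow> sw x (\<lambda>a b. frag_of (la r a, b)) \<in> \<Delta> (la r c)"
  using \<Delta>_bilinear[of x c r 1] by (simp add: ra_one)

lemma \<Delta>_right: "x \<in> \<Delta> c \<Longrightarrow> sw x (\<lambda>a b. frag_of (a, ra b r)) \<in> \<Delta> (ra c r)"
  using \<Delta>_bilinear[of x c 1 r] by (simp add: la_one)

lemma \<Delta>_coassoc: "sw (rep (\<Delta> c)) (\<lambda>a b. sw (rep (\<Delta> a)) (\<lambda>a1 a2. frag_of (a1, a2, b)))
      - sw (rep (\<Delta> c)) (\<lambda>a b. sw (rep (\<Delta> b)) (\<lambda>b1 b2. frag_of (a, b1, b2))) \<in> tensor3_ker ra la ra la"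
  by (rule coassoc_rep[OF coassociative rep_\<Delta> comult_in \<Delta>_plus]) (rule in_\<Delta>[OF \<Delta>_left[OF rep_\<Delta>]])

end

context coring_comodule
begin

abbreviation "KM \<equiv> tensor_ker raM la"

lemmas rep_\<tau> = rep_in[OF coact_in]

lemma in_\<tau>: "x \<in> \<tau> m \<Longrightarrow> rep (\<tau> m) - x \<in> KM"
  by (rule tensor_elem_diff[OF coact_in rep_\<tau>])

lemma \<tau>_plus: "rep (\<tau> (c + c')) - (rep (\<tau> c) + rep (\<tau> c')) \<in> KM"
  by (rule in_\<tau>) (use rep_\<tau> in \<open>force simp: coact_add coset_add_def\<close>)

lemma \<tau>_right: "rep (\<tau> (raM m r)) - sw (rep (\<tau> m)) (\<lambda>n c. frag_of (n, ra c r)) \<in> KM"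
  by (rule in_\<tau>)
    (use in_induced[OF rep_\<tau>, of KM "\<lambda>(n, c). frag_of (n, ra c r)" m] in
      \<open>simp add: coact_linear tensor_ker_zero frag_extend_pair\<close>)

lemma \<tau>_coassoc: "sw (rep (\<tau> m)) (\<lambda>a b. sw (rep (\<tau> a)) (\<lambda>a1 a2. frag_of (a1, a2, b)))
      - sw (rep (\<tau> m)) (\<lambda>a b. sw (rep (\<Delta> b)) (\<lambda>b1 b2. frag_of (a, b1, b2))) \<in> tensor3_ker raM la ra la"
  by (rule coassoc_rep[OF coact_coassociative rep_\<tau> coact_in \<Delta>_plus]) (rule in_\<Delta>[OF \<Delta>_left[OF rep_\<Delta>]])

end

section \<open>Finite dual bases\<close>

text \<open>The splitting sends the finitely many generators into the span of a finite set
  \<open>Y\<close> of basis vectors. By linearity all other coordinates vanish on the whole module,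
  so those indexed by \<open>Y\<close> form a dual basis.\<close>

lemma finite_dual_basis:
  fixes act :: "'b::{ring,monoid_mult} \<Rightarrow> 'm::ab_group_add \<Rightarrow> 'm"
  assumes fg: "finitely_generated UNIV act" and proj: "projective UNIV (*) act"
  obtains Y :: "'m set" and e :: "'m \<Rightarrow> 'm" and f :: "'m \<Rightarrow> 'm \<Rightarrow> 'b"
    where "\<And>y m m'. f y (m + m') = f y m + f y m'" "\<And>y b m. f y (act b m) = b * f y m"
    "\<And>m. (\<Sum>y\<in>Y. act (f y m) (e y)) = m"
proof -
  obtain X where X: "finite X" "\<And>m. \<exists>c. m = (\<Sum>x\<in>X. act (c x) x)"
    using fg by (auto simp: finitely_generated_def)
  obtain i :: "'m \<Rightarrow> 'm \<Rightarrow>\<^sub>0 'b" and p where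
    i_add: "\<And>m m'. i (m + m') = i m + i m'" and
    i_act: "\<And>b m. i (act b m) = Poly_Mapping.map ((*) b) (i m)" and
    p_add: "\<And>f g. p (f + g) = p f + p g" and
    p_act: "\<And>b f. p (Poly_Mapping.map ((*) b) f) = act b (p f)" and
    p_i: "\<And>m. p (i m) = m"
    using proj by (auto simp: projective_def free_module_def)
  define Y where "Y = (\<Union>x\<in>X. Poly_Mapping.keys (i x))"
  have Y: "finite Y" using X(1) by (simp add: Y_def)
  have lookup_map: "Poly_Mapping.lookup (Poly_Mapping.map ((*) b) g) y = b * Poly_Mapping.lookup g y"
    for b :: 'b and g y
    by (simp add: Poly_Mapping.map.rep_eq when_def)
  have add_i: "additive_map i" and add_p: "additive_map p"
    by (simp_all add: additive_map_def i_add p_add)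
  have zero: "Poly_Mapping.lookup (i m) y = 0" if "y \<notin> Y" for m y
  proof -
    obtain c where "m = (\<Sum>x\<in>X. act (c x) x)" using X(2) by blast
    then have "Poly_Mapping.lookup (i m) y = (\<Sum>x\<in>X. c x * Poly_Mapping.lookup (i x) y)"
      by (simp add: additive_map_sum[OF add_i] i_act lookup_map Poly_Mapping.lookup_sum)
    also have "\<dots> = 0"
      using that by (intro sum.neutral) (auto simp: Y_def in_keys_iff)
    finally show ?thesis .
  qed
  have i_expand: "i m = (\<Sum>y\<in>Y. Poly_Mapping.map ((*) (Poly_Mapping.lookup (i m) y)) (Poly_Mapping.single y 1))" for m
  proof (rule poly_mapping_eqI)
    fix x
    show "Poly_Mapping.lookup (i m) x = Poly_Mapping.lookup
        (\<Sum>y\<in>Y. Poly_Mapping.map ((*) (Poly_Mapping.lookup (i m) y)) (Poly_Mapping.single y 1)) x"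
      using zero[of x m]
      by (cases "x \<in> Y") (simp_all add: Poly_Mapping.lookup_sum lookup_map lookup_single when_def Y
        if_distrib[where f = "(*) _"] cong: if_cong)
  qed
  show ?thesis
  proof (rule that[where f = "\<lambda>y m. Poly_Mapping.lookup (i m) y" and Y = Y
        and e = "\<lambda>y. p (Poly_Mapping.single y 1)"])
    show "Poly_Mapping.lookup (i (m + m')) y = Poly_Mapping.lookup (i m) y + Poly_Mapping.lookup (i m') y" for y m m'
      by (simp add: i_add lookup_add)
    show "Poly_Mapping.lookup (i (act b m)) y = b * Poly_Mapping.lookup (i m) y" for y b m
      by (simp add: i_act lookup_map)
    have "p (i m) = (\<Sum>y\<in>Y. act (Poly_Mapping.lookup (i m) y) (p (Poly_Mapping.single y 1)))" for m
      by (subst i_expand) (simp only: additive_map_sum[OF add_p] p_act)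
    then show "(\<Sum>y\<in>Y. act (Poly_Mapping.lookup (i m) y) (p (Poly_Mapping.single y 1))) = m" for m
      by (simp add: p_i)
  qed
qed

section \<open>Galois extensions\<close>

context left_bialgebroid
begin

abbreviation "\<delta> h \<equiv> rep (\<gamma> HL h)"

lemma mult_rep: "x \<in> \<gamma> HL h \<Longrightarrow> y \<in> \<gamma> HL h' \<Longrightarrow>
    sw x (\<lambda>a b. sw y (\<lambda>a' b'. frag_of (a * a', b * b'))) \<in> \<gamma> HL (h * h')"
  unfolding comult_mult coset_mult_def frag_mult_def
  by (force simp: tensor_ker_zero frag_extend_pair)

lemma one_rep: "frag_of (1, 1) \<in> \<gamma> HL 1"
  by (simp add: comult_one coset_def tensor_ker_zero)

lemma pi_src: "\<pi> HL (src HL l * h) = l * \<pi> HL h" and pi_tgt: "\<pi> HL (tgt HL l * h) = \<pi> HL h * l"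
  using counit_bilinear[where r = 1 and c = h and r' = l] counit_bilinear[where r = l and c = h and r' = 1]
  by (simp_all add: la_one ra_one)

lemma mul_src_rep: "sw (\<delta> h) (\<lambda>a b. frag_of (a * src HL l, b)) \<in> \<gamma> HL (h * src HL l)"
  using mult_rep[OF rep_\<Delta> \<Delta>_left[OF one_rep, of l]] by simp

text \<open>The axiom relates the chosen representative to some other one, \<open>y\<close>. The two
  may be exchanged because right multiplication of the second leg by \<open>s\<^sub>L(l)\<close>
  commutes with the left multiplications used for balancing.\<close>

lemma takeuchi_rep: "sw (\<delta> h) (\<lambda>a b. frag_of (a * tgt HL l, b))
    - sw (\<delta> h) (\<lambda>a b. frag_of (a, b * src HL l)) \<in> K"
proof -
  have "frag_extend (\<lambda>(a, b). frag_of (a * tgt HL l, b)) (\<delta> h)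
      \<in> induced K (\<lambda>(a, b). frag_of (a, b * src HL l)) (\<gamma> HL h)"
    unfolding takeuchi[symmetric] by (rule in_induced[OF rep_\<Delta> tensor_ker_zero])
  then obtain y where y: "y \<in> \<gamma> HL h"
    "sw (\<delta> h) (\<lambda>a b. frag_of (a * tgt HL l, b)) - sw y (\<lambda>a b. frag_of (a, b * src HL l)) \<in> K"
    by (auto simp: induced_def frag_extend_pair)
  have "sw (\<delta> h - y) (\<lambda>a b. frag_of (a, b * src HL l)) \<in> K"
  proof (rule tensor_map_ker[OF _ _ _ in_\<Delta>[OF y(1)]])
    show "frag_of (tgt HL s * m, n * src HL l) - frag_of (m, src HL s * n * src HL l) \<in> K" for m s n
      using ten_ker_swap[OF UNIV_I, of "\<lambda>h l. tgt HL l * h" m s "n * src HL l" "\<lambda>l h. src HL l * h"]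
      by (simp add: ten_ker_UNIV mult.assoc)
  qed (simp_all add: distrib_right)
  from tensor_ker_diff[OF y(2) this] show ?thesis
    by (simp add: sw_diff_arg)
qed

end

context right_bialgebroid
begin

abbreviation "\<delta> h \<equiv> rep (\<gamma> HR h)"

lemma mult_rep: "x \<in> \<gamma> HR h \<Longrightarrow> y \<in> \<gamma> HR h' \<Longrightarrow>
    sw x (\<lambda>a b. sw y (\<lambda>a' b'. frag_of (a * a', b * b'))) \<in> \<gamma> HR (h * h')"
  unfolding comult_mult coset_mult_def frag_mult_def
  by (force simp: tensor_ker_zero frag_extend_pair)

lemma one_rep: "frag_of (1, 1) \<in> \<gamma> HR 1"
  by (simp add: comult_one coset_def tensor_ker_zero)

lemma pi_src: "\<pi> HR (h * src HR r) = \<pi> HR h * r" and pi_tgt: "\<pi> HR (h * tgt HR r) = r * \<pi> HR h"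
  using counit_bilinear[where r = 1 and c = h and r' = r] counit_bilinear[where r = r and c = h and r' = 1]
  by (simp_all add: la_one ra_one)

lemma tgt_mul_rep: "sw (\<delta> h) (\<lambda>a b. frag_of (tgt HR r * a, b)) \<in> \<gamma> HR (tgt HR r * h)"
  using mult_rep[OF \<Delta>_left[OF one_rep, of r] rep_\<Delta>] by simp

lemma takeuchi_rep: "sw (\<delta> h) (\<lambda>a b. frag_of (src HR r * a, b))
    - sw (\<delta> h) (\<lambda>a b. frag_of (a, tgt HR r * b)) \<in> K"
proof -
  have "frag_extend (\<lambda>(a, b). frag_of (src HR r * a, b)) (\<delta> h)
      \<in> induced K (\<lambda>(a, b). frag_of (a, tgt HR r * b)) (\<gamma> HR h)"
    unfolding takeuchi[symmetric] by (rule in_induced[OF rep_\<Delta> tensor_ker_zero])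
  then obtain y where y: "y \<in> \<gamma> HR h"
    "sw (\<delta> h) (\<lambda>a b. frag_of (src HR r * a, b)) - sw y (\<lambda>a b. frag_of (a, tgt HR r * b)) \<in> K"
    by (auto simp: induced_def frag_extend_pair)
  have "sw (\<delta> h - y) (\<lambda>a b. frag_of (a, tgt HR r * b)) \<in> K"
  proof (rule tensor_map_ker[OF _ _ _ in_\<Delta>[OF y(1)]])
    show "frag_of (m * src HR s, tgt HR r * n) - frag_of (m, tgt HR r * (n * tgt HR s)) \<in> K" for m s n
      using ten_ker_swap[OF UNIV_I, of "\<lambda>h r. h * src HR r" m s "tgt HR r * n" "\<lambda>r h. h * tgt HR r"]
      by (simp add: ten_ker_UNIV mult.assoc)
  qed (simp_all add: distrib_left)
  from tensor_ker_diff[OF y(2) this] show ?thesis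
    by (simp add: sw_diff_arg)
qed

end

context hopf_algebroid
begin

lemma bialgebroid_pair: "bialgebroid_pair (*) 1 (src HL) (tgt HL) (\<pi> HL) HL.\<delta> (src HR) (tgt HR) (\<pi> HR) HR.\<delta>"
proof
  \<comment> \<open>The mixed laws need each comultiplication to be linear over the other base; this
    holds because values of \<open>s\<^sub>L\<close> are values of \<open>t\<^sub>R\<close>, and
    values of \<open>t\<^sub>R\<close> are values of \<open>s\<^sub>L\<close>.\<close>
  have R_sL: "HR.\<delta> (src HL l * h) - sw (HR.\<delta> h) (\<lambda>a b. frag_of (src HL l * a, b)) \<in> HR.K" for l h
    using HR.in_\<Delta>[OF HR.tgt_mul_rep, of "\<pi> HR (src HL l)" h] by (simp add: tR_sL)
  have L_tR: "HL.\<delta> (h * tgt HR r) - sw (HL.\<delta> h) (\<lambda>a b. frag_of (a * tgt HR r, b)) \<in> HL.K" for r h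
    using HL.in_\<Delta>[OF HL.mul_src_rep, of h "\<pi> HL (tgt HR r)"] by (simp add: sL_tR)
  show "sw (HR.\<delta> h) (\<lambda>a b. sw (HL.\<delta> a) (\<lambda>a1 a2. frag_of (a1, a2, b)))
      - sw (HL.\<delta> h) (\<lambda>a b. sw (HR.\<delta> b) (\<lambda>b1 b2. frag_of (a, b1, b2)))
      \<in> tensor3_ker (right_l HL) (left_l HL) (right_r HR) (left_r HR)" for h
    by (rule coassoc_rep[OF mixed_coassociative_LR HR.rep_\<Delta> HL.comult_in HR.\<Delta>_plus R_sL])
  show "sw (HL.\<delta> h) (\<lambda>a b. sw (HR.\<delta> a) (\<lambda>a1 a2. frag_of (a1, a2, b)))
      - sw (HR.\<delta> h) (\<lambda>a b. sw (HL.\<delta> b) (\<lambda>b1 b2. frag_of (a, b1, b2)))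
      \<in> tensor3_ker (right_r HR) (left_r HR) (right_l HL) (left_l HL)" for h
    by (rule coassoc_rep[OF mixed_coassociative_RL HL.rep_\<Delta> HR.comult_in HL.\<Delta>_plus L_tR])
  show "HL.\<delta> (a * b) - sw (HL.\<delta> a) (\<lambda>a1 a2. sw (HL.\<delta> b) (\<lambda>b1 b2. frag_of (a1 * b1, a2 * b2))) \<in> HL.K" for a b
    by (rule HL.in_\<Delta>[OF HL.mult_rep[OF HL.rep_\<Delta> HL.rep_\<Delta>]])
  show "HR.\<delta> (a * b) - sw (HR.\<delta> b) (\<lambda>b1 b2. sw (HR.\<delta> a) (\<lambda>a1 a2. frag_of (a1 * b1, a2 * b2))) \<in> HR.K" for a b
    by (subst sw_swap) (rule HR.in_\<Delta>[OF HR.mult_rep[OF HR.rep_\<Delta> HR.rep_\<Delta>]])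
  show "sw (HL.\<delta> a) (\<lambda>a1 a2. src HL (\<pi> HL a1) * a2) = a" for a
    using HL.counital_left[OF HL.rep_\<Delta>] by (simp add: sw_def)
  show "sw (HL.\<delta> a) (\<lambda>a1 a2. tgt HL (\<pi> HL a2) * a1) = a" for a
    using HL.counital_right[OF HL.rep_\<Delta>] by (simp add: sw_def)
  show "sw (HR.\<delta> a) (\<lambda>a1 a2. a2 * tgt HR (\<pi> HR a1)) = a" for a
    using HR.counital_left[OF HR.rep_\<Delta>] by (simp add: sw_def)
  show "sw (HR.\<delta> a) (\<lambda>a1 a2. a1 * src HR (\<pi> HR a2)) = a" for a
    using HR.counital_right[OF HR.rep_\<Delta>] by (simp add: sw_def)
qed (fact mult.assoc distrib_left distrib_right mult_1_left mult_1_right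
    HL.s.map_add HL.s.map_mult HL.s.map_one HL.t.map_add HL.t.map_mult HL.t.map_one
    HR.s.map_add HR.s.map_mult HR.s.map_one HR.t.map_add HR.t.map_mult HR.t.map_one
    HL.src_tgt_commute HR.src_tgt_commute sL_tR tL_sR sR_tL tR_sL
    HL.counit_add HR.counit_add HL.pi_src HL.pi_tgt HR.pi_src HR.pi_tgt HL.counit_one HR.counit_one
    HL.counit_src HR.counit_src HL.counit_tgt HR.counit_tgt HL.\<Delta>_plus HR.\<Delta>_plus
    HL.in_\<Delta>[OF HL.one_rep] HR.in_\<Delta>[OF HR.one_rep]
    HL.in_\<Delta>[OF HL.\<Delta>_left[OF HL.rep_\<Delta>]] HR.in_\<Delta>[OF HR.\<Delta>_left[OF HR.rep_\<Delta>]]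
    HL.in_\<Delta>[OF HL.\<Delta>_right[OF HL.rep_\<Delta>]] HR.in_\<Delta>[OF HR.\<Delta>_right[OF HR.rep_\<Delta>]]
    HL.takeuchi_rep HR.takeuchi_rep HL.\<Delta>_coassoc HR.\<Delta>_coassoc)+

lemma hopf:
  assumes "bij S"
  shows "hopf (*) 1 (src HL) (tgt HL) (\<pi> HL) HL.\<delta> (src HR) (tgt HR) (\<pi> HR) HR.\<delta> S (inv S)"
proof -
  interpret bialgebroid_pair "(*)" 1 "src HL" "tgt HL" "\<pi> HL" HL.\<delta> "src HR" "tgt HR" "\<pi> HR" HR.\<delta>
    by (rule bialgebroid_pair)
  show ?thesis
  proof
    show "sw (HL.\<delta> a) (\<lambda>a1 a2. S a1 * a2) = src HR (\<pi> HR a)" for a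
      using antipode_left[OF HL.rep_\<Delta>] by (simp add: sw_def)
    show "sw (HR.\<delta> a) (\<lambda>a1 a2. a1 * S a2) = src HL (\<pi> HL a)" for a
      using antipode_right[OF HR.rep_\<Delta>] by (simp add: sw_def)
    show "inv S (S a) = a" "S (inv S a) = a" for a
      using assms by (simp_all add: bij_is_inj bij_is_surj surj_f_inv_f)
  qed (fact antipode_add antipode_tL antipode_tR)+
qed

lemma fgp_hopf:
  assumes "bij S" "fin_gen_projective_hopf_algebroid HL HR"
  obtains IL IR :: "'h set" and bL bR :: "'h \<Rightarrow> 'h" and \<beta>L :: "'h \<Rightarrow> 'h \<Rightarrow> 'l" and \<beta>R :: "'h \<Rightarrow> 'h \<Rightarrow> 'r"
  where "fgp_hopf (*) 1 (src HL) (tgt HL) (\<pi> HL) HL.\<delta> (src HR) (tgt HR) (\<pi> HR) HR.\<delta>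
    S (inv S) IL IR bL bR \<beta>L \<beta>R"
proof -
  interpret hopf "(*)" 1 "src HL" "tgt HL" "\<pi> HL" HL.\<delta> "src HR" "tgt HR" "\<pi> HR" HR.\<delta> S "inv S"
    by (rule hopf[OF assms(1)])
  have fg: "finitely_generated UNIV (left_l HL)" "finitely_generated UNIV (left_r HR)"
    and proj: "projective UNIV (*) (left_l HL)" "projective UNIV (*) (left_r HR)"
    using assms(2) by (simp_all add: fin_gen_projective_hopf_algebroid_def left_projective_def)
  show thesis
  proof (rule finite_dual_basis[OF fg(1) proj(1)])
    fix IL :: "'h set" and bL :: "'h \<Rightarrow> 'h" and \<beta>L :: "'h \<Rightarrow> 'h \<Rightarrow> 'l"
    assume L: "\<And>y m m'. \<beta>L y (m + m') = \<beta>L y m + \<beta>L y m'"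
      "\<And>y l m. \<beta>L y (src HL l * m) = l * \<beta>L y m" "\<And>m. (\<Sum>y\<in>IL. src HL (\<beta>L y m) * bL y) = m"
    show thesis
    proof (rule finite_dual_basis[OF fg(2) proj(2)])
      fix IR :: "'h set" and bR :: "'h \<Rightarrow> 'h" and \<beta>R :: "'h \<Rightarrow> 'h \<Rightarrow> 'r"
      assume R: "\<And>y m m'. \<beta>R y (m + m') = \<beta>R y m + \<beta>R y m'"
        "\<And>y r m. \<beta>R y (m * tgt HR r) = r * \<beta>R y m" "\<And>m. (\<Sum>y\<in>IR. bR y * tgt HR (\<beta>R y m)) = m"
      have "fgp_hopf (*) 1 (src HL) (tgt HL) (\<pi> HL) HL.\<delta> (src HR) (tgt HR) (\<pi> HR) HR.\<delta>
          S (inv S) IL IR bL bR \<beta>L \<beta>R"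
        by unfold_locales (fact L R)+
      then show thesis by (rule that)
    qed
  qed
qed

end

section \<open>Representatives for the coactions of a comodule algebra\<close>

context comodule_algebra_R
begin

lemma ract_eq: "ract AR a r = a * ract AR 1 r"
  using A.mult_ra[of a 1 r] by simp

lemma lact_eq: "lact_R HR AR r a = ract AR 1 r * a"
  using A.mult_balanced[of 1 r a] by simp

lemma one_rep: "frag_of (1, 1) \<in> coact AR 1"
  by (simp add: coact_one coset_def tensor_ker_zero)

lemma mult_rep: "sw (rep (coact AR a)) (\<lambda>a0 a1. sw (rep (coact AR b)) (\<lambda>b0 b1. frag_of (a0 * b0, a1 * b1)))
    \<in> coact AR (a * b)"
  unfolding coact_mult coset_mult_def frag_mult_def
  using rep_\<tau>[of a] rep_\<tau>[of b] by (force simp: tensor_ker_zero frag_extend_pair)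

end

context comodule_algebra_L
begin

lemma one_rep: "frag_of (1, 1) \<in> coact AL 1"
  by (simp add: coact_one coset_def tensor_ker_zero)

lemma mult_rep: "sw (rep (coact AL a)) (\<lambda>a0 a1. sw (rep (coact AL b)) (\<lambda>b0 b1. frag_of (a0 * b0, a1 * b1)))
    \<in> coact AL (a * b)"
  unfolding coact_mult coset_mult_def frag_mult_def
  using rep_\<tau>[of a] rep_\<tau>[of b] by (force simp: tensor_ker_zero frag_extend_pair)

end

lemma comod_alg:
  assumes H: "hopf_algebroid kH kL kR HL HR S" and "bij S" "fin_gen_projective_hopf_algebroid HL HR"
    and A: "comodule_algebra kH kL kR HL HR kA AL AR"
  obtains IL IR :: "'h::{ring,monoid_mult} set" and bL bR :: "'h \<Rightarrow> 'h" and \<beta>L \<beta>R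
  where "comod_alg (*) 1 (src HL) (tgt HL) (\<pi> HL) (\<lambda>h. rep (\<gamma> HL h)) (src HR) (tgt HR) (\<pi> HR) (\<lambda>h. rep (\<gamma> HR h))
    S (inv S) IL IR bL bR \<beta>L \<beta>R (*) 1 (ract AL 1) (ract AR 1) (\<lambda>a. rep (coact AL a)) (\<lambda>a. rep (coact AR a))"
proof -
  interpret H: hopf_algebroid kH kL kR HL HR S by (rule H)
  interpret A: comodule_algebra kH kL kR HL HR kA AL AR by (rule A)
  show thesis
  proof (rule H.fgp_hopf[OF assms(2,3)])
    fix IL IR bL bR \<beta>L \<beta>R
    assume fgp: "fgp_hopf (*) 1 (src HL) (tgt HL) (\<pi> HL) H.HL.\<delta> (src HR) (tgt HR) (\<pi> HR) H.HR.\<delta>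
        S (inv S) IL IR bL bR \<beta>L \<beta>R"
    interpret F: fgp_hopf "(*)" 1 "src HL" "tgt HL" "\<pi> HL" H.HL.\<delta> "src HR" "tgt HR" "\<pi> HR" H.HR.\<delta>
        S "inv S" IL IR bL bR \<beta>L \<beta>R by (rule fgp)
    have ractR: "(\<lambda>a r. a * ract AR 1 r) = ract AR"
      by (intro ext) (rule A.AR.ract_eq[symmetric])
    have ractL: "(\<lambda>a l. ract AL 1 l * a) = ract AL"
      by (intro ext) (rule A.AL.ract_one[symmetric])
    \<comment> \<open>Compatibility of the actions at \<open>m = 1\<close>, with \<open>1\<close> as
      the scalar acting from the left.\<close>
    have eL_eq: "ract AR 1 (\<pi> HR (tgt HL l)) = ract AL 1 l" for l
      using A.actions_compatible[of 1 1 l]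
      by (simp add: A.AL.lact_one A.L.M.ra_one H.HL.t.map_one H.HR.counit_one A.R.M.ra_one A.AR.lact_eq)
    have R_sL: "H.HR.\<delta> (src HL l * h) - sw (H.HR.\<delta> h) (\<lambda>a b. frag_of (src HL l * a, b)) \<in> H.HR.K" for l h
      using H.HR.in_\<Delta>[OF H.HR.tgt_mul_rep, of "\<pi> HR (src HL l)" h] by (simp add: H.tR_sL)
    have L_tR: "H.HL.\<delta> (h * tgt HR r) - sw (H.HL.\<delta> h) (\<lambda>a b. frag_of (a * tgt HR r, b)) \<in> H.HL.K" for r h
      using H.HL.in_\<Delta>[OF H.HL.mul_src_rep, of h "\<pi> HL (tgt HR r)"] by (simp add: H.sL_tR)
    have "comod_alg (*) 1 (src HL) (tgt HL) (\<pi> HL) H.HL.\<delta> (src HR) (tgt HR) (\<pi> HR) H.HR.\<delta>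
      S (inv S) IL IR bL bR \<beta>L \<beta>R (*) 1 (ract AL 1) (ract AR 1) (\<lambda>a. rep (coact AL a)) (\<lambda>a. rep (coact AR a))"
    proof (rule comod_alg.intro[OF fgp], rule comod_alg_axioms.intro,
        unfold ractR ractL A.AL.ract_one[symmetric] A.AR.ract_eq[symmetric])
      show "ract AL 1 (\<pi> HL (src HR r)) = ract AR 1 r" for r
        by (simp add: H.tL_sR F.piR_sR flip: eL_eq)
      show "ract AL 1 (l * l') = ract AL (ract AL 1 l) l'" for l l'
        by (rule A.L.M.ra_ra)
      show "ract AR 1 (r * r') = ract AR (ract AR 1 r) r'" for r r'
        by (rule A.R.M.ra_ra)
      show "rep (coact AL (a * b)) - sw (rep (coact AL b)) (\<lambda>b0 b1. sw (rep (coact AL a)) (\<lambda>a0 a1.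
          frag_of (a0 * b0, a1 * b1))) \<in> ker_L HL AL" for a b
        by (subst sw_swap) (rule A.L.in_\<tau>[OF A.AL.mult_rep])
      show "rep (coact AR (a * b)) - sw (rep (coact AR a)) (\<lambda>a0 a1. sw (rep (coact AR b)) (\<lambda>b0 b1.
          frag_of (a0 * b0, a1 * b1))) \<in> ker_R HR AR" for a b
        by (rule A.R.in_\<tau>[OF A.AR.mult_rep])
      \<comment> \<open>The left action is defined with \<open>s\<^sub>L(l)\<close>. Under
        \<open>\<pi>\<^sub>L\<close> the counit axioms identify it with \<open>t\<^sub>L(l)\<close>,
        the form that mirrors the rule for \<open>R\<close>.\<close>
      show "sw (rep (coact AL a)) (\<lambda>a0 a1. ract AL a0 (\<pi> HL (a1 * tgt HL l))) = a * ract AL 1 l" for a l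
        using H.HL.counit_tgt[of _ "src HL l"] H.HL.counit_src[of _ "src HL l"]
        by (simp add: F.piL_sL lact_L_def sw_def flip: A.AL.lact_one)
      show "sw (rep (coact AR a)) (\<lambda>a0 a1. ract AR a0 (\<pi> HR (src HR r * a1))) = ract AR 1 r * a" for a r
        by (simp add: lact_R_def sw_def flip: A.AR.lact_eq)
      show "sw (rep (coact AL a)) (\<lambda>a0 a1. ract AL a0 (\<pi> HL a1)) = a" for a
        using A.L.coact_counital[OF A.L.rep_\<tau>] by (simp add: sw_def)
      show "sw (rep (coact AR a)) (\<lambda>a0 a1. ract AR a0 (\<pi> HR a1)) = a" for a
        using A.R.coact_counital[OF A.R.rep_\<tau>] by (simp add: sw_def)
      show "sw (rep (coact AR a)) (\<lambda>b c. sw (rep (coact AL b)) (\<lambda>b0 b1. frag_of (b0, b1, c)))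
        - sw (rep (coact AL a)) (\<lambda>b c. sw (H.HR.\<delta> c) (\<lambda>c1 c2. frag_of (b, c1, c2)))
        \<in> tensor3_ker (ract AL) (left_l HL) (right_r HR) (left_r HR)" for a
        by (rule coassoc_rep[OF A.coactions_LR A.R.rep_\<tau> A.L.coact_in H.HR.\<Delta>_plus R_sL])
      show "sw (rep (coact AL a)) (\<lambda>b c. sw (rep (coact AR b)) (\<lambda>b0 b1. frag_of (b0, b1, c)))
        - sw (rep (coact AR a)) (\<lambda>b c. sw (H.HL.\<delta> c) (\<lambda>c1 c2. frag_of (b, c1, c2)))
        \<in> tensor3_ker (ract AR) (left_r HR) (right_l HL) (left_l HL)" for a
        by (rule coassoc_rep[OF A.coactions_RL A.L.rep_\<tau> A.R.coact_in H.HL.\<Delta>_plus L_tR])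
    qed (fact mult.assoc distrib_left distrib_right mult_1_left mult_1_right
        A.L.M.ra_add_right A.R.M.ra_add_right A.L.M.ra_one A.R.M.ra_one eL_eq A.L.\<tau>_plus A.R.\<tau>_plus
        A.L.in_\<tau>[OF A.AL.one_rep] A.R.in_\<tau>[OF A.AR.one_rep] A.L.\<tau>_right A.R.\<tau>_right
        A.L.\<tau>_coassoc A.R.\<tau>_coassoc)+
    then show thesis by (rule that)
  qed
qed

section \<open>Maps induced on quotients by subgroups\<close>

definition diff_closed :: "'x frag set \<Rightarrow> bool" where
  "diff_closed K \<longleftrightarrow> 0 \<in> K \<and> (\<forall>x\<in>K. \<forall>y\<in>K. x - y \<in> K)"

lemma diff_closed_zero: "diff_closed K \<Longrightarrow> 0 \<in> K"
  and diff_closed_diff: "diff_closed K \<Longrightarrow> x \<in> K \<Longrightarrow> y \<in> K \<Longrightarrow> x - y \<in> K"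
  by (auto simp: diff_closed_def)

lemma diff_closed_minus: "diff_closed K \<Longrightarrow> x \<in> K \<Longrightarrow> - x \<in> K"
  using diff_closed_diff[of K 0 x] diff_closed_zero by fastforce

lemma diff_closed_add: "diff_closed K \<Longrightarrow> x \<in> K \<Longrightarrow> y \<in> K \<Longrightarrow> x + y \<in> K"
  using diff_closed_diff[of K x "- y"] diff_closed_minus[of K y] by simp

lemma diff_closed_commute: "diff_closed K \<Longrightarrow> x - y \<in> K \<Longrightarrow> y - x \<in> K"
  using diff_closed_minus[of K "x - y"] by simp

lemma diff_closed_trans: "diff_closed K \<Longrightarrow> x - y \<in> K \<Longrightarrow> y - z \<in> K \<Longrightarrow> x - z \<in> K"
  using diff_closed_add[of K "x - y" "y - z"] by simp

lemma diff_closed_tensor_ker_on: "diff_closed (tensor_ker_on M addM N addN B ra la)"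
  unfolding diff_closed_def tensor_ker_on_def by (auto intro: group_closure.diff)

lemma diff_closed_tensor_ker: "diff_closed (tensor_ker ra la)"
  unfolding tensor_ker_def by (rule diff_closed_tensor_ker_on)

lemma diff_closed_tensor3_ker: "diff_closed (tensor3_ker raM laN raN laP)"
  unfolding diff_closed_def tensor3_ker_def by (auto intro: group_closure.diff)

lemma diff_closed_sw:
  fixes x :: "('m \<times> 'n) frag"
  assumes K: "diff_closed K" and f: "\<And>a b. (a, b) \<in> Poly_Mapping.keys x \<Longrightarrow> f a b \<in> K"
  shows "sw x f \<in> K"
proof -
  have sum: "(\<Sum>i\<in>I. g i) \<in> K" if "\<And>i. i \<in> I \<Longrightarrow> g i \<in> K" for I :: "('m \<times> 'n) set" and g
    using that by (induction I rule: infinite_finite_induct)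
      (auto intro: diff_closed_add[OF K] diff_closed_zero[OF K])
  have nat: "(\<Sum>_<n. z) \<in> K" if "z \<in> K" for n :: nat and z
    using that by (induction n) (auto intro: diff_closed_add[OF K] diff_closed_zero[OF K])
  have "int_mult k z \<in> K" if "z \<in> K" for k z
    using nat[OF that] diff_closed_diff[OF K] by (simp add: int_mult_def)
  then show ?thesis
    unfolding sw_def evaluate_def by (rule sum) (use f in auto)
qed

lemma coset_eq_iff: "diff_closed K \<Longrightarrow> coset K x = coset K y \<longleftrightarrow> x - y \<in> K"
proof
  assume K: "diff_closed K"
  assume eq: "coset K x = coset K y"
  have "x \<in> coset K x" by (simp add: coset_def diff_closed_zero[OF K])
  then show "x - y \<in> K" unfolding eq by (simp add: coset_def)
next
  assume "diff_closed K" "x - y \<in> K"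
  then show "coset K x = coset K y"
    using diff_closed_trans[of K _ x y] diff_closed_trans[of K _ y x] diff_closed_commute[of K x y]
    by (auto simp: coset_def)
qed

lemma coset_self: "diff_closed K \<Longrightarrow> x \<in> coset K x"
  by (simp add: coset_def diff_closed_zero)

lemma coset_add_coset:
  assumes K: "diff_closed K" shows "coset_add (coset K x) (coset K y) = coset K (x + y)"
proof (intro equalityI subsetI)
  fix z assume "z \<in> coset_add (coset K x) (coset K y)"
  then obtain u v where "z = u + v" "u - x \<in> K" "v - y \<in> K"
    by (auto simp: coset_add_def coset_def)
  then show "z \<in> coset K (x + y)"
    using diff_closed_add[OF K, of "u - x" "v - y"] by (simp add: coset_def algebra_simps)
next
  fix z assume "z \<in> coset K (x + y)"
  then have "z = (z - y) + y" "z - y \<in> coset K x" "y \<in> coset K y"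
    by (simp_all add: coset_def algebra_simps diff_closed_zero[OF K])
  then show "z \<in> coset_add (coset K x) (coset K y)"
    unfolding coset_add_def by blast
qed

lemma induced_coset:
  assumes K: "diff_closed K" and K': "diff_closed K'" and f: "\<And>z. z \<in> K' \<Longrightarrow> frag_extend f z \<in> K"
  shows "induced K f (coset K' x) = coset K (frag_extend f x)"
proof (intro equalityI subsetI)
  fix y assume "y \<in> induced K f (coset K' x)"
  then obtain z where "z - x \<in> K'" "y - frag_extend f z \<in> K"
    by (auto simp: induced_def coset_def)
  then show "y \<in> coset K (frag_extend f x)"
    using f[of "z - x"] diff_closed_trans[OF K, of y "frag_extend f z" "frag_extend f x"]
    by (simp add: coset_def frag_extend_diff)
next
  fix y assume "y \<in> coset K (frag_extend f x)"
  then show "y \<in> induced K f (coset K' x)"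
    using coset_self[OF K', of x] unfolding induced_def by (auto simp: coset_def[of K])
qed

lemma sw_expansion: "sw x (\<lambda>a b. frag_of (a, b)) = x"
  using frag_expansion[of x] by (simp add: sw_def split_def frag_extend_eq_evaluate)

lemma induced_frag_of_coset:
  assumes "diff_closed K" "diff_closed K'" "K' \<subseteq> K"
  shows "induced K frag_of (coset K' x) = coset K x"
  using induced_coset[OF assms(1,2), of frag_of x] assms(3) by (auto simp flip: frag_expansion)

lemma tensor_ker_on_map:
  assumes K: "diff_closed K" and z: "z \<in> tensor_ker_on M addM N addN B ra la"
    and "\<And>m m' n. m \<in> M \<Longrightarrow> m' \<in> M \<Longrightarrow> n \<in> N \<Longrightarrow> F (addM m m') n - F m n - F m' n \<in> K"
    and "\<And>m n n'. m \<in> M \<Longrightarrow> n \<in> N \<Longrightarrow> n' \<in> N \<Longrightarrow> F m (addN n n') - F m n - F m n' \<in> K"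
    and "\<And>m s n. m \<in> M \<Longrightarrow> s \<in> B \<Longrightarrow> n \<in> N \<Longrightarrow> F (ra m s) n - F m (la s n) \<in> K"
  shows "sw z F \<in> K"
  using z[unfolded tensor_ker_on_def]
proof (induction z rule: group_closure.induct)
  case (base z)
  then show ?case using assms by (auto simp: sw_diff_arg diff_closed_zero[OF K])
qed (simp add: sw_diff_arg diff_closed_diff[OF K])

lemma ker_on_gens:
  shows ker_on_left: "m \<in> M \<Longrightarrow> m' \<in> M \<Longrightarrow> n \<in> N \<Longrightarrow>
      frag_of (addM m m', n) - frag_of (m, n) - frag_of (m', n) \<in> tensor_ker_on M addM N addN B ra la"
    and ker_on_right: "m \<in> M \<Longrightarrow> n \<in> N \<Longrightarrow> n' \<in> N \<Longrightarrow>
      frag_of (m, addN n n') - frag_of (m, n) - frag_of (m, n') \<in> tensor_ker_on M addM N addN B ra la"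
    and ker_on_swap: "m \<in> M \<Longrightarrow> s \<in> B \<Longrightarrow> n \<in> N \<Longrightarrow>
      frag_of (ra m s, n) - frag_of (m, la s n) \<in> tensor_ker_on M addM N addN B ra la"
  unfolding tensor_ker_on_def by (rule group_closure.base; blast)+

lemma bij_betw_induced:
  assumes K: "diff_closed K" and K': "diff_closed K'" and f: "\<And>z. z \<in> K' \<Longrightarrow> frag_extend f z \<in> K"
  shows bij_betw_induced_iff: "bij_betw (induced K f) (range (coset K')) (range (coset K)) \<longleftrightarrow>
      (\<forall>x. frag_extend f x \<in> K \<longrightarrow> x \<in> K') \<and> (\<forall>w. \<exists>x. frag_extend f x - w \<in> K)"
    and image_induced_iff: "induced K f ` range (coset K') = range (coset K) \<longleftrightarrow>
      (\<forall>w. \<exists>x. frag_extend f x - w \<in> K)"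
proof -
  note ind = induced_coset[OF K K' f]
  have inj: "inj_on (induced K f) (range (coset K')) \<longleftrightarrow> (\<forall>x. frag_extend f x \<in> K \<longrightarrow> x \<in> K')"
  proof
    assume inj: "inj_on (induced K f) (range (coset K'))"
    show "\<forall>x. frag_extend f x \<in> K \<longrightarrow> x \<in> K'"
    proof (intro allI impI)
      fix x assume "frag_extend f x \<in> K"
      then have "induced K f (coset K' x) = induced K f (coset K' 0)"
        by (simp add: ind coset_eq_iff[OF K])
      then have "coset K' x = coset K' 0" using inj by (auto dest: inj_onD)
      then show "x \<in> K'" by (simp add: coset_eq_iff[OF K'])
    qed
  next
    assume *: "\<forall>x. frag_extend f x \<in> K \<longrightarrow> x \<in> K'"
    show "inj_on (induced K f) (range (coset K'))"
    proof (rule inj_onI, elim rangeE)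
      fix X Y x y
      assume "induced K f X = induced K f Y" "X = coset K' x" "Y = coset K' y"
      then show "X = Y"
        using *[rule_format, of "x - y"] by (simp add: ind coset_eq_iff[OF K] coset_eq_iff[OF K'] frag_extend_diff)
    qed
  qed
  show surj: "induced K f ` range (coset K') = range (coset K) \<longleftrightarrow> (\<forall>w. \<exists>x. frag_extend f x - w \<in> K)"
  proof
    assume *: "induced K f ` range (coset K') = range (coset K)"
    show "\<forall>w. \<exists>x. frag_extend f x - w \<in> K"
    proof
      fix w
      have "coset K w \<in> induced K f ` range (coset K')" unfolding * by simp
      then obtain x where "coset K w = coset K (frag_extend f x)" by (auto simp: ind)
      then show "\<exists>x. frag_extend f x - w \<in> K"
        using coset_eq_iff[OF K, of "frag_extend f x" w] by auto
    qed
  next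
    assume *: "\<forall>w. \<exists>x. frag_extend f x - w \<in> K"
    show "induced K f ` range (coset K') = range (coset K)"
    proof (intro equalityI subsetI; elim imageE rangeE)
      fix X w assume X: "X = coset K w"
      obtain x where "frag_extend f x - w \<in> K" using * by blast
      then have "X = induced K f (coset K' x)" by (simp add: X ind coset_eq_iff[OF K] diff_closed_commute[OF K])
      then show "X \<in> induced K f ` range (coset K')" by blast
    qed (simp add: ind)
  qed
  show "bij_betw (induced K f) (range (coset K')) (range (coset K)) \<longleftrightarrow>
      (\<forall>x. frag_extend f x \<in> K \<longrightarrow> x \<in> K') \<and> (\<forall>w. \<exists>x. frag_extend f x - w \<in> K)"
    by (simp add: bij_betw_def inj surj)
qed

lemma tensor_on_UNIV: "tensor_on UNIV UNIV K = range (coset K)"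
  by (simp add: tensor_on_def)

lemma galois:
  fixes kH :: "'k::{comm_ring,monoid_mult} \<Rightarrow> 'h::{ring,monoid_mult} \<Rightarrow> 'h"
    and AR :: "('a::{ring,monoid_mult}, 'r::{ring,monoid_mult}, 'h) comodule"
  assumes H: "hopf_algebroid kH kL kR HL HR S" and S: "bij S"
    and fgp: "fin_gen_projective_hopf_algebroid HL HR"
    and A: "comodule_algebra kH kL kR HL HR kA AL AR"
    and B: "B = coinvariants_R HR AR"
  shows galois_if_surj: "can_R HR AR ` tensor_B B = tensor_on UNIV UNIV (ker_R HR AR) \<Longrightarrow>
      galois_R HR AR B \<and> galois_L HL AL B"
    and right_projective_if_galois: "galois_R HR AR B \<Longrightarrow> right_projective B (*)"
    and left_projective_if_galois: "galois_L HL AL B \<Longrightarrow> left_projective B (*)"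
proof -
  interpret A: comodule_algebra kH kL kR HL HR kA AL AR by (rule A)
  obtain IL IR bL bR \<beta>L \<beta>R where
    C: "comod_alg (*) 1 (src HL) (tgt HL) (\<pi> HL) (\<lambda>h. rep (\<gamma> HL h)) (src HR) (tgt HR) (\<pi> HR) (\<lambda>h. rep (\<gamma> HR h))
      S (inv S) IL IR bL bR \<beta>L \<beta>R (*) 1 (ract AL 1) (ract AR 1) (\<lambda>a. rep (coact AL a)) (\<lambda>a. rep (coact AR a))"
    by (rule comod_alg[OF H S fgp A]) (rule that)
  interpret C: comod_alg "(*)" 1 "src HL" "tgt HL" "\<pi> HL" "\<lambda>h. rep (\<gamma> HL h)" "src HR" "tgt HR" "\<pi> HR"
    "\<lambda>h. rep (\<gamma> HR h)" S "inv S" IL IR bL bR \<beta>L \<beta>R "(*)" 1 "ract AL 1" "ract AR 1"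
    "\<lambda>a. rep (coact AL a)" "\<lambda>a. rep (coact AR a)"
    by (rule C)
  have ractR: "(\<lambda>a r. a * ract AR 1 r) = ract AR"
    by (intro ext) (rule A.AR.ract_eq[symmetric])
  have ractL: "(\<lambda>a l. ract AL 1 l * a) = ract AL"
    by (intro ext) (rule A.AL.ract_one[symmetric])
  note kerR = diff_closed_tensor_ker[of "ract AR" "left_r HR"]
  note kerL = diff_closed_tensor_ker[of "ract AL" "left_l HL"]
  have "coset (ker_R HR AR) (rep (coact AR a)) = coact AR a" for a
    by (rule tensor_elem_eq[OF A.R.coact_in A.R.rep_\<tau>, symmetric])
  then have "coact AR a = coset (ker_R HR AR) y \<longleftrightarrow> rep (coact AR a) - y \<in> ker_R HR AR" for a y
    using coset_eq_iff[OF kerR, of "rep (coact AR a)" y] by simp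
  then have B_eq: "B = {b. C.coinvR b}"
    unfolding B coinvariants_R_def C.coinvR_def ractR by simp
  let ?KB = "ten_ker B (*) (*)"
  note kerB = diff_closed_tensor_ker_on[of UNIV "(+)" UNIV "(+)" B "(*)" "(*)"]
  define cR where "cR = (\<lambda>(a, a'). frag_extend (\<lambda>(c, h). frag_of (a * c, h)) (rep (coact AR a')))"
  define cL where "cL = (\<lambda>(a, a'). frag_extend (\<lambda>(c, h). frag_of (c * a', h)) (rep (coact AL a)))"
  have can_R: "can_R HR AR = induced (ker_R HR AR) cR" and can_L: "can_L HL AL = induced (ker_L HL AL) cL"
    by (simp_all add: can_R_def can_L_def cR_def cL_def)
  have cR_sw: "frag_extend cR x = sw x (\<lambda>a a'. sw (rep (coact AR a')) (\<lambda>c h. frag_of (a * c, h)))" for x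
    by (simp add: cR_def frag_extend_pair)
  have cL_sw: "frag_extend cL x = sw x (\<lambda>a a'. sw (rep (coact AL a)) (\<lambda>c h. frag_of (c * a', h)))" for x
    by (simp add: cL_def frag_extend_pair)
  \<comment> \<open>\<open>canR_ker\<close> speaks of test maps; the coordinates of
    \<open>kerR_separation\<close> turn it into membership in the kernel.\<close>
  have ker_cR: "frag_extend cR z \<in> ker_R HR AR" if "z \<in> ?KB" for z
    using C.kerR_separation[of "frag_extend cR z" 0] C.canR_ker[OF C.balAR_\<beta>] that
    unfolding ractR by (simp add: cR_sw sw_sw B_eq)
  have ker_cL: "frag_extend cL z \<in> ker_L HL AL" if "z \<in> ?KB" for z
  proof -
    have "frag_extend cL z - 0 \<in> ker_L HL AL"
    proof (rule C.kerL_separation[unfolded ractL])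
      fix f :: "'a \<Rightarrow> 'h \<Rightarrow> 'a" assume "balanced (ract AL) (left_l HL) f"
      from C.canL_ker[unfolded ractL, OF this that[unfolded B_eq]]
      show "sw (frag_extend cL z) f = sw 0 f" by (simp add: cL_sw sw_sw)
    qed
    then show ?thesis by simp
  qed
  have tensor_B: "tensor_B B = range (coset ?KB)"
    by (simp add: tensor_B_def tensor_on_UNIV)
  have R_iff: "bij_betw (induced (ker_R HR AR) cR) (range (coset ?KB)) (range (coset (ker_R HR AR))) \<longleftrightarrow>
      (\<forall>x. frag_extend cR x \<in> ker_R HR AR \<longrightarrow> x \<in> ?KB)
      \<and> (\<forall>w. \<exists>x. frag_extend cR x - w \<in> ker_R HR AR)"
    by (rule bij_betw_induced_iff[OF kerR kerB ker_cR])
  have L_iff: "bij_betw (induced (ker_L HL AL) cL) (range (coset ?KB)) (range (coset (ker_L HL AL))) \<longleftrightarrow>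
      (\<forall>x. frag_extend cL x \<in> ker_L HL AL \<longrightarrow> x \<in> ?KB)
      \<and> (\<forall>w. \<exists>x. frag_extend cL x - w \<in> ker_L HL AL)"
    by (rule bij_betw_induced_iff[OF kerL kerB ker_cL])
  have surjR: "C.surjR" if "\<forall>w. \<exists>x. frag_extend cR x - w \<in> ker_R HR AR"
    using that by (simp add: C.surjR_def ractR cR_sw)
  show "galois_R HR AR B \<and> galois_L HL AL B"
    if "can_R HR AR ` tensor_B B = tensor_on UNIV UNIV (ker_R HR AR)"
  proof -
    have surj: "\<forall>w. \<exists>x. frag_extend cR x - w \<in> ker_R HR AR"
      by (rule image_induced_iff[OF kerR kerB ker_cR, THEN iffD1])
        (use that in \<open>simp_all only: can_R tensor_B tensor_on_UNIV\<close>)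
    have surj': "\<forall>w. \<exists>x. frag_extend cL x - w \<in> ker_L HL AL"
      using C.canL_surj[unfolded ractR ractL, folded cR_sw cL_sw] surj by blast
    have inj': "x \<in> ?KB" if "\<And>f::'a \<Rightarrow> 'h \<Rightarrow> 'a. C.balAL f \<Longrightarrow> sw (frag_extend cL x) f = 0" for x
      unfolding B_eq by (rule C.canL_inj[OF surjR[OF surj]]) (use that in \<open>simp add: cL_sw sw_sw\<close>)
    have injL: "\<forall>x. frag_extend cL x \<in> ker_L HL AL \<longrightarrow> x \<in> ?KB"
      using inj' sw_tensor_ker unfolding ractL by blast
    \<comment> \<open>\<open>can\<^sub>L\<close> factors through \<open>can\<^sub>R\<close>, so
      elements killed by \<open>can\<^sub>R\<close> are killed by \<open>can\<^sub>L\<close>, whose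
      injectivity is already known.\<close>
    have injR: "\<forall>x. frag_extend cR x \<in> ker_R HR AR \<longrightarrow> x \<in> ?KB"
    proof (intro allI impI)
      fix x assume x: "frag_extend cR x \<in> ker_R HR AR"
      have "sw x (\<lambda>a a'. sw (rep (coact AR a')) (\<lambda>c h. f (a * c) h)) = 0"
        if "C.balAR f" for f :: "'a \<Rightarrow> 'h \<Rightarrow> 'a"
        using sw_tensor_ker[OF that[unfolded ractR] x] by (simp add: cR_sw sw_sw)
      from C.canR_zero_imp_canL_zero[OF this] show "x \<in> ?KB"
        by (intro inj') (simp add: cL_sw sw_sw)
    qed
    show ?thesis
      unfolding galois_R_def galois_L_def can_R can_L tensor_B tensor_on_UNIV R_iff L_iff
      using surj surj' injR injL by blast
  qed
  show "right_projective B (*)" if "galois_R HR AR B"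
  proof -
    have "C.surjR"
      using that unfolding galois_R_def can_R tensor_B tensor_on_UNIV R_iff by (blast intro: surjR)
    from C.projective_right[OF this] show ?thesis by (simp add: right_projective_def B_eq)
  qed
  show "left_projective B (*)" if "galois_L HL AL B"
  proof -
    have surj: "\<exists>x. frag_extend cL x - w \<in> ker_L HL AL" for w
      using that unfolding galois_L_def can_L tensor_B tensor_on_UNIV L_iff by blast
    have "C.surjL"
      unfolding C.surjL_def ractL
    proof
      fix h
      obtain x where x: "frag_extend cL x - frag_of (1, h) \<in> ker_L HL AL" using surj by blast
      \<comment> \<open>The flip accounts for the opposite order of the factors in
        \<open>surjL\<close>.\<close>
      have "frag_extend cL x = sw (sw x (\<lambda>a b. frag_of (b, a)))
          (\<lambda>u v. sw (rep (coact AL v)) (\<lambda>c k. frag_of (c * u, k)))"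
        by (simp add: cL_sw sw_sw)
      with x show "\<exists>y. sw y (\<lambda>u v. sw (rep (coact AL v)) (\<lambda>c k. frag_of (c * u, k))) - frag_of (1, h)
          \<in> ker_L HL AL" by (intro exI[of _ "sw x (\<lambda>a b. frag_of (b, a))"]) simp
    qed
    from C.projective_left[OF this] show ?thesis by (simp add: left_projective_def B_eq)
  qed
qed

section \<open>Coinvariants of \<open>A \<otimes>\<^sub>k A\<close> for flat \<open>A\<close>\<close>

lemma tensor_ker_on_mono:
  assumes "N \<subseteq> N'"
  shows "tensor_ker_on UNIV addM N addN B ra la \<subseteq> tensor_ker_on UNIV addM N' addN B ra la"
proof
  fix z assume z: "z \<in> tensor_ker_on UNIV addM N addN B ra la"
  have "sw z (\<lambda>a b. frag_of (a, b)) \<in> tensor_ker_on UNIV addM N' addN B ra la"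
    by (rule tensor_ker_on_map[OF diff_closed_tensor_ker_on z]) (use assms in \<open>auto intro!: ker_on_gens\<close>)
  then show "z \<in> tensor_ker_on UNIV addM N' addN B ra la" by (simp add: sw_expansion)
qed

lemma keys_sw: "Poly_Mapping.keys (sw x (\<lambda>a b. frag_of (f a b))) \<subseteq> (\<lambda>(a, b). f a b) ` Poly_Mapping.keys x"
  using keys_frag_extend[of "\<lambda>p. frag_of (case_prod f p)" x]
  by (auto simp: frag_extend_eq_evaluate sw_def split_def keys_frag_of)

context comodule_algebra_R
begin

abbreviation cls :: "('a \<times> 'h) frag \<Rightarrow> ('a \<times> 'h) frag set" where "cls \<equiv> coset KM"

text \<open>The \<open>k\<close>-module structure of \<open>A \<otimes>\<^sub>R H\<close> on cosets,
  since flatness is applied to modules consisting of cosets.\<close>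

definition scale :: "'k \<Rightarrow> ('a \<times> 'h) frag set \<Rightarrow> ('a \<times> 'h) frag set" where
  "scale c X = induced KM (\<lambda>(a, h). frag_of (kA c a, h)) X"

text \<open>Represents \<open>\<tau>\<^sub>R(a) - a \<otimes> 1\<close>, so that \<open>B\<close>
  becomes the kernel of a \<open>k\<close>-linear map.\<close>

definition defect :: "'a \<Rightarrow> ('a \<times> 'h) frag" where
  "defect a = rep (coact AR a) - frag_of (a, 1)"

lemmas KM_closed = diff_closed_tensor_ker[of "ract AR" "left_r HR"]
lemmas KM_add_left = ten_ker_add_left[where B = UNIV and ra = "ract AR" and la = "left_r HR", folded ten_ker_UNIV]
  and KM_swap = ten_ker_swap[OF UNIV_I, where ra = "ract AR" and la = "left_r HR", folded ten_ker_UNIV]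
  and KM_sw = ten_ker_sw[where B = UNIV and ra = "ract AR" and la = "left_r HR", folded ten_ker_UNIV]

lemma scale_cls: "scale c (cls x) = cls (sw x (\<lambda>a h. frag_of (kA c a, h)))"
proof -
  have "frag_extend (\<lambda>(a, h). frag_of (kA c a, h)) z \<in> KM" if "z \<in> KM" for z
    unfolding frag_extend_pair
    using tensor_map_ker[of "kA c" "\<lambda>h. h" "ract AR" "left_r HR" "ract AR" "left_r HR" z] that KM_swap[of "kA c _"]
    by (simp add: M.sc_add_right flip: M.ra_scale_left)
  from induced_coset[OF KM_closed KM_closed this] show ?thesis
    by (simp add: scale_def frag_extend_pair)
qed

lemma cls_add: "coset_add (cls x) (cls y) = cls (x + y)"
  by (rule coset_add_coset[OF KM_closed])

lemma k_module_on_cosets: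
  assumes Z: "Z \<subseteq> range cls" and "cls 0 \<in> Z" and "\<And>x. cls x \<in> Z \<Longrightarrow> cls (- x) \<in> Z"
    and "\<And>X Y. X \<in> Z \<Longrightarrow> Y \<in> Z \<Longrightarrow> coset_add X Y \<in> Z" and "\<And>c X. X \<in> Z \<Longrightarrow> scale c X \<in> Z"
  shows "k_module_on Z coset_add scale"
proof -
  have plus: "scale (c + d) (cls x) = coset_add (scale c (cls x)) (scale d (cls x))" for c d x
  proof -
    have "sw x (\<lambda>a h. frag_of (kA (c + d) a, h)) - sw x (\<lambda>a h. frag_of (kA c a, h) + frag_of (kA d a, h)) \<in> KM"
      by (rule KM_sw) (use KM_add_left in \<open>simp add: M.sc_add_left diff_diff_eq\<close>)
    then show ?thesis by (simp add: scale_cls cls_add coset_eq_iff[OF KM_closed] sw_add)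
  qed
  have simps: "scale c (coset_add (cls x) (cls y)) = coset_add (scale c (cls x)) (scale c (cls y))"
    "scale (c * d) (cls x) = scale c (scale d (cls x))" "scale 1 (cls x) = cls x" for c d x y
    by (simp_all add: scale_cls cls_add sw_plus_arg sw_sw M.sc_sc M.sc_one sw_expansion)
  have rep: "\<exists>x. X = cls x" if "X \<in> Z" for X
    using that Z by auto
  show ?thesis
    unfolding k_module_on_def
  proof (intro conjI ballI allI)
    show "\<exists>z\<in>Z. \<forall>x\<in>Z. coset_add z x = x \<and> (\<exists>y\<in>Z. coset_add y x = z)"
    proof (rule bexI[of _ "cls 0"], intro ballI conjI)
      fix X assume X: "X \<in> Z"
      then obtain x where x: "X = cls x" using rep by blast
      show "coset_add (cls 0) X = X" by (simp add: x cls_add)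
      show "\<exists>y\<in>Z. coset_add y X = cls 0"
        using assms(3)[of x] X by (auto simp: x cls_add intro!: bexI[of _ "cls (- x)"])
    qed (rule assms)
    show "coset_add X Y \<in> Z" if "X \<in> Z" "Y \<in> Z" for X Y
      using assms(4) that by auto
    show "scale c X \<in> Z" if "X \<in> Z" for X c
      using assms(5) that by auto
    show "coset_add X Y = coset_add Y X" "scale c (coset_add X Y) = coset_add (scale c X) (scale c Y)"
      if "X \<in> Z" "Y \<in> Z" for X Y c
      using rep[OF that(1)] rep[OF that(2)] by (auto simp: cls_add add.commute simps(1)[unfolded cls_add])
    show "coset_add (coset_add W X) Y = coset_add W (coset_add X Y)"
      if "W \<in> Z" "X \<in> Z" "Y \<in> Z" for W X Y
      using rep[OF that(1)] rep[OF that(2)] rep[OF that(3)] by (auto simp: cls_add add.assoc)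
    show "scale (c + d) X = coset_add (scale c X) (scale d X)" "scale (c * d) X = scale c (scale d X)"
      "scale 1 X = X" if "X \<in> Z" for X c d
      using rep[OF that] by (auto simp: plus simps)
  qed
qed

text \<open>Flatness for the inclusion of \<open>Z\<close> into \<open>Z'\<close>: a relation over
  the larger module between tensors from the smaller one already holds over the smaller one.\<close>

lemma flat_tensor_ker:
  assumes flat: "k_flat TYPE(('a \<times> 'h) frag set) kA"
    and Z: "k_module_on Z coset_add scale" "k_module_on Z' coset_add scale" "Z \<subseteq> Z'"
    and x: "Poly_Mapping.keys x \<subseteq> UNIV \<times> Z" "x \<in> k_tensor_ker kA Z' coset_add scale"
  shows "x \<in> k_tensor_ker kA Z coset_add scale"
proof -
  note cl = diff_closed_tensor_ker_on
  let ?i = "induced (k_tensor_ker kA Z' coset_add scale) frag_of"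
  have i: "?i (coset (k_tensor_ker kA Z coset_add scale) y) = coset (k_tensor_ker kA Z' coset_add scale) y" for y
    by (rule induced_frag_of_coset[OF cl cl tensor_ker_on_mono[OF Z(3)]])
  have "inj_on (induced (k_tensor_ker kA Z' coset_add scale) (\<lambda>(a, m). frag_of (a, (\<lambda>m. m) m)))
      (k_tensor kA Z coset_add scale)"
    using flat[unfolded k_flat_def, rule_format, of Z coset_add scale Z' coset_add scale "\<lambda>m. m"] Z by auto
  then have "inj_on ?i (k_tensor kA Z coset_add scale)"
    by (simp add: split_def)
  moreover have "?i (coset (k_tensor_ker kA Z coset_add scale) x) = ?i (coset (k_tensor_ker kA Z coset_add scale) 0)"
    by (simp add: i coset_eq_iff[OF cl] x(2))
  ultimately have "coset (k_tensor_ker kA Z coset_add scale) x = coset (k_tensor_ker kA Z coset_add scale) 0"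
    by (rule inj_onD) (use x(1) in \<open>auto simp: tensor_on_def\<close>)
  then show ?thesis by (simp add: coset_eq_iff[OF cl])
qed

text \<open>A scalar \<open>c\<close> acts on \<open>A\<close> as the element \<open>c 1\<close> of
  \<open>R\<close>, so right \<open>R\<close>-linearity of the coaction applies; on \<open>H\<close>
  this element acts alike through \<open>s\<^sub>R\<close> and \<open>t\<^sub>R\<close>, which
  brings it back to the first leg.\<close>

lemma coact_scale: "rep (coact AR (kA c a)) - sw (rep (coact AR a)) (\<lambda>n h. frag_of (kA c n, h)) \<in> KM"
proof -
  have "sw (rep (coact AR a)) (\<lambda>n h. frag_of (n, h * src HR (kR c 1))) - sw (rep (coact AR a)) (\<lambda>n h. frag_of (kA c n, h)) \<in> KM"
  proof (rule KM_sw)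
    fix n h
    have "h * src HR (kR c 1) = h * tgt HR (kR c 1)"
      using ra_scale_right[where m = h and c = c and r = 1] la_scale_left[where m = h and c = c and r = 1] by (simp add: ra_one la_one)
    moreover have "ract AR n (kR c 1) = kA c n"
      using M.ra_scale_right[where m = n and c = c and r = 1] by (simp add: M.ra_one)
    ultimately show "frag_of (n, h * src HR (kR c 1)) - frag_of (kA c n, h) \<in> KM"
      using diff_closed_commute[OF KM_closed KM_swap[of n "kR c 1" h]] by simp
  qed
  moreover have "ract AR a (kR c 1) = kA c a"
    using M.ra_scale_right[where m = a and c = c and r = 1] by (simp add: M.ra_one)
  ultimately show ?thesis
    using \<tau>_right[of a "kR c 1"] diff_closed_trans[OF KM_closed] by fastforce
qed

lemma defect_plus: "cls (defect (a + b)) = coset_add (cls (defect a)) (cls (defect b))"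
  using diff_closed_diff[OF KM_closed \<tau>_plus[of a b] KM_add_left[of a b 1]]
  by (simp add: cls_add coset_eq_iff[OF KM_closed] defect_def algebra_simps)

lemma defect_scale: "cls (defect (kA c a)) = scale c (cls (defect a))"
  using coact_scale[of c a]
  by (simp add: scale_cls coset_eq_iff[OF KM_closed] defect_def sw_diff_arg)

lemma coinvariant_iff: "a \<in> coinvariants_R HR AR \<longleftrightarrow> cls (defect a) = cls 0"
proof -
  have "cls (rep (coact AR a)) = coact AR a"
    by (rule tensor_elem_eq[OF coact_in rep_\<tau>, symmetric])
  then show ?thesis
    using coset_eq_iff[OF KM_closed, of "rep (coact AR a)" "frag_of (a, 1)"]
    by (simp add: coinvariants_R_def defect_def coset_eq_iff[OF KM_closed])
qed

lemma defect_0: "cls (defect 0) = cls 0"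
proof -
  have "cls (defect 0) = cls (defect 0 + defect 0)"
    using defect_plus[of 0 0] by (simp add: cls_add)
  then show ?thesis
    using diff_closed_minus[OF KM_closed, of "- defect 0"] by (simp add: coset_eq_iff[OF KM_closed])
qed

lemma defect_minus: "cls (defect (- a)) = cls (- defect a)"
proof -
  have "cls (defect (- a) + defect a) = cls 0"
    using defect_plus[of "- a" a] by (simp add: cls_add defect_0)
  then show ?thesis by (simp add: coset_eq_iff[OF KM_closed])
qed

lemma defect_diff: "cls (defect (a - b)) = cls (defect a - defect b)"
  using defect_plus[of a "- b"] defect_minus[of b] by (simp flip: cls_add) (simp add: cls_add)

lemma k_module_on_defects: "k_module_on (range (\<lambda>a. cls (defect a))) coset_add scale"
proof (rule k_module_on_cosets)
  show "cls 0 \<in> range (\<lambda>a. cls (defect a))"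
    using defect_0 by (metis rangeI)
  show "cls (- x) \<in> range (\<lambda>a. cls (defect a))" if x: "cls x \<in> range (\<lambda>a. cls (defect a))" for x
  proof -
    obtain a where "cls x = cls (defect a)" using x by auto
    then have "cls (- x) = cls (defect (- a))"
      using diff_closed_minus[OF KM_closed, of "x - defect a"]
      by (simp add: defect_minus coset_eq_iff[OF KM_closed])
    then show ?thesis by simp
  qed
qed (auto simp flip: defect_plus defect_scale)

lemma k_module_on_all: "k_module_on (range cls) coset_add scale"
  by (rule k_module_on_cosets) (auto simp: cls_add scale_cls)

text \<open>\<open>a \<otimes> h \<mapsto> a \<cdot> \<pi>\<^sub>R(h)\<close> is a left inverse of
  \<open>a \<mapsto> a \<otimes> 1\<close>. Thus \<open>A\<close> has a copy among the
  cosets.\<close>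

lemma cls_one_eq_iff: "cls (frag_of (a, 1)) = cls (frag_of (b, 1)) \<longleftrightarrow> a = b"
proof
  have bal: "balanced (ract AR) (left_r HR) (\<lambda>n h. ract AR n (\<pi> HR h))"
  proof (rule balancedI)
    show "ract AR (ract AR m s) (\<pi> HR n) = ract AR m (\<pi> HR (left_r HR s n))" for m s n
      using counit_bilinear[where r = s and c = n and r' = 1] by (simp add: M.ra_ra ra_one)
  qed (simp_all add: M.ra_add_left M.ra_add_right counit_add)
  have pi_one: "ract AR a (\<pi> HR 1) = a" for a
    using coact_counital[OF one_rep] ract_eq[of a "\<pi> HR 1"] by simp
  assume "cls (frag_of (a, 1)) = cls (frag_of (b, 1))"
  then have "frag_of (a, 1) - frag_of (b, 1) \<in> KM" by (simp add: coset_eq_iff[OF KM_closed])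
  from sw_cong_ker[OF this bal] show "a = b" by (simp add: pi_one)
qed simp

lemma cls_one_plus: "coset_add (cls (frag_of (a, 1))) (cls (frag_of (b, 1))) = cls (frag_of (a + b, 1))"
  using diff_closed_minus[OF KM_closed KM_add_left[of a b 1]]
  by (simp add: cls_add coset_eq_iff[OF KM_closed] algebra_simps)

lemma scale_one: "scale c (cls (frag_of (a, 1))) = cls (frag_of (kA c a, 1))"
  by (simp add: scale_cls)

lemma k_module_on_one:
  assumes B: "0 \<in> B" "\<And>a b. a \<in> B \<Longrightarrow> b \<in> B \<Longrightarrow> a + b \<in> B" "\<And>a. a \<in> B \<Longrightarrow> - a \<in> B"
    "\<And>c a. a \<in> B \<Longrightarrow> kA c a \<in> B"
  shows "k_module_on ((\<lambda>a. cls (frag_of (a, 1))) ` B) coset_add scale"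
proof -
  have zero: "cls (frag_of (0, 1)) = cls 0"
    using diff_closed_minus[OF KM_closed KM_add_left[of 0 0 1]] by (simp add: coset_eq_iff[OF KM_closed])
  have minus: "cls (- frag_of (a, 1)) = cls (frag_of (- a, 1))" for a
    using cls_one_plus[of "- a" a] diff_closed_minus[OF KM_closed, of "frag_of (- a, 1) + frag_of (a, 1)"]
    by (simp add: zero cls_add coset_eq_iff[OF KM_closed] algebra_simps)
  show ?thesis
  proof (rule k_module_on_cosets)
    show "cls 0 \<in> (\<lambda>a. cls (frag_of (a, 1))) ` B"
      using B(1) by (auto simp flip: zero)
    show "cls (- x) \<in> (\<lambda>a. cls (frag_of (a, 1))) ` B" if x: "cls x \<in> (\<lambda>a. cls (frag_of (a, 1))) ` B" for x
    proof -
      obtain a where a: "cls x = cls (frag_of (a, 1))" "a \<in> B" using x by auto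
      then have "cls (- x) = cls (- frag_of (a, 1))"
        using diff_closed_minus[OF KM_closed, of "x - frag_of (a, 1)"]
        by (simp add: coset_eq_iff[OF KM_closed])
      then show ?thesis using B(3)[OF a(2)] by (simp add: minus)
    qed
  qed (auto simp: cls_one_plus scale_one B)
qed

end

lemma tensor3_gens:
  fixes raM laN raN laP
  defines "K \<equiv> tensor3_ker raM laN raN laP"
  shows "frag_of (m + m', n, p) - frag_of (m, n, p) - frag_of (m', n, p) \<in> K"
    and "frag_of (m, n + n', p) - frag_of (m, n, p) - frag_of (m, n', p) \<in> K"
    and "frag_of (m, n, p + p') - frag_of (m, n, p) - frag_of (m, n, p') \<in> K"
    and "frag_of (raM m s, n, p) - frag_of (m, laN s n, p) \<in> K"
    and "frag_of (m, raN n t, p) - frag_of (m, n, laP t p) \<in> K"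
  unfolding K_def tensor3_ker_def by (rule group_closure.base; blast)+

lemma evaluate_tensor3_ker_in:
  assumes K: "diff_closed K" and z: "z \<in> tensor3_ker raM laN raN laP"
    and "\<And>m m' n p. F (m + m') n p - F m n p - F m' n p \<in> K"
    and "\<And>m n n' p. F m (n + n') p - F m n p - F m n' p \<in> K"
    and "\<And>m n p p'. F m n (p + p') - F m n p - F m n p' \<in> K"
    and "\<And>m s n p. F (raM m s) n p - F m (laN s n) p \<in> K"
    and "\<And>m n t p. F m (raN n t) p - F m n (laP t p) \<in> K"
  shows "evaluate (\<lambda>(m, n, p). F m n p) z \<in> K"
  using z[unfolded tensor3_ker_def]
proof (induction z rule: group_closure.induct)
  case (base z)
  then show ?case using assms by (auto simp: evaluate_diff diff_closed_zero[OF K])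
qed (simp add: evaluate_diff diff_closed_diff[OF K])

context comodule_algebra_R
begin

abbreviation B :: "'a set" where "B \<equiv> coinvariants_R HR AR"

abbreviation K2 :: "('a \<times> 'a) frag set" where "K2 \<equiv> k_tensor_ker kA UNIV (+) kA"

abbreviation K3 :: "('a \<times> 'a \<times> 'h) frag set" where
  "K3 \<equiv> tensor3_ker (\<lambda>a c. kA c a) kA (ract AR) (left_r HR)"

definition defect2 :: "('a \<times> 'a) frag \<Rightarrow> ('a \<times> 'a \<times> 'h) frag" where
  "defect2 x = sw x (\<lambda>a a'. sw (defect a') (\<lambda>c h. frag_of (a, c, h)))"

lemma coinvariants_0: "0 \<in> B" and coinvariants_add: "a \<in> B \<Longrightarrow> b \<in> B \<Longrightarrow> a + b \<in> B"
  and coinvariants_minus: "a \<in> B \<Longrightarrow> - a \<in> B" and coinvariants_scale: "a \<in> B \<Longrightarrow> kA c a \<in> B"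
  unfolding coinvariant_iff
  by (simp_all add: defect_0 defect_plus cls_add defect_scale scale_cls)
    (use diff_closed_minus[OF KM_closed] in \<open>simp add: defect_minus coset_eq_iff[OF KM_closed]\<close>)

lemma coinvariants_diff_iff: "a - b \<in> B \<longleftrightarrow> cls (defect a) = cls (defect b)"
  by (simp add: coinvariant_iff defect_diff coset_eq_iff[OF KM_closed])

lemma coset_in_coinvariants_AA: "coset K2 x \<in> coinvariants_AA HR kA AR \<longleftrightarrow> defect2 x \<in> K3"
proof -
  note K2 = diff_closed_tensor_ker_on[of UNIV "(+)" UNIV "(+)" UNIV "\<lambda>a c. kA c a" kA]
  note K3 = diff_closed_tensor3_ker[of "\<lambda>a c. kA c a" kA "ract AR" "left_r HR"]
  have right: "frag_extend (tensor_right (coact AR)) z = sw z (\<lambda>a a'. sw (rep (coact AR a')) (\<lambda>c h. frag_of (a, c, h)))" for z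
    by (simp add: tensor_right_def frag_extend_pair)
  have "induced K3 (tensor_right (coact AR)) (coset K2 x) = coset K3 (frag_extend (tensor_right (coact AR)) x)"
  proof (rule induced_coset[OF K3 K2])
    show "frag_extend (tensor_right (coact AR)) z \<in> K3" if "z \<in> K2" for z
      unfolding right
      by (rule tensor_right_ker[OF \<tau>_plus coact_scale]) (use that in \<open>simp add: tensor_ker_def\<close>)
  qed
  moreover have "induced K3 (\<lambda>(a, a'). frag_of (a, a', 1)) (coset K2 x)
      = coset K3 (frag_extend (\<lambda>(a, a'). frag_of (a, a', 1)) x)"
  proof (rule induced_coset[OF K3 K2])
    show "frag_extend (\<lambda>(a, a'). frag_of (a, a', 1)) z \<in> K3" if "z \<in> K2" for z
      unfolding frag_extend_pair by (rule tensor_ker_on_map[OF K3 that]) (rule tensor3_gens)+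
  qed
  moreover have "frag_extend (tensor_right (coact AR)) x - frag_extend (\<lambda>(a, a'). frag_of (a, a', 1)) x = defect2 x"
    by (simp add: right frag_extend_pair defect2_def defect_def sw_diff_arg sw_diff)
  ultimately show ?thesis
    by (simp add: coinvariants_AA_def tensor_on_UNIV coset_eq_iff[OF K3])
qed

lemma defect2_coinvariants:
  assumes "Poly_Mapping.keys y \<subseteq> UNIV \<times> B" shows "defect2 y \<in> K3"
  unfolding defect2_def
proof (rule diff_closed_sw[OF diff_closed_tensor3_ker])
  fix a b assume "(a, b) \<in> Poly_Mapping.keys y"
  then have "b \<in> B" using assms by auto
  then have b: "defect b \<in> KM" by (simp add: coinvariant_iff coset_eq_iff[OF KM_closed])
  show "sw (defect b) (\<lambda>c h. frag_of (a, c, h)) \<in> K3"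
    by (rule tensor_ker_on_map[OF diff_closed_tensor3_ker b[unfolded tensor_ker_def]]) (rule tensor3_gens)+
qed

text \<open>Flatness for the inclusion of \<open>B\<close> into \<open>A\<close>, transported along
  \<open>a \<mapsto> a \<otimes> 1\<close> into the type of cosets and back along its
  inverse.\<close>

lemma flat_coinvariants_inject:
  assumes flat: "k_flat TYPE(('a \<times> 'h) frag set) kA"
    and y: "Poly_Mapping.keys y \<subseteq> UNIV \<times> B" "y \<in> K2"
  shows "y \<in> k_tensor_ker kA B (+) kA"
proof -
  define i where "i a = cls (frag_of (a, 1))" for a
  have inj: "inj i" using cls_one_eq_iff by (auto simp: inj_def i_def)
  have i_add: "coset_add (i a) (i b) = i (a + b)" and i_scale: "scale c (i a) = i (kA c a)" for a b c
    by (simp_all add: i_def cls_one_plus scale_one)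
  let ?y = "sw y (\<lambda>a b. frag_of (a, i b))"
  have "?y \<in> k_tensor_ker kA (range i) coset_add scale"
  proof (rule tensor_ker_on_map[OF diff_closed_tensor_ker_on y(2)])
    fix m n n' :: 'a
    show "frag_of (m, i (n + n')) - frag_of (m, i n) - frag_of (m, i n') \<in> k_tensor_ker kA (range i) coset_add scale"
      unfolding i_add[symmetric] by (rule ker_on_right) auto
  next
    fix m n :: 'a and s
    show "frag_of (kA s m, i n) - frag_of (m, i (kA s n)) \<in> k_tensor_ker kA (range i) coset_add scale"
      unfolding i_scale[symmetric] by (rule ker_on_swap) auto
  qed (rule ker_on_left, auto)
  moreover have "Poly_Mapping.keys ?y \<subseteq> UNIV \<times> i ` B"
    using keys_sw[of y "\<lambda>a b. (a, i b)"] y(1) by fastforce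
  moreover have "k_module_on (i ` B) coset_add scale" "k_module_on (range i) coset_add scale"
    unfolding i_def
    by (rule k_module_on_one, auto intro: coinvariants_0 coinvariants_add coinvariants_minus coinvariants_scale)+
  ultimately have y': "?y \<in> k_tensor_ker kA (i ` B) coset_add scale"
    using flat_tensor_ker[OF flat, of "i ` B" "range i" ?y] by blast
  have "sw ?y (\<lambda>a X. frag_of (a, inv i X)) \<in> k_tensor_ker kA B (+) kA"
  proof (rule tensor_ker_on_map[OF diff_closed_tensor_ker_on y'])
    fix m X Y assume "X \<in> i ` B" "Y \<in> i ` B"
    then show "frag_of (m, inv i (coset_add X Y)) - frag_of (m, inv i X) - frag_of (m, inv i Y)
        \<in> k_tensor_ker kA B (+) kA"
      by (auto simp: i_add inv_f_f[OF inj] intro!: ker_on_right)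
  next
    fix m X s assume "X \<in> i ` B"
    then show "frag_of (kA s m, inv i X) - frag_of (m, inv i (scale s X)) \<in> k_tensor_ker kA B (+) kA"
      using ker_on_swap[of _ UNIV s UNIV _ B "\<lambda>a c. kA c a" kA "(+)" "(+)"]
      by (auto simp: i_scale inv_f_f[OF inj])
  next
    fix m m' X assume "X \<in> i ` B"
    then show "frag_of (m + m', inv i X) - frag_of (m, inv i X) - frag_of (m', inv i X)
        \<in> k_tensor_ker kA B (+) kA"
      by (auto simp: inv_f_f[OF inj] intro!: ker_on_left)
  qed
  then show ?thesis by (simp add: sw_sw inv_f_f[OF inj] sw_expansion)
qed

text \<open>The map \<open>a \<mapsto> \<tau>\<^sub>R(a) - a \<otimes> 1\<close> is split into a
  surjection \<open>D\<close> onto its image and the inclusion of that image into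
  \<open>A \<otimes>\<^sub>R H\<close>. Flatness disposes of the inclusion; right exactness, proved
  by hand, identifies the kernel for the surjection.\<close>

lemma flat_coinvariants_surject:
  assumes flat: "k_flat TYPE(('a \<times> 'h) frag set) kA" and x: "defect2 x \<in> K3"
  obtains y where "Poly_Mapping.keys y \<subseteq> UNIV \<times> B" "x - y \<in> K2"
proof -
  define D where "D a = cls (defect a)" for a
  have D_add: "coset_add (D a) (D b) = D (a + b)" and D_scale: "scale c (D a) = D (kA c a)" for a b c
    by (simp_all add: D_def defect_plus defect_scale)
  have D_eq: "D a = D b \<longleftrightarrow> a - b \<in> B" for a b
    by (simp add: D_def coinvariants_diff_iff)
  let ?N = "k_tensor_ker kA (range cls) coset_add scale"
  let ?I = "k_tensor_ker kA (range D) coset_add scale"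
  note N = diff_closed_tensor_ker_on[of UNIV "(+)" "range cls" coset_add UNIV "\<lambda>a c. kA c a" scale]
  have N_right: "frag_of (a, cls (x + y)) - frag_of (a, cls x) - frag_of (a, cls y) \<in> ?N" for a x y
    unfolding cls_add[symmetric] by (rule ker_on_right) auto
  have N_sw: "frag_of (a, cls d) - sw d (\<lambda>c h. frag_of (a, cls (frag_of (c, h)))) \<in> ?N" for a d
    using additive_mod_sw[of "\<lambda>z. frag_of (a, cls z)" _ d "\<lambda>c h. frag_of (c, h)",
        OF N_right[unfolded tensor_ker_on_def], folded tensor_ker_on_def]
    by (simp add: sw_expansion)
  \<comment> \<open>Passage from the threefold tensor product formed in one step to
    \<open>A \<otimes>\<^sub>k (A \<otimes>\<^sub>R H)\<close>, the one flatness speaks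
    about.\<close>
  have "evaluate (\<lambda>(a, c, h). frag_of (a, cls (frag_of (c, h)))) (defect2 x) \<in> ?N"
  proof (rule evaluate_tensor3_ker_in[OF N x])
    fix m m' n p
    show "frag_of (m + m', cls (frag_of (n, p))) - frag_of (m, cls (frag_of (n, p)))
        - frag_of (m', cls (frag_of (n, p))) \<in> ?N" by (rule ker_on_left) auto
  next
    fix m n n' p
    have "cls (frag_of (n + n', p)) = cls (frag_of (n, p) + frag_of (n', p))"
      using KM_add_left[of n n' p] by (simp add: coset_eq_iff[OF KM_closed] diff_diff_eq)
    then show "frag_of (m, cls (frag_of (n + n', p))) - frag_of (m, cls (frag_of (n, p)))
        - frag_of (m, cls (frag_of (n', p))) \<in> ?N" using N_right by simp
  next
    fix m n p p'
    have "cls (frag_of (n, p + p')) = cls (frag_of (n, p) + frag_of (n, p'))"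
      using ten_ker_add_right[where B = UNIV, folded ten_ker_UNIV, of n p p' "ract AR" "left_r HR"]
      by (simp add: coset_eq_iff[OF KM_closed] diff_diff_eq)
    then show "frag_of (m, cls (frag_of (n, p + p'))) - frag_of (m, cls (frag_of (n, p)))
        - frag_of (m, cls (frag_of (n, p'))) \<in> ?N" using N_right by simp
  next
    fix m s n p
    have "scale s (cls (frag_of (n, p))) = cls (frag_of (kA s n, p))" by (simp add: scale_cls)
    then show "frag_of (kA s m, cls (frag_of (n, p))) - frag_of (m, cls (frag_of (kA s n, p))) \<in> ?N"
      using ker_on_swap[of m UNIV s UNIV "cls (frag_of (n, p))" "range cls" "\<lambda>a c. kA c a" scale "(+)" coset_add]
      by simp
  next
    fix m n t p
    show "frag_of (m, cls (frag_of (ract AR n t, p))) - frag_of (m, cls (frag_of (n, left_r HR t p))) \<in> ?N"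
      using KM_swap[of n t p] diff_closed_zero[OF N] by (simp add: coset_eq_iff[OF KM_closed, THEN iffD2])
  qed
  moreover have "sw x (\<lambda>a a'. frag_of (a, D a')) - evaluate (\<lambda>(a, c, h). frag_of (a, cls (frag_of (c, h)))) (defect2 x) \<in> ?N"
  proof -
    have "evaluate (\<lambda>(a, c, h). frag_of (a, cls (frag_of (c, h)))) (defect2 x)
        = sw x (\<lambda>a a'. sw (defect a') (\<lambda>c h. frag_of (a, cls (frag_of (c, h)))))"
      by (simp add: defect2_def evaluate_sw)
    moreover have "sw x (\<lambda>a a'. frag_of (a, D a') - sw (defect a') (\<lambda>c h. frag_of (a, cls (frag_of (c, h))))) \<in> ?N"
      unfolding D_def by (rule diff_closed_sw[OF N]) (rule N_sw)
    ultimately show ?thesis by (simp add: sw_diff)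
  qed
  ultimately have xN: "sw x (\<lambda>a a'. frag_of (a, D a')) \<in> ?N"
    using diff_closed_add[OF N] by fastforce
  have "k_module_on (range D) coset_add scale" "range D \<subseteq> range cls"
    using k_module_on_defects by (auto simp: D_def)
  moreover have "Poly_Mapping.keys (sw x (\<lambda>a a'. frag_of (a, D a'))) \<subseteq> UNIV \<times> range D"
    using keys_sw[of x "\<lambda>a a'. (a, D a')"] by auto
  ultimately have xI: "sw x (\<lambda>a a'. frag_of (a, D a')) \<in> ?I"
    using flat_tensor_ker[OF flat _ k_module_on_all _ _ xN] by blast
  note K2 = diff_closed_tensor_ker_on[of UNIV "(+)" UNIV "(+)" UNIV "\<lambda>a c. kA c a" kA]
  \<comment> \<open>The image of \<open>A \<otimes>\<^sub>k B\<close> together with the relations.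
    Any set-theoretic section \<open>s\<close> of \<open>D\<close> is additive and
    \<open>k\<close>-linear up to elements of \<open>B\<close>, so
    \<open>a \<otimes> X \<mapsto> a \<otimes> s(X)\<close> is well defined modulo \<open>Q\<close>
    and inverts the map induced by \<open>D\<close>.\<close>
  define Q where "Q = {z. \<exists>y. Poly_Mapping.keys y \<subseteq> UNIV \<times> B \<and> z - y \<in> K2}"
  have Q: "diff_closed Q"
    unfolding diff_closed_def
  proof (intro conjI ballI)
    show "0 \<in> Q" unfolding Q_def using diff_closed_zero[OF K2] by (auto intro!: exI[of _ 0])
    fix z z' assume "z \<in> Q" "z' \<in> Q"
    then obtain y y' where y: "Poly_Mapping.keys y \<subseteq> UNIV \<times> B" "z - y \<in> K2"
      "Poly_Mapping.keys y' \<subseteq> UNIV \<times> B" "z' - y' \<in> K2" unfolding Q_def by blast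
    have "Poly_Mapping.keys (y - y') \<subseteq> UNIV \<times> B" using keys_diff[of y y'] y by blast
    moreover have "z - z' - (y - y') \<in> K2" using diff_closed_diff[OF K2 y(2,4)] by (simp add: algebra_simps)
    ultimately show "z - z' \<in> Q" unfolding Q_def by blast
  qed
  have K2_Q: "z \<in> Q" if "z \<in> K2" for z
    unfolding Q_def using that by (auto intro!: exI[of _ 0])
  have B_Q: "frag_of (a, b) \<in> Q" if "b \<in> B" for a b
    unfolding Q_def using that diff_closed_zero[OF K2] by (auto intro!: exI[of _ "frag_of (a, b)"] simp: keys_frag_of)
  have diff_Q: "frag_of (a, b) - frag_of (a, b') \<in> Q" if "b - b' \<in> B" for a b b'
  proof -
    have "frag_of (a, (b - b') + b') - frag_of (a, b - b') - frag_of (a, b') \<in> K2"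
      by (rule ker_on_right) auto
    from diff_closed_add[OF Q K2_Q[OF this] B_Q[OF that, of a]] show ?thesis by (simp add: algebra_simps)
  qed
  define s where "s X = (SOME a. D a = X)" for X
  have D_s: "D (s X) = X" if "X \<in> range D" for X
  proof -
    from that obtain a where "D a = X" by blast
    then show ?thesis unfolding s_def by (rule someI)
  qed
  have s_D: "a - s (D a) \<in> B" for a
    using D_s[of "D a"] by (simp flip: D_eq)
  have "sw (sw x (\<lambda>a a'. frag_of (a, D a'))) (\<lambda>a X. frag_of (a, s X)) \<in> Q"
  proof (rule tensor_ker_on_map[OF Q xI])
    fix m m' X
    show "frag_of (m + m', s X) - frag_of (m, s X) - frag_of (m', s X) \<in> Q"
      by (rule K2_Q, rule ker_on_left) auto
  next
    fix m X Y assume XY: "X \<in> range D" "Y \<in> range D"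
    then have "coset_add X Y \<in> range D" by (auto simp: D_add)
    then have "D (s (coset_add X Y)) = D (s X + s Y)"
      using XY by (simp add: D_s flip: D_add)
    then have "frag_of (m, s (coset_add X Y)) - frag_of (m, s X + s Y) \<in> Q"
      by (intro diff_Q) (simp add: D_eq)
    moreover have "frag_of (m, s X + s Y) - frag_of (m, s X) - frag_of (m, s Y) \<in> Q"
      by (rule K2_Q, rule ker_on_right) auto
    ultimately have "(frag_of (m, s (coset_add X Y)) - frag_of (m, s X + s Y))
        + (frag_of (m, s X + s Y) - frag_of (m, s X) - frag_of (m, s Y)) \<in> Q"
      by (rule diff_closed_add[OF Q])
    then show "frag_of (m, s (coset_add X Y)) - frag_of (m, s X) - frag_of (m, s Y) \<in> Q"
      by (simp add: algebra_simps)
  next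
    fix m X c assume X: "X \<in> range D"
    then have "scale c X \<in> range D" by (auto simp: D_scale)
    then have "D (kA c (s X)) = D (s (scale c X))"
      using X by (simp add: D_s flip: D_scale)
    then have "frag_of (m, kA c (s X)) - frag_of (m, s (scale c X)) \<in> Q"
      by (intro diff_Q) (simp add: D_eq)
    moreover have "frag_of (kA c m, s X) - frag_of (m, kA c (s X)) \<in> Q"
      by (rule K2_Q) (rule ker_on_swap[where ra = "\<lambda>a c. kA c a"], auto)
    ultimately show "frag_of (kA c m, s X) - frag_of (m, s (scale c X)) \<in> Q"
      using diff_closed_trans[OF Q] by blast
  qed
  moreover have "sw x (\<lambda>a a'. frag_of (a, a') - frag_of (a, s (D a'))) \<in> Q"
    by (rule diff_closed_sw[OF Q]) (rule diff_Q[OF s_D])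
  ultimately have "x \<in> Q"
    using diff_closed_add[OF Q, of "sw x (\<lambda>a a'. frag_of (a, s (D a')))"
        "x - sw x (\<lambda>a a'. frag_of (a, s (D a')))"]
    by (simp add: sw_diff sw_sw sw_expansion)
  then show thesis unfolding Q_def using that by blast
qed

lemma flat_imp_coinvariants_AA_eq:
  assumes flat: "k_flat TYPE(('a \<times> 'h) frag set) kA"
  shows "coinvariants_AA_eq HR kA AR B"
proof -
  let ?KB = "k_tensor_ker kA B (+) kA"
  note K2 = diff_closed_tensor_ker_on[of UNIV "(+)" UNIV "(+)" UNIV "\<lambda>a c. kA c a" kA]
  note KB = diff_closed_tensor_ker_on[of UNIV "(+)" B "(+)" UNIV "\<lambda>a c. kA c a" kA]
  have ind: "induced K2 frag_of (coset ?KB y) = coset K2 y" for y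
    by (rule induced_frag_of_coset[OF K2 KB tensor_ker_on_mono]) simp
  have AB: "k_tensor kA B (+) kA = coset ?KB ` {y. Poly_Mapping.keys y \<subseteq> UNIV \<times> B}"
    by (simp add: tensor_on_def)
  show ?thesis
    unfolding coinvariants_AA_eq_def bij_betw_def
  proof
    show "inj_on (induced K2 frag_of) (k_tensor kA B (+) kA)"
      unfolding AB
    proof (rule inj_onI, elim imageE CollectE)
      fix X Y x y
      assume eq: "induced K2 frag_of X = induced K2 frag_of Y" "X = coset ?KB x" "Y = coset ?KB y"
        and keys: "Poly_Mapping.keys x \<subseteq> UNIV \<times> B" "Poly_Mapping.keys y \<subseteq> UNIV \<times> B"
      have "x - y \<in> K2" using eq by (simp add: ind coset_eq_iff[OF K2])
      moreover have "Poly_Mapping.keys (x - y) \<subseteq> UNIV \<times> B" using keys_diff[of x y] keys by blast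
      ultimately have "x - y \<in> ?KB" by (intro flat_coinvariants_inject[OF flat])
      then show "X = Y" by (simp add: eq coset_eq_iff[OF KB])
    qed
    show "induced K2 frag_of ` k_tensor kA B (+) kA = coinvariants_AA HR kA AR"
    proof (intro equalityI subsetI)
      fix X assume "X \<in> induced K2 frag_of ` k_tensor kA B (+) kA"
      then obtain y where "X = coset K2 y" "Poly_Mapping.keys y \<subseteq> UNIV \<times> B"
        unfolding AB by (auto simp: ind)
      then show "X \<in> coinvariants_AA HR kA AR"
        by (simp add: coset_in_coinvariants_AA defect2_coinvariants)
    next
      fix X assume X: "X \<in> coinvariants_AA HR kA AR"
      then obtain x where x: "X = coset K2 x"
        by (auto simp: coinvariants_AA_def tensor_on_UNIV)
      have "defect2 x \<in> K3" using X unfolding x coset_in_coinvariants_AA .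
      then obtain y where y: "Poly_Mapping.keys y \<subseteq> UNIV \<times> B" "x - y \<in> K2"
        by (rule flat_coinvariants_surject[OF flat])
      have "X = induced K2 frag_of (coset ?KB y)" using y(2) by (simp add: x ind coset_eq_iff[OF K2])
      then show "X \<in> induced K2 frag_of ` k_tensor kA B (+) kA" unfolding AB using y(1) by blast
    qed
  qed
qed

end

theorem corollary4p3:
  fixes kH :: "'k::{comm_ring,monoid_mult} \<Rightarrow> 'h::{ring,monoid_mult} \<Rightarrow> 'h"
    and kL :: "'k \<Rightarrow> 'l::{ring,monoid_mult} \<Rightarrow> 'l"
    and kR :: "'k \<Rightarrow> 'r::{ring,monoid_mult} \<Rightarrow> 'r"
    and HL :: "('h, 'l) bialgebroid"
    and HR :: "('h, 'r) bialgebroid"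
    and S :: "'h \<Rightarrow> 'h"
    and kA :: "'k \<Rightarrow> 'a::{ring,monoid_mult} \<Rightarrow> 'a"
    and AL :: "('a, 'l, 'h) comodule"
    and AR :: "('a, 'r, 'h) comodule"
    and B :: "'a set"
  assumes hopf: "hopf_algebroid kH kL kR HL HR S"
    and fgp: "fin_gen_projective_hopf_algebroid HL HR"
    and bij: "bij S"
    and ext: "extension kH kL kR HL HR kA AL AR B"
  shows "(coinvariants_AA_eq HR kA AR B \<and>
            can_R HR AR ` tensor_B B = tensor_on UNIV UNIV (ker_R HR AR)
            \<longrightarrow> galois_R HR AR B \<and> galois_L HL AL B) \<and>
         (k_flat TYPE(('a \<times> 'h) frag set) kA \<longrightarrow> coinvariants_AA_eq HR kA AR B) \<and>
         (galois_R HR AR B \<and> galois_L HL AL B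
            \<longrightarrow> left_projective B (*) \<and> right_projective B (*))"
proof -
  have A: "comodule_algebra kH kL kR HL HR kA AL AR" and B: "B = coinvariants_R HR AR"
    using ext by (simp_all add: extension_def)
  interpret A: comodule_algebra kH kL kR HL HR kA AL AR by (rule A)
  show ?thesis
    using galois_if_surj[OF hopf bij fgp A B] right_projective_if_galois[OF hopf bij fgp A B]
      left_projective_if_galois[OF hopf bij fgp A B] A.AR.flat_imp_coinvariants_AA_eq
    unfolding B by blast
qed

end
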